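(* Let $\Omega$ be an open, connected subset of $\mathbb{R}^n$, $n \geq 3$, let $\Gamma$ be a non-empty open subset of $\mathbb{R}^n$ and let $f\in C^0(\bar \Gamma)$ be such that $(f,\Gamma)$ satisfies the structural conditions (S1)--(S5) listed in the context. Assume that (i) $u_1 \in USC(\Omega;[0,\infty))$ and $u_2 \in LSC(\Omega;(0,\infty])$ are a sub-solution and a super-solution to $f(\lambda(A^u)) = 1$ in $\Omega$ in the viscosity sense, respectively, and (ii) $u_1 \leq u_2$ in $\Omega$. If one of $\ln u_1$ and $\ln u_2$ belongs to $C^{1,1}_{\rm loc}(\Omega)$, then either $u_1 \equiv u_2$ in $\Omega$ or $u_1 < u_2$ in $\Omega$.
   Context: For $n \geq 3$ and a positive function $u$, the conformal Hessian of $u$ is $$A^u = -\frac{2}{n-2} u^{-\frac{n+2}{n-2}} \nabla^2 u + \frac{2n}{(n-2)^2} u^{-\frac{2n}{n-2}} \nabla u \otimes \nabla u - \frac{2}{(n-2)^2} u^{-\frac{2n}{n-2}} |\nabla u|^2 I,$$ where $I$ is the $n\times n$ identity matrix; $\lambda(A^u)$ denotes the eigenvalues of $A^u$. Let $\Gamma_n := \{\mu \in \mathbb{R}^n: \mu_i > 0 \text{ for all } i\}$. Structural conditions on $(f,\Gamma)$: (S1) (symmetry) if $\lambda \in \Gamma$ and $\lambda'$ is a permutation of $\lambda$, then $\lambda' \in \Gamma$ and $f(\lambda') = f(\lambda)$. (S2) (ellipticity) if $\lambda \in \Gamma$ and $\mu \in \bar\Gamma_n$, then $\lambda + \mu \in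 \Gamma$ and $f(\lambda + \mu) \geq f(\lambda)$. (S3) (local strict ellipticity) for any compact subset $K$ of $\Gamma$, there is some constant $\delta(K) > 0$ such that $f(\lambda + \mu) - f(\lambda) \geq \delta(K) |\mu|$ for all $\lambda \in K$, $\mu \in \bar\Gamma_n$. (S4) (local Lipschitz) for any compact subset $K$ of $\Gamma$, there is some constant $C(K) > 0$ such that $|f(\lambda') - f(\lambda)| \leq C(K) |\lambda' - \lambda|$ for all $\lambda, \lambda' \in K$. (S5) $f^{-1}([1,\infty)) \subset \Gamma$. $USC(\Omega;S)$ and $LSC(\Omega;S)$ denote the upper, respectively lower, semi-continuous functions on $\Omega$ with values in $S$. Viscosity sub-/super-solutions of $f(\lambda(A^u))=1$ in an open set $\Omega$: - $u \in USC(\Omega;[0,\infty))$ is a viscosity sub-solution if for any $x_0\in\Omega$ and any positive $\varphi \in C^2(\Omega)$ with $(u-\varphi)(x_0)=0$ and $u-\varphi\leq 0$ near $x_0$, either $\lambda(A^\varphi(x_0)) \notin \bar\Gamma$ or $f(\lambda(A^\varphi(x_0))) \leq 1$. - $u \in LSC(\Omega;(0,\infty])$ is a viscosity super-solution if for any $x_0\in\Omega$ and any positive $\varphi \in C^2(\Omega)$ with $(u-\varphi)(x_0)=0$ and $u-\varphi\geq 0$ near $x_0$, one has $\lambda(A^\varphi(x_0)) \in \bar\Gamma$ and $f(\lambda(A^\varphi(x_0))) \geq 1$. *)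

theory Defs
  imports "HOL-Analysis.Analysis"
begin

definition grad :: "(real^'n \<Rightarrow> real) \<Rightarrow> real^'n \<Rightarrow> real^'n" where
  "grad u x = (\<chi> i. frechet_derivative u (at x) (axis i 1))"

definition hess :: "(real^'n \<Rightarrow> real) \<Rightarrow> real^'n \<Rightarrow> real^'n^'n" where
  "hess u x = jacobian (grad u) (at x)"

(* Both predicates below are meant for open W only: they use grad and hess, which are
   taken with respect to full neighbourhoods. *)

definition C2_on :: "(real^'n) set \<Rightarrow> (real^'n \<Rightarrow> real) \<Rightarrow> bool" where
  "C2_on W u \<longleftrightarrow> u differentiable_on W \<and> grad u differentiable_on W \<and> continuous_on W (hess u)"

definition C11_loc :: "(real^'n) set \<Rightarrow> (real^'n \<Rightarrow> real) \<Rightarrow> bool" where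
  "C11_loc W u \<longleftrightarrow>
     u differentiable_on W \<and>
     (\<forall>K. compact K \<and> K \<subseteq> W \<longrightarrow> (\<exists>L. L-lipschitz_on K (grad u)))"

definition usc_on :: "'a::topological_space set \<Rightarrow> ('a \<Rightarrow> 'b::linorder) \<Rightarrow> bool" where
  "usc_on W u \<longleftrightarrow> (\<forall>x0\<in>W. \<forall>c. u x0 < c \<longrightarrow> (\<forall>\<^sub>F x in at x0 within W. u x < c))"

definition lsc_on :: "'a::topological_space set \<Rightarrow> ('a \<Rightarrow> 'b::linorder) \<Rightarrow> bool" where
  "lsc_on W u \<longleftrightarrow> (\<forall>x0\<in>W. \<forall>c. c < u x0 \<longrightarrow> (\<forall>\<^sub>F x in at x0 within W. c < u x))"

definition outer_prod :: "real^'n \<Rightarrow> real^'n \<Rightarrow> real^'n^'n" where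
  "outer_prod v w = (\<chi> i j. v $ i * w $ j)"

definition conf_hess :: "(real^'n \<Rightarrow> real) \<Rightarrow> real^'n \<Rightarrow> real^'n^'n" where
  "conf_hess u x =
     (let n = real CARD('n) in
        (- (2 / (n - 2)) * u x powr (- ((n + 2) / (n - 2)))) *\<^sub>R hess u x
      + (2 * n / (n - 2)\<^sup>2 * u x powr (- (2 * n / (n - 2)))) *\<^sub>R outer_prod (grad u x) (grad u x)
      - (2 / (n - 2)\<^sup>2 * u x powr (- (2 * n / (n - 2))) * (norm (grad u x))\<^sup>2) *\<^sub>R mat 1)"

(* The vector of eigenvalues counted with multiplicity. It exists for every symmetric A and
   is unique up to a permutation of its entries; which ordering is chosen does not matter,
   because it is only used with permutation-invariant (f, G). *)
definition eigvals :: "real^'n^'n \<Rightarrow> real^'n" where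
  "eigvals A = (SOME l. \<forall>t. det (mat t - A) = (\<Prod>i\<in>UNIV. t - l $ i))"

definition Gamma_pos :: "(real^'n) set" where
  "Gamma_pos = {m. \<forall>i. 0 < m $ i}"

definition S1 :: "(real^'n \<Rightarrow> real) \<Rightarrow> (real^'n) set \<Rightarrow> bool" where
  "S1 f G \<longleftrightarrow>
     (\<forall>l\<in>G. \<forall>p. p permutes UNIV \<longrightarrow> (\<chi> i. l $ p i) \<in> G \<and> f (\<chi> i. l $ p i) = f l)"

definition S2 :: "(real^'n \<Rightarrow> real) \<Rightarrow> (real^'n) set \<Rightarrow> bool" where
  "S2 f G \<longleftrightarrow> (\<forall>l\<in>G. \<forall>m\<in>closure Gamma_pos. l + m \<in> G \<and> f (l + m) \<ge> f l)"

definition S3 :: "(real^'n \<Rightarrow> real) \<Rightarrow> (real^'n) set \<Rightarrow> bool" where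
  "S3 f G \<longleftrightarrow>
     (\<forall>K. compact K \<and> K \<subseteq> G \<longrightarrow>
        (\<exists>\<delta>>0. \<forall>l\<in>K. \<forall>m\<in>closure Gamma_pos. f (l + m) - f l \<ge> \<delta> * norm m))"

definition S4 :: "(real^'n \<Rightarrow> real) \<Rightarrow> (real^'n) set \<Rightarrow> bool" where
  "S4 f G \<longleftrightarrow>
     (\<forall>K. compact K \<and> K \<subseteq> G \<longrightarrow>
        (\<exists>C>0. \<forall>l\<in>K. \<forall>l'\<in>K. \<bar>f l' - f l\<bar> \<le> C * norm (l' - l)))"

(* f is a function on closure G, so preimages are taken there. *)
definition S5 :: "(real^'n \<Rightarrow> real) \<Rightarrow> (real^'n) set \<Rightarrow> bool" where
  "S5 f G \<longleftrightarrow> {l \<in> closure G. f l \<in> {1..}} \<subseteq> G"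

definition visc_sub ::
  "(real^'n \<Rightarrow> real) \<Rightarrow> (real^'n) set \<Rightarrow> (real^'n) set \<Rightarrow> (real^'n \<Rightarrow> real) \<Rightarrow> bool" where
  "visc_sub f G W u \<longleftrightarrow>
     (\<forall>x0\<in>W. \<forall>\<phi>. C2_on W \<phi> \<and> (\<forall>x\<in>W. 0 < \<phi> x) \<and>
        u x0 - \<phi> x0 = 0 \<and> (\<forall>\<^sub>F x in nhds x0. u x - \<phi> x \<le> 0) \<longrightarrow>
        eigvals (conf_hess \<phi> x0) \<notin> closure G \<or> f (eigvals (conf_hess \<phi> x0)) \<le> 1)"

definition visc_super ::
  "(real^'n \<Rightarrow> real) \<Rightarrow> (real^'n) set \<Rightarrow> (real^'n) set \<Rightarrow> (real^'n \<Rightarrow> ereal) \<Rightarrow> bool" where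
  "visc_super f G W u \<longleftrightarrow>
     (\<forall>x0\<in>W. \<forall>\<phi>. C2_on W \<phi> \<and> (\<forall>x\<in>W. 0 < \<phi> x) \<and>
        u x0 - ereal (\<phi> x0) = 0 \<and> (\<forall>\<^sub>F x in nhds x0. u x - ereal (\<phi> x) \<ge> 0) \<longrightarrow>
        eigvals (conf_hess \<phi> x0) \<in> closure G \<and> f (eigvals (conf_hess \<phi> x0)) \<ge> 1)"

end

(* The claim is a Hopf-type argument in viscosity form. Near an interior touching point pick a ball
   that meets the contact set only at one boundary point, and lower the C^{1,1} function by a small
   multiple of the barrier exp(-alpha |x - z|^2) - exp(-alpha rho^2), so that the difference of the
   two logarithms has an interior maximum. After doubling the variables with a quadratic penalty
   and perturbing by all small linear functions p, the slope p is a Lipschitz function of the contact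
   point; as the slopes fill a ball, the contact points are not negligible. By Rademacher's theorem
   the gradient of the C^{1,1} function is differentiable at one of them, which provides second order
   test functions for both sides, and no Alexandrov theorem is needed. For large alpha the gain
   alpha^2 in the direction x - z beats, by (S3), all errors of order alpha, controlled by (S4). *)

theory Submission
  imports Defs
begin

section \<open>Rademacher's theorem\<close>

text \<open>The obstacle is that one of the two functions is only semicontinuous and has no
  derivatives. After the doubling, the supremum over y of
  \<open>v y - \<mu> * (norm (x - y))\<^sup>2\<close> has a paraboloid below it at each contact
  point, and so does minus the regular function, while a linear function bounds the difference from
  above. These one-sided bounds make the slope Lipschitz, and a Lipschitz map cannot send a null set
  onto a ball. Keeping x - y fixed then carries the expansion of the regular function over to a test
  function for the other one. The constants are chosen in a strict order. \<open>R\<close> bounds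
  all jets and depends on the regular function only; (S3) and (S4) on a compact set determined by
  \<open>R\<close> give \<open>\<kappa>\<close> and \<open>\<theta>\<close>; then come
  \<open>\<alpha>\<close>, \<open>\<epsilon>\<close> and \<open>\<eta>\<close>, each depending on
  its predecessors. For logarithms the conformal Hessian is an exponential factor times a polynomial
  in the gradient and the Hessian, and a change of sign of both logarithms puts the regular one on
  top, so that one Hopf lemma serves both cases.\<close>

lemma lipschitz_right_derivative_ae:
  fixes G :: "real \<Rightarrow> real"
  assumes G: "L-lipschitz_on UNIV G"
  shows "negligible {x. \<not> (\<exists>d. ((\<lambda>t. (G (x + t) - G x) / t) \<longlongrightarrow> d) (at_right 0))}"
proof -
  have L0: "0 \<le> L" using G by (rule lipschitz_on_nonneg)
  have Glip: "\<bar>G x - G y\<bar> \<le> L * \<bar>x - y\<bar>" for x y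
    using lipschitz_onD[OF G, of x y] by (simp add: dist_real_def)
  \<comment> \<open>The added slope L + 1 makes F an increasing bi-Lipschitz bijection of the line;
    differentiating F amounts to differentiating G.\<close>
  define F where "F x = (L + 1) * x + G x" for x
  have Flow: "F b - F a \<ge> b - a" if "a \<le> b" for a b
    using Glip[of b a] that by (simp add: F_def algebra_simps)
  have Fup: "\<bar>F b - F a\<bar> \<le> (2 * L + 1) * \<bar>b - a\<bar>" for a b
  proof -
    have "\<bar>F b - F a\<bar> \<le> \<bar>(L + 1) * (b - a)\<bar> + \<bar>G b - G a\<bar>"
      by (simp add: F_def algebra_simps)
    also have "\<dots> \<le> (L + 1) * \<bar>b - a\<bar> + L * \<bar>b - a\<bar>"
      using Glip[of b a] L0 by (simp add: abs_mult)
    finally show ?thesis by (simp add: algebra_simps)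
  qed
  have contF: "continuous_on UNIV F"
    unfolding F_def using lipschitz_on_continuous_on[OF G] by (intro continuous_intros)
  have Fmono: "F a \<le> F b \<longleftrightarrow> a \<le> b" for a b
    using Flow[of a b] Flow[of b a] by linarith
  have Finj: "inj F" by (metis Fmono injI order_antisym order_refl)
  have Fsurj: "\<exists>x. F x = y" for y
  proof -
    define M where "M = \<bar>y\<bar> + \<bar>F 0\<bar>"
    have "M \<ge> 0" by (simp add: M_def)
    have "F (-M) \<le> y" "y \<le> F M"
      using Flow[of 0 M] Flow[of "-M" 0] \<open>M \<ge> 0\<close> unfolding M_def by linarith+
    then show ?thesis
      using IVT'[of F "-M" y M] \<open>M \<ge> 0\<close> continuous_on_subset[OF contF] by auto
  qed
  define K where "K = inv F"
  have FK: "F (K y) = y" for y using Fsurj[of y] unfolding K_def by (metis inv_f_f[OF Finj])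
  have KF: "K (F x) = x" for x unfolding K_def using Finj by simp
  have Klip: "\<bar>K x - K y\<bar> \<le> \<bar>x - y\<bar>" for x y
    using Flow[of "K x" "K y"] Flow[of "K y" "K x"] by (simp add: FK) linarith
  have contK: "continuous_on UNIV K"
    using Klip by (intro lipschitz_on_continuous_on[of 1] lipschitz_onI) (auto simp: dist_real_def)
  then have Kmeas [measurable]: "K \<in> borel_measurable borel"
    by (rule borel_measurable_continuous_onI)
  \<comment> \<open>The push-forward along the inverse K gives each set the length of its image
    under F. F maps null sets to null sets, so Radon-Nikodym yields a density, and F is its
    indefinite integral.\<close>
  define N where "N = distr lborel borel K"
  have setsN: "sets N = sets lborel" by (simp add: N_def)
  have Kvim: "K -` A = F ` A" for A
    by (auto simp: FK KF image_iff) (metis FK)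
  have "absolutely_continuous lborel N"
    unfolding absolutely_continuous_def
  proof
    fix A :: "real set" assume A: "A \<in> null_sets lborel"
    then have "negligible A"
      by (simp add: negligible_iff_null_sets null_sets_completionI)
    then have "negligible (F ` A)"
      using Fup by (intro negligible_locally_Lipschitz_image)
        (auto intro!: exI[of _ UNIV] exI[of _ "2 * L + 1"])
    then have "F ` A \<in> null_sets lebesgue" by (simp add: negligible_iff_null_sets)
    moreover have "F ` A \<in> sets lborel"
      using null_setsD2[OF A] measurable_sets[OF Kmeas, of A] by (simp flip: Kvim)
    ultimately have "emeasure lborel (F ` A) = 0"
      using null_sets_completion_iff[of "F ` A" lborel] by auto
    then show "A \<in> null_sets N"
      using A by (auto simp: N_def null_sets_def emeasure_distr Kvim)
  qed
  from sigma_finite_measure.Radon_Nikodym[OF sigma_finite_lborel this setsN] obtain f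
    where fm [measurable]: "f \<in> borel_measurable borel" and fd: "density lborel f = N" by auto
  have mass: "(\<integral>\<^sup>+x. f x * indicator {a..b} x \<partial>lborel) = ennreal (F b - F a)" if "a \<le> b" for a b
  proof -
    have "(\<integral>\<^sup>+x. f x * indicator {a..b} x \<partial>lborel) = emeasure N {a..b}"
      by (simp add: emeasure_density flip: fd)
    also have "\<dots> = emeasure lborel (F ` {a..b})"
      by (simp add: N_def emeasure_distr Kvim)
    also have "F ` {a..b} = {F a..F b}"
      by (auto simp: Fmono image_iff) (metis FK Fmono atLeastAtMost_iff)
    finally show ?thesis using that Fmono[of a b] by simp
  qed
  have fin: "AE x in lborel. f x \<noteq> \<infinity>"
  proof -
    have "AE x in lborel. f x * indicator {- real k..real k} x \<noteq> \<infinity>" for k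
      by (rule nn_integral_PInf_AE) (auto simp: mass)
    then have "AE x in lborel. \<forall>k. f x * indicator {- real k..real k} x \<noteq> \<infinity>"
      by (simp add: AE_all_countable)
    then show ?thesis
    proof eventually_elim
      case (elim x)
      obtain k where "\<bar>x\<bar> \<le> real k" using real_arch_simple by blast
      then have "x \<in> {- real k..real k}" by auto
      then show ?case using elim[rule_format, of k] by simp
    qed
  qed
  define h where "h x = enn2real (f x)" for x
  have hint: "(h has_integral (F b - F a)) {a..b}" if "a \<le> b" for a b
  proof -
    have "(\<integral>\<^sup>+x. ennreal (h x * indicator {a..b} x) \<partial>lborel) = (\<integral>\<^sup>+x. f x * indicator {a..b} x \<partial>lborel)"
      using fin by (intro nn_integral_cong_AE) (auto simp: h_def ennreal_mult' ennreal_indicator less_top elim!: eventually_mono)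
    then have "((\<lambda>x. h x * indicator {a..b} x) has_integral (F b - F a)) UNIV"
      using that Fmono[of a b] by (intro nn_integral_has_integral) (auto simp: mass h_def)
    moreover have "(\<lambda>x. h x * indicator {a..b} x) = (\<lambda>x. if x \<in> {a..b} then h x else 0)"
      by (auto simp: fun_eq_iff indicator_def)
    ultimately show ?thesis by (simp only: has_integral_restrict_UNIV)
  qed
  have "h integrable_on cbox a b" for a b
    using hint[of a b] by (cases "a \<le> b") (auto simp: integrable_on_def cbox_interval)
  \<comment> \<open>Lebesgue differentiation over cubes with lower corner x, here the intervals from
    x to x + t: hence the derivative from the right.\<close>
  from integrable_ccontinuous_explicit[of h, OF this] obtain N where N: "negligible N" 
    and lim: "\<And>x e. x \<notin> N \<Longrightarrow> 0 < e \<Longrightarrow>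
      \<exists>d>0. \<forall>t. 0 < t \<and> t < d \<longrightarrow> norm (integral (cbox x (x + t *\<^sub>R One)) h /\<^sub>R t ^ DIM(real) - h x) < e"
    by metis
  show ?thesis
  proof (rule negligible_subset[OF N], clarify, rule ccontr)
    fix x assume "\<nexists>d. ((\<lambda>t. (G (x + t) - G x) / t) \<longlongrightarrow> d) (at_right 0)" and "x \<notin> N"
    moreover have "((\<lambda>t. (G (x + t) - G x) / t) \<longlongrightarrow> h x - (L + 1)) (at_right 0)"
    proof (rule tendstoI)
      fix e :: real assume "e > 0"
      from lim[OF \<open>x \<notin> N\<close> this] obtain d where "d > 0" and
        d: "\<And>t. 0 < t \<Longrightarrow> t < d \<Longrightarrow> norm (integral (cbox x (x + t *\<^sub>R One)) h /\<^sub>R t ^ DIM(real) - h x) < e"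
        by blast
      have "dist ((G (x + t) - G x) / t) (h x - (L + 1)) < e" if "0 < t" "t < d" for t
        using d[OF that] that integral_unique[OF hint[of x "x + t"]]
        by (simp add: cbox_interval dist_real_def F_def field_simps)
      then show "\<forall>\<^sub>F t in at_right 0. dist ((G (x + t) - G x) / t) (h x - (L + 1)) < e"
        using \<open>d > 0\<close> by (auto simp: eventually_at_right_field)
    qed
    ultimately show False by blast
  qed
qed

section \<open>Almost everywhere existence and linearity of directional derivatives\<close>

definition diff_quot :: "('a::real_normed_vector \<Rightarrow> real) \<Rightarrow> 'a \<Rightarrow> 'a \<Rightarrow> real \<Rightarrow> real" where
  "diff_quot G v x t = (G (x + t *\<^sub>R v) - G x) / t"

lemma diff_quot_bound:
  assumes "L-lipschitz_on UNIV G" shows "\<bar>diff_quot G v x t\<bar> \<le> L * norm v"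
proof (cases "t = 0")
  case False
  have "\<bar>G (x + t *\<^sub>R v) - G x\<bar> \<le> L * (\<bar>t\<bar> * norm v)"
    using lipschitz_onD[OF assms, of "x + t *\<^sub>R v" x] by (simp add: dist_norm)
  then show ?thesis using False by (simp add: diff_quot_def field_simps)
qed (use lipschitz_on_nonneg[OF assms] in \<open>simp add: diff_quot_def\<close>)

text \<open>The Cauchy criterion with countable outer quantifiers n and m. The uncountable ones over
  s and t will only intersect closed sets, so the set where the limit exists is Borel.\<close>

lemma convergent_at_right_iff_Cauchy:
  fixes q :: "real \<Rightarrow> real"
  shows "(\<exists>d. (q \<longlongrightarrow> d) (at_right 0)) \<longleftrightarrow>
    (\<forall>n. \<exists>m. \<forall>s t. 0 < s \<and> s < inverse (real (Suc m)) \<and> 0 < t \<and> t < inverse (real (Suc m)) \<longrightarrow>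
       \<bar>q s - q t\<bar> \<le> inverse (real (Suc n)))" (is "?L \<longleftrightarrow> ?R")
proof
  assume ?L
  then obtain d where d: "(q \<longlongrightarrow> d) (at_right 0)" by blast
  show ?R
  proof
    fix n
    have "\<forall>\<^sub>F t in at_right 0. dist (q t) d < inverse (real (Suc n)) / 2"
      by (rule tendstoD[OF d]) simp
    then obtain b where "b > 0" and b: "\<And>t. 0 < t \<Longrightarrow> t < b \<Longrightarrow> dist (q t) d < inverse (real (Suc n)) / 2"
      by (auto simp: eventually_at_right_field)
    obtain m where m: "inverse (real (Suc m)) < b" using reals_Archimedean[OF \<open>b > 0\<close>] by blast
    have "\<bar>q s - q t\<bar> \<le> inverse (real (Suc n))"
      if "0 < s \<and> s < inverse (real (Suc m)) \<and> 0 < t \<and> t < inverse (real (Suc m))" for s t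
    proof -
      have "dist (q s) d < inverse (real (Suc n)) / 2" "dist (q t) d < inverse (real (Suc n)) / 2"
        using that m by (intro b; linarith)+
      then show ?thesis unfolding dist_real_def by linarith
    qed
    then show "\<exists>m. \<forall>s t. 0 < s \<and> s < inverse (real (Suc m)) \<and> 0 < t \<and> t < inverse (real (Suc m)) \<longrightarrow>
       \<bar>q s - q t\<bar> \<le> inverse (real (Suc n))" by blast
  qed
next
  assume R: ?R
  define X where "X k = q (inverse (real (Suc k)))" for k
  have "Cauchy X"
  proof (rule metric_CauchyI)
    fix e :: real assume "e > 0"
    then obtain n where n: "inverse (real (Suc n)) < e" using reals_Archimedean by blast
    obtain m where m: "\<And>s t. 0 < s \<and> s < inverse (real (Suc m)) \<and> 0 < t \<and> t < inverse (real (Suc m)) \<Longrightarrow>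
       \<bar>q s - q t\<bar> \<le> inverse (real (Suc n))" using R by blast
    have "dist (X i) (X j) < e" if "i \<ge> Suc m" "j \<ge> Suc m" for i j
      using m[of "inverse (real (Suc i))" "inverse (real (Suc j))"] n that
      by (simp add: X_def dist_real_def)
    then show "\<exists>M. \<forall>i\<ge>M. \<forall>j\<ge>M. dist (X i) (X j) < e" by blast
  qed
  then obtain d where d: "X \<longlonglongrightarrow> d" using convergent_eq_Cauchy by blast
  have "(q \<longlongrightarrow> d) (at_right 0)"
  proof (rule tendstoI)
    fix e :: real assume "e > 0"
    then obtain n where n: "inverse (real (Suc n)) < e / 2" using reals_Archimedean[of "e/2"] by auto
    obtain m where m: "\<And>s t. 0 < s \<and> s < inverse (real (Suc m)) \<and> 0 < t \<and> t < inverse (real (Suc m)) \<Longrightarrow>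
       \<bar>q s - q t\<bar> \<le> inverse (real (Suc n))" using R by blast
    from tendstoD[OF d, of "e/2"] \<open>e > 0\<close> obtain K where K: "\<And>k. k \<ge> K \<Longrightarrow> dist (X k) d < e / 2"
      by (auto simp: eventually_sequentially)
    have "dist (q t) d < e" if "0 < t" "t < inverse (real (Suc m))" for t
    proof -
      have "inverse (real (Suc (max K (Suc m)))) < inverse (real (Suc m))" by simp
      then have "\<bar>q t - X (max K (Suc m))\<bar> \<le> inverse (real (Suc n))"
        using that unfolding X_def by (intro m) auto
      then show ?thesis using K[of "max K (Suc m)"] n unfolding dist_real_def by linarith
    qed
    then show "\<forall>\<^sub>F t in at_right 0. dist (q t) d < e"
      unfolding eventually_at_right_field
      by (intro exI[of _ "inverse (real (Suc m))"]) auto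
  qed
  then show ?L by blast
qed

text \<open>On each line in direction v the one-dimensional result applies. Instead of rotating
  coordinates, the points x + t v are regarded as a function of the pair (x, t): for every x almost
  every t is good, so by Fubini some t is good for almost every x, and translation by t v preserves
  Lebesgue measure.\<close>

lemma lipschitz_directional_derivative_ae:
  fixes G :: "'a::euclidean_space \<Rightarrow> real"
  assumes G: "L-lipschitz_on UNIV G"
  shows "AE x in lborel. \<exists>d. (diff_quot G v x \<longlongrightarrow> d) (at_right 0)"
proof -
  have contG: "continuous_on UNIV G" by (rule lipschitz_on_continuous_on[OF G])
  let ?I = "\<lambda>m. {0<..<inverse (real (Suc m))}"
  define P where "P x \<longleftrightarrow> (\<exists>d. (diff_quot G v x \<longlongrightarrow> d) (at_right 0))" for x
  have "{x. P x} = (\<Inter>n. \<Union>m. \<Inter>s\<in>?I m. \<Inter>t\<in>?I m.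
      {x. \<bar>diff_quot G v x s - diff_quot G v x t\<bar> \<le> inverse (real (Suc n))})"
    unfolding P_def convergent_at_right_iff_Cauchy by (simp add: set_eq_iff) (simp add: Ball_def imp_conjL)
  moreover have "closed {x. \<bar>diff_quot G v x s - diff_quot G v x t\<bar> \<le> inverse (real (Suc n))}" for s t n
    unfolding diff_quot_def divide_inverse
    by (intro closed_Collect_le continuous_intros continuous_on_compose2[OF contG]) auto
  ultimately have meas: "{x. P x} \<in> sets borel"
    by (simp only:) (intro sets.countable_INT sets.countable_UN image_subsetI borel_closed closed_INT ballI; simp)
  then have [measurable]: "Measurable.pred borel P" by (simp add: pred_def)
  have line: "AE t in lborel. P (x + t *\<^sub>R v)" for x
  proof -
    define \<gamma> where "\<gamma> t = G (x + t *\<^sub>R v)" for t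
    have "(L * norm v)-lipschitz_on UNIV \<gamma>"
    proof (rule lipschitz_onI)
      show "dist (\<gamma> s) (\<gamma> t) \<le> L * norm v * dist s t" for s t
        using lipschitz_onD[OF G, of "x + s *\<^sub>R v" "x + t *\<^sub>R v"]
        by (simp add: \<gamma>_def dist_norm mult_ac flip: scaleR_left_diff_distrib)
    qed (use lipschitz_on_nonneg[OF G] in simp)
    from lipschitz_right_derivative_ae[OF this]
    have "negligible {t. \<not> P (x + t *\<^sub>R v)}"
      by (simp add: P_def diff_quot_def[abs_def] \<gamma>_def algebra_simps)
    then have "{t. \<not> P (x + t *\<^sub>R v)} \<in> null_sets lebesgue" by (simp add: negligible_iff_null_sets)
    then have "AE t in lebesgue. P (x + t *\<^sub>R v)" by (rule AE_I') auto
    then show ?thesis by (simp add: AE_completion_iff)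
  qed
  have "AE x in (lborel :: 'a measure). AE t in (lborel :: real measure). P (x + t *\<^sub>R v)"
    using line by simp
  moreover have "{z \<in> space ((lborel :: 'a measure) \<Otimes>\<^sub>M (lborel :: real measure)). P (fst z + snd z *\<^sub>R v)}
      \<in> sets ((lborel :: 'a measure) \<Otimes>\<^sub>M (lborel :: real measure))"
    by measurable
  ultimately have "AE t in (lborel :: real measure). AE x in (lborel :: 'a measure). P (x + t *\<^sub>R v)"
    by (subst (asm) lborel_pair.AE_commute)
  then have "\<exists>t::real. AE x in (lborel :: 'a measure). P (x + t *\<^sub>R v)"
    by (rule eventually_happens'[rotated]) (simp add: ae_filter_eq_bot_iff)
  then obtain t where "AE x in (lborel :: 'a measure). P (x + t *\<^sub>R v)" by blast
  then have "AE x in distr lborel borel ((+) (t *\<^sub>R v)). P x"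
    by (subst AE_distr_iff) (auto simp: add.commute meas)
  then show ?thesis by (simp only: lborel_distr_plus P_def)
qed

text \<open>The defect of additivity is a difference of two translates of one bounded difference
  quotient. Integrated over a box, the translation can be moved onto the box, so the limit
  \<open>E\<close> has integral 0 over every box and vanishes almost everywhere by Lebesgue
  differentiation.\<close>

lemma directional_derivative_add_ae:
  fixes G :: "'a::euclidean_space \<Rightarrow> real"
  assumes G: "L-lipschitz_on UNIV G"
    and a: "AE x in lborel. (diff_quot G v x \<longlongrightarrow> a x) (at_right 0)"
    and b: "AE x in lborel. (diff_quot G w x \<longlongrightarrow> b x) (at_right 0)"
  shows "AE x in lborel. (diff_quot G (v + w) x \<longlongrightarrow> a x + b x) (at_right 0)"
proof -
  \<comment> \<open>A fixed sequence of step sizes makes the limits measurable and allows dominated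
    convergence.\<close>
  define r where "r k = inverse (real (Suc k))" for k
  have r: "r k > 0" "r k \<noteq> 0" for k by (auto simp: r_def)
  have rlim: "filterlim r (at_right 0) sequentially"
    unfolding r_def[abs_def] filterlim_at using LIMSEQ_inverse_real_of_nat by (auto intro!: always_eventually)
  have r0: "r \<longlonglongrightarrow> 0" using rlim by (simp add: filterlim_at)
  define q where "q u k x = diff_quot G u x (r k)" for u k x
  define D where "D u x = lim (\<lambda>k. q u k x)" for u x
  have contG: "continuous_on UNIV G" by (rule lipschitz_on_continuous_on[OF G])
  then have Gm [measurable]: "G \<in> borel_measurable borel" by (rule borel_measurable_continuous_onI)
  have qm [measurable]: "q u k \<in> borel_measurable borel" for u k
    unfolding q_def diff_quot_def by measurable
  have Dm [measurable]: "D u \<in> borel_measurable borel" for u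
    unfolding D_def by measurable
  have qb: "\<bar>q u k x\<bar> \<le> L * norm u" for u k x
    unfolding q_def by (rule diff_quot_bound[OF G])
  have Dlim: "(\<lambda>k. q u k x) \<longlonglongrightarrow> d \<and> D u x = d" if "(diff_quot G u x \<longlongrightarrow> d) (at_right 0)" for u x d
    using filterlim_compose[OF that rlim] unfolding q_def D_def by (simp add: limI)
  have Dae: "AE x in lborel. (diff_quot G u x \<longlongrightarrow> D u x) (at_right 0)" for u
    using lipschitz_directional_derivative_ae[OF G, of u]
  proof eventually_elim
    case (elim x)
    then obtain d where d: "(diff_quot G u x \<longlongrightarrow> d) (at_right 0)" by blast
    with Dlim[OF d] show ?case by simp
  qed
  define h where "h k x = q (v + w) k x - q v k x - q w k x" for k x
  define E where "E x = D (v + w) x - D v x - D w x" for x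
  have hm [measurable]: "h k \<in> borel_measurable borel" for k unfolding h_def by measurable
  have Em [measurable]: "E \<in> borel_measurable borel" unfolding E_def by measurable
  have hE: "AE x in lborel. (\<lambda>k. h k x) \<longlonglongrightarrow> E x"
    using Dae[of "v + w"] Dae[of v] Dae[of w]
  proof eventually_elim
    case (elim x)
    show ?case unfolding h_def E_def
      by (intro tendsto_diff Dlim[THEN conjunct1] elim)
  qed
  have hq: "h k x = q w k (x + r k *\<^sub>R v) - q w k x" for k x
    using r[of k] by (simp add: h_def q_def diff_quot_def field_simps)
  define M where "M = L * norm w"
  have M0: "M \<ge> 0" using lipschitz_on_nonneg[OF G] by (simp add: M_def)
  have qM: "\<bar>q w k x\<bar> \<le> M" for k x
    using qb by (simp add: M_def)
  have hb: "\<bar>h k x\<bar> \<le> 2 * M" for k x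
    using qb[of w k x] qb[of w k "x + r k *\<^sub>R v"] unfolding hq M_def by linarith
  have zero: "((\<lambda>x. indicator (cbox c d) x * E x) has_integral 0) UNIV" for c d :: 'a
  proof -
    let ?Q = "cbox c d"
    let ?i = "indicator ?Q :: 'a \<Rightarrow> real"
    have iQ: "integrable lborel (\<lambda>x. ?i x * C)" for C
      by (intro integrable_mult_left integrable_real_indicator) (auto simp: emeasure_lborel_cbox_eq)
    have ae: "AE x in lborel. (\<lambda>k. ?i x * h k x) \<longlonglongrightarrow> ?i x * E x"
      using hE by eventually_elim (intro tendsto_intros)
    have bd: "AE x in lborel. norm (?i x * h k x) \<le> ?i x * (2 * M)" for k
      using hb[of k] by (intro AE_I2) (auto simp: abs_mult indicator_def)
    have int: "integrable lborel (\<lambda>x. ?i x * E x)"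
      by (rule integrable_dominated_convergence[OF _ _ iQ[of "2*M"] ae bd]) simp_all
    have conv: "(\<lambda>k. \<integral>x. ?i x * h k x \<partial>lborel) \<longlonglongrightarrow> (\<integral>x. ?i x * E x \<partial>lborel)"
      by (rule integral_dominated_convergence[OF _ _ iQ[of "2*M"] ae bd]) simp_all
    obtain R where "R > 0" and R: "\<And>x. x \<in> ?Q \<Longrightarrow> norm x \<le> R"
      using bounded_cbox[of c d] by (meson bounded_pos)
    define S where "S = R + norm v"
    \<comment> \<open>After the change of variables the regularity of q is irrelevant: it is bounded
      by \<open>M\<close>, and the difference of the two indicators tends to 0 off the null boundary
      of the box.\<close>
    have shift: "(\<integral>x. ?i x * h k x \<partial>lborel) = (\<integral>x. (?i (x - r k *\<^sub>R v) - ?i x) * q w k x \<partial>lborel)" for k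
    proof -
      have i1: "integrable lborel (\<lambda>x. ?i x * q w k x)"
        by (rule Bochner_Integration.integrable_bound[OF iQ[of M]])
          (use qM M0 in \<open>auto simp: abs_mult indicator_def intro!: AE_I2\<close>)
      have i2: "integrable lborel (\<lambda>x. ?i x * q w k (x + r k *\<^sub>R v))"
        by (rule Bochner_Integration.integrable_bound[OF iQ[of M]])
          (use qM M0 in \<open>auto simp: abs_mult indicator_def intro!: AE_I2\<close>)
      have tr: "distr lborel borel ((+) (r k *\<^sub>R v)) = (lborel :: 'a measure)" by (rule lborel_distr_plus)
      have i3: "integrable lborel (\<lambda>x. ?i (x - r k *\<^sub>R v) * q w k x)"
        by (subst tr[symmetric], subst integrable_distr_eq) (use i2 in \<open>simp_all add: add.commute\<close>)
      have "(\<integral>x. ?i (x - r k *\<^sub>R v) * q w k x \<partial>lborel) = (\<integral>x. ?i x * q w k (x + r k *\<^sub>R v) \<partial>lborel)"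
        by (subst tr[symmetric], subst integral_distr) (simp_all add: add.commute)
      then show ?thesis
        by (simp add: hq ring_distribs i1 i2 i3)
    qed
    have bS: "integrable lborel (\<lambda>x. indicator (cball 0 S) x * M :: real)"
      by (intro integrable_mult_left integrable_real_indicator) (use emeasure_bounded_finite[OF bounded_cball, of 0 S] in simp_all)
    have "(\<lambda>k. \<integral>x. (?i (x - r k *\<^sub>R v) - ?i x) * q w k x \<partial>lborel) \<longlonglongrightarrow> (\<integral>x. 0 \<partial>(lborel :: 'a measure))"
    proof (rule integral_dominated_convergence[OF _ _ bS])
      have "negligible (frontier ?Q)" by (simp add: negligible_convex_frontier)
      then have "frontier ?Q \<in> null_sets lborel"
        by (simp add: negligible_iff_null_sets null_sets_completion_iff)
      then have "AE x in lborel. x \<notin> frontier ?Q" by (rule AE_not_in)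
      then show "AE x in lborel. (\<lambda>k. (?i (x - r k *\<^sub>R v) - ?i x) * q w k x) \<longlonglongrightarrow> 0"
      proof eventually_elim
        case (elim x)
        have lim: "(\<lambda>k. x - r k *\<^sub>R v) \<longlonglongrightarrow> x"
          using tendsto_diff[OF tendsto_const tendsto_scaleR[OF r0 tendsto_const], of x v] by simp
        have "x \<in> interior ?Q \<or> x \<in> - ?Q"
          using elim by (auto simp: frontier_def)
        then have "\<forall>\<^sub>F k in sequentially. ?i (x - r k *\<^sub>R v) - ?i x = 0"
        proof
          assume "x \<in> interior ?Q"
          then have ev: "\<forall>\<^sub>F k in sequentially. x - r k *\<^sub>R v \<in> interior ?Q" and xQ: "x \<in> ?Q"
            using topological_tendstoD[OF lim open_interior] interior_subset[of ?Q] by blast+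
          from ev show ?thesis
          proof eventually_elim
            case (elim k)
            then have "x - r k *\<^sub>R v \<in> ?Q" using interior_subset[of ?Q] by blast
            then show ?case using xQ by simp
          qed
        next
          assume "x \<in> - ?Q"
          then show ?thesis
            using topological_tendstoD[OF lim, of "- ?Q"]
            by (auto elim!: eventually_mono simp: indicator_def open_Compl)
        qed
        then show ?case by (rule tendsto_eventually[OF eventually_mono]) simp
      qed
      show "AE x in lborel. norm ((?i (x - r k *\<^sub>R v) - ?i x) * q w k x) \<le> indicator (cball 0 S) x * M" for k
      proof (intro AE_I2)
        fix x
        show "norm ((?i (x - r k *\<^sub>R v) - ?i x) * q w k x) \<le> indicator (cball 0 S) x * M"
        proof (cases "x \<in> cball 0 S")
          case True
          have "\<bar>?i (x - r k *\<^sub>R v) - ?i x\<bar> \<le> 1" by (auto simp: indicator_def)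
          from mult_mono[OF this qb[of w k x]] True show ?thesis by (simp add: abs_mult M_def)
        next
          case False
          have "norm x \<le> norm (x - r k *\<^sub>R v) + norm (r k *\<^sub>R v)"
            by (metis diff_add_cancel norm_triangle_ineq)
          moreover have "norm (r k *\<^sub>R v) \<le> norm v"
          proof -
            have "r k \<le> 1" by (simp add: r_def field_simps)
            then show ?thesis using r[of k] by (simp add: mult_left_le_one_le)
          qed
          moreover have "norm x > R + norm v" using False by (simp add: S_def)
          ultimately have "x \<notin> ?Q" "x - r k *\<^sub>R v \<notin> ?Q"
            using R[of x] R[of "x - r k *\<^sub>R v"] norm_ge_zero[of v] by linarith+
          then show ?thesis using False by simp
        qed
      qed
    qed simp_all
    with conv have "(\<integral>x. ?i x * E x \<partial>lborel) = 0"
      unfolding shift by (simp add: LIMSEQ_unique)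
    with has_integral_integral_lborel[OF int] show ?thesis by simp
  qed
  have E0: "(E has_integral 0) (cbox c d)" for c d
  proof -
    have "(\<lambda>x. indicator (cbox c d) x * E x) = (\<lambda>x. if x \<in> cbox c d then E x else 0)"
      by (auto simp: fun_eq_iff)
    then show ?thesis using zero[of c d] by (simp only: has_integral_restrict_UNIV)
  qed
  then have "E integrable_on cbox c d" for c d by blast
  from integrable_ccontinuous_explicit[of E, OF this] obtain N where N: "negligible N"
    and lim: "\<And>x e. x \<notin> N \<Longrightarrow> 0 < e \<Longrightarrow>
      \<exists>d>0. \<forall>t. 0 < t \<and> t < d \<longrightarrow> norm (integral (cbox x (x + t *\<^sub>R One)) E /\<^sub>R t ^ DIM('a) - E x) < e"
    by metis
  have "E x = 0" if "x \<notin> N" for x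
  proof (rule ccontr)
    assume "E x \<noteq> 0"
    with lim[OF that, of "\<bar>E x\<bar>"] obtain d where "d > 0" and
      d: "\<And>t. 0 < t \<Longrightarrow> t < d \<Longrightarrow> norm (integral (cbox x (x + t *\<^sub>R One)) E /\<^sub>R t ^ DIM('a) - E x) < \<bar>E x\<bar>"
      by auto
    then show False using d[of "d/2"] integral_unique[OF E0] by simp
  qed
  then have "AE x in lebesgue. E x = 0"
    using N by (intro AE_I'[of N]) (auto simp: negligible_iff_null_sets)
  then have "AE x in lborel. E x = 0" by (simp add: AE_completion_iff)
  with Dae[of "v + w"] Dae[of v] Dae[of w] a b show ?thesis
  proof eventually_elim
    case (elim x)
    have "a x = D v x" "b x = D w x"
      using Dlim[OF elim(4)] Dlim[OF elim(5)] by simp_all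
    then have "a x + b x = D (v + w) x" using elim(6) by (simp add: E_def)
    then show ?case using elim(1) by simp
  qed
qed

lemma directional_derivative_scale_ae:
  fixes G :: "'a::euclidean_space \<Rightarrow> real"
  assumes G: "L-lipschitz_on UNIV G"
    and a: "AE x in lborel. (diff_quot G v x \<longlongrightarrow> a x) (at_right 0)"
  shows "AE x in lborel. (diff_quot G (c *\<^sub>R v) x \<longlongrightarrow> c * a x) (at_right 0)"
proof -
  have pos: "(diff_quot G (c *\<^sub>R v) x \<longlongrightarrow> c * d) (at_right 0)"
    if "c > 0" "(diff_quot G v x \<longlongrightarrow> d) (at_right 0)" for c v x d
  proof -
    have "filterlim (\<lambda>t. c * t) (at_right 0) (at_right 0)"
      unfolding filterlim_at using \<open>c > 0\<close>
      by (auto intro!: tendsto_eq_intros eventually_at_right_less[THEN eventually_mono])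
    from tendsto_mult_left[OF filterlim_compose[OF that(2) this], of c]
    show ?thesis using \<open>c > 0\<close> by (simp add: diff_quot_def[abs_def] mult.commute)
  qed
  have zero: "(diff_quot G 0 x \<longlongrightarrow> d) (at_right 0) \<longleftrightarrow> d = 0" for x d
    by (auto simp: diff_quot_def[abs_def] tendsto_const_iff)
  show ?thesis
  proof (cases c "0 :: real" rule: linorder_cases)
    case greater
    show ?thesis using a by eventually_elim (rule pos[OF greater])
  next
    case equal
    then show ?thesis by (simp add: zero)
  next
    case less
    define b where "b x = (SOME d. (diff_quot G (c *\<^sub>R v) x \<longlongrightarrow> d) (at_right 0))" for x
    have bae: "AE x in lborel. (diff_quot G (c *\<^sub>R v) x \<longlongrightarrow> b x) (at_right 0)"
      using lipschitz_directional_derivative_ae[OF G, of "c *\<^sub>R v"]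
      unfolding b_def by eventually_elim (rule someI_ex)
    have "AE x in lborel. (diff_quot G ((- c) *\<^sub>R v) x \<longlongrightarrow> - c * a x) (at_right 0)"
      using a by eventually_elim (rule pos, use less in auto)
    \<comment> \<open>One-sided quotients do not scale by a negative c. The opposite directions - c
      v and c v, however, add up to 0, where every quotient vanishes, so additivity determines
      \<open>b x\<close>.\<close>
    from directional_derivative_add_ae[OF G this bae] bae show ?thesis
    proof eventually_elim
      case (elim x)
      then have "- c * a x + b x = 0" using zero[of x "- c * a x + b x"] by simp
      then have "b x = c * a x" by linarith
      then show ?case using elim by simp
    qed
  qed
qed

text \<open>Finitely many directions of D are \<open>e'\<close>-dense in the compact unit sphere,
  and the limits along them are uniform. The Lipschitz bounds of G and of A pass from these to all
  directions.\<close>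

lemma has_derivative_if_dense_directions:
  fixes G :: "'a::euclidean_space \<Rightarrow> real"
  assumes G: "L-lipschitz_on UNIV G"
    and dense: "\<And>U. open U \<Longrightarrow> U \<noteq> {} \<Longrightarrow> \<exists>d\<in>D. d \<in> U"
    and lim: "\<And>v. v \<in> D \<Longrightarrow> (diff_quot G v x \<longlongrightarrow> A v) (at_right 0)"
    and A: "bounded_linear A"
  shows "(G has_derivative A) (at x)"
  unfolding has_derivative_at_alt
proof (intro conjI A allI impI)
  fix e :: real assume "e > 0"
  interpret bounded_linear A by (rule A)
  obtain K where K: "K > 0" "\<And>u. norm (A u) \<le> norm u * K" using pos_bounded by metis
  have L0: "L \<ge> 0" by (rule lipschitz_on_nonneg[OF G])
  \<comment> \<open>Three errors add up: L e' for replacing the direction in G, e' for the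
    difference quotient, K e' for replacing the direction in A.\<close>
  define e' where "e' = e / (L + K + 1)"
  have "e' > 0" using \<open>e > 0\<close> L0 K by (simp add: e'_def)
  have "sphere 0 1 \<subseteq> (\<Union>d\<in>D. ball d e')"
  proof
    fix u :: 'a
    show "u \<in> (\<Union>d\<in>D. ball d e')"
      using dense[of "ball u e'"] \<open>e' > 0\<close> by (auto simp: dist_commute)
  qed
  then obtain F where F: "F \<subseteq> D" "finite F" "sphere 0 1 \<subseteq> (\<Union>d\<in>F. ball d e')"
    by (rule compactE_image[OF compact_sphere, of D "\<lambda>d. ball d e'", rotated]) auto
  have "\<forall>\<^sub>F t in at_right 0. \<forall>d\<in>F. dist (diff_quot G d x t) (A d) < e'"
    unfolding eventually_ball_finite_distrib[OF F(2)]
    using F(1) \<open>e' > 0\<close> by (auto intro!: tendstoD[OF lim])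
  then obtain \<delta> where "\<delta> > 0" and \<delta>: "\<And>t d. 0 < t \<Longrightarrow> t < \<delta> \<Longrightarrow> d \<in> F \<Longrightarrow> dist (diff_quot G d x t) (A d) < e'"
    by (auto simp: eventually_at_right_field)
  have "norm (G y - G x - A (y - x)) \<le> e * norm (y - x)" if "norm (y - x) < \<delta>" for y
  proof (cases "y = x")
    case False
    define t where "t = norm (y - x)"
    define u where "u = (y - x) /\<^sub>R t"
    have t: "0 < t" "t < \<delta>" using False that by (auto simp: t_def)
    have y: "y = x + t *\<^sub>R u" using t by (simp add: u_def)
    have "norm u = 1" using t by (simp add: u_def t_def)
    then obtain d where d: "d \<in> F" "norm (u - d) < e'" using F(3) by (force simp: dist_norm norm_minus_commute)
    have "\<bar>G y - G (x + t *\<^sub>R d)\<bar> \<le> L * (t * norm (u - d))"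
      using lipschitz_onD[OF G, of y "x + t *\<^sub>R d"] t
      by (simp add: y dist_norm flip: scaleR_diff_right)
    also have "\<dots> \<le> L * (t * e')" using d t L0 by (intro mult_left_mono) auto
    finally have 1: "\<bar>G y - G (x + t *\<^sub>R d)\<bar> \<le> t * (L * e')" by (simp add: mult_ac)
    have "\<bar>G (x + t *\<^sub>R d) - G x - t * A d\<bar> = t * \<bar>diff_quot G d x t - A d\<bar>"
      using t by (simp add: diff_quot_def abs_mult_pos' field_simps)
    also have "\<dots> \<le> t * e'"
      using \<delta>[OF t d(1)] t by (intro mult_left_mono) (auto simp: dist_real_def)
    finally have 2: "\<bar>G (x + t *\<^sub>R d) - G x - t * A d\<bar> \<le> t * e'" .
    have "\<bar>t * A d - t * A u\<bar> = t * \<bar>A (u - d)\<bar>"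
      using t by (simp add: diff abs_mult_pos' abs_minus_commute flip: right_diff_distrib)
    also have "\<dots> \<le> t * (K * e')"
    proof (intro mult_left_mono)
      have "\<bar>A (u - d)\<bar> \<le> norm (u - d) * K" using K(2) by simp
      also have "\<dots> \<le> e' * K" using d K by (intro mult_right_mono) auto
      finally show "\<bar>A (u - d)\<bar> \<le> K * e'" by (simp add: mult.commute)
    qed (use t in simp)
    finally have 3: "\<bar>t * A d - t * A u\<bar> \<le> t * (K * e')" .
    have "A (y - x) = t * A u" by (simp add: y scaleR)
    then have "\<bar>G y - G x - A (y - x)\<bar> \<le> t * (L * e') + t * e' + t * (K * e')"
      using 1 2 3 by linarith
    also have "\<dots> = t * (e' * (L + K + 1))" by (simp add: algebra_simps)
    also have "e' * (L + K + 1) = e" using L0 K by (simp add: e'_def)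
    finally show ?thesis by (simp add: t_def mult.commute)
  qed simp
  then show "\<exists>d>0. \<forall>y. norm (y - x) < d \<longrightarrow> norm (G y - G x - A (y - x)) \<le> e * norm (y - x)"
    using \<open>\<delta> > 0\<close> by blast
qed

text \<open>Linearity, checked on a basis, yields the candidate \<open>A x\<close>. Each direction
  has its own null set of exceptions; a countable dense set of directions leaves only one null set
  in total.\<close>

theorem rademacher_real:
  fixes G :: "'a::euclidean_space \<Rightarrow> real"
  assumes G: "L-lipschitz_on UNIV G"
  shows "AE x in lborel. G differentiable (at x)"
proof -
  obtain D :: "'a set" where "countable D" and dense: "\<And>U. open U \<Longrightarrow> U \<noteq> {} \<Longrightarrow> \<exists>d\<in>D. d \<in> U"
    by (rule countable_dense_setE) (rule that)
  define d where "d b x = (SOME l. (diff_quot G b x \<longlongrightarrow> l) (at_right 0))" for b x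
  have d: "(diff_quot G b x \<longlongrightarrow> d b x) (at_right 0)" if "\<exists>l. (diff_quot G b x \<longlongrightarrow> l) (at_right 0)" for b x
    unfolding d_def using that by (rule someI_ex)
  have dae: "AE x in lborel. (diff_quot G b x \<longlongrightarrow> d b x) (at_right 0)" for b
    using lipschitz_directional_derivative_ae[OF G, of b] by eventually_elim (rule d)
  have sum: "AE x in lborel. (diff_quot G (\<Sum>b\<in>B. c b *\<^sub>R b) x \<longlongrightarrow> (\<Sum>b\<in>B. c b * d b x)) (at_right 0)"
    if "finite B" for B c
    using that
  proof induction
    case empty
    show ?case by (simp add: diff_quot_def[abs_def])
  next
    case (insert b B)
    show ?case
      using directional_derivative_add_ae[OF G directional_derivative_scale_ae[OF G dae] insert.IH] insert.hyps
      by simp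
  qed
  define A where "A x v = (\<Sum>b\<in>Basis. (v \<bullet> b) * d b x)" for x v
  have "AE x in lborel. (diff_quot G v x \<longlongrightarrow> A x v) (at_right 0)" for v
    using sum[OF finite_Basis, of "\<lambda>b. v \<bullet> b"] by (simp add: A_def euclidean_representation)
  then have "AE x in lborel. \<forall>v\<in>D. (diff_quot G v x \<longlongrightarrow> A x v) (at_right 0)"
    using \<open>countable D\<close> by (simp add: AE_ball_countable)
  then show ?thesis
  proof eventually_elim
    case (elim x)
    have "bounded_linear (A x)"
      unfolding A_def by (intro bounded_linear_sum bounded_linear_mult_const bounded_linear_inner_left)
    then show ?case
      using has_derivative_if_dense_directions[OF G dense] elim unfolding differentiable_def by blast
  qed
qed

text \<open>Composition with the 1-Lipschitz nearest-point projection onto the ball extends g to the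
  whole space without changing it in the ball; Rademacher's theorem is then applied to each
  coordinate.\<close>

theorem rademacher_on_cball:
  fixes g :: "'a::euclidean_space \<Rightarrow> 'b::euclidean_space"
  assumes g: "L-lipschitz_on (cball a r) g"
  shows "negligible {x \<in> ball a r. \<not> g differentiable (at x)}"
proof (cases "r \<ge> 0")
  case True
  define G where "G x = g (closest_point (cball a r) x)" for x
  have L0: "0 \<le> L" by (rule lipschitz_on_nonneg[OF g])
  have Glip: "L-lipschitz_on UNIV (\<lambda>x. G x \<bullet> b)" if "b \<in> Basis" for b
  proof (rule lipschitz_onI[OF _ L0])
    fix x y
    have "dist (G x \<bullet> b) (G y \<bullet> b) \<le> dist (G x) (G y)"
      using Basis_le_norm[OF that, of "G x - G y"] by (simp add: dist_norm inner_diff_left)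
    also have "\<dots> \<le> L * dist (closest_point (cball a r) x) (closest_point (cball a r) y)"
      unfolding G_def using True by (intro lipschitz_onD[OF g] closest_point_in_set) auto
    also have "\<dots> \<le> L * dist x y"
      using True by (intro mult_left_mono closest_point_lipschitz L0) auto
    finally show "dist (G x \<bullet> b) (G y \<bullet> b) \<le> L * dist x y" .
  qed
  have "AE x in lborel. \<forall>b\<in>Basis. (\<lambda>x. G x \<bullet> b) differentiable (at x)"
    using rademacher_real[OF Glip] by (simp add: AE_ball_countable countable_finite)
  then have "AE x in lebesgue. \<forall>b\<in>Basis. (\<lambda>x. G x \<bullet> b) differentiable (at x)"
    by (simp add: AE_completion)
  then obtain N where N: "N \<in> null_sets lebesgue"
    "{x. \<not> (\<forall>b\<in>Basis. (\<lambda>x. G x \<bullet> b) differentiable (at x))} \<subseteq> N"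
    by (elim AE_E3) (rule that, auto)
  have "{x \<in> ball a r. \<not> g differentiable (at x)} \<subseteq> N"
  proof (rule subsetI, rule ccontr)
    fix x assume x: "x \<in> {x \<in> ball a r. \<not> g differentiable (at x)}" and "x \<notin> N"
    then have "G differentiable (at x)"
      using N(2) by (subst differentiable_componentwise_within) auto
    moreover have "G y = g y" if "y \<in> ball a r" for y
      using that by (simp add: G_def closest_point_self)
    ultimately have "g differentiable (at x)"
      unfolding differentiable_def
      using has_derivative_transform_within_open[OF _ open_ball, of G _ x UNIV a r g] x by blast
    with x show False by simp
  qed
  then show ?thesis
    using N(1) negligible_iff_null_sets negligible_subset by blast
next
  case False
  then have "ball a r = {}" by (simp add: ball_empty)
  then show ?thesis by (simp only: empty_iff simp_thms Collect_empty_eq[THEN iffD2] negligible_empty)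
qed

section \<open>Contact points of a semicontinuous and a regular function\<close>

lemma usc_on_imp_open_nbhd:
  assumes "usc_on S F" "x \<in> S" "F x < c"
  shows "\<exists>T. open T \<and> x \<in> T \<and> (\<forall>y\<in>T \<inter> S. F y < c)"
  using assms unfolding usc_on_def eventually_at_topological by (metis IntD1 IntD2)

lemma usc_on_subset: "usc_on S F \<Longrightarrow> T \<subseteq> S \<Longrightarrow> usc_on T F"
  unfolding usc_on_def by (meson at_le filter_leD subsetD)

lemma usc_on_add_continuous:
  fixes F h :: "'a::topological_space \<Rightarrow> real"
  assumes F: "usc_on S F" and h: "continuous_on S h"
  shows "usc_on S (\<lambda>x. F x + h x)"
  unfolding usc_on_def
proof (intro ballI allI impI)
  fix x c assume x: "x \<in> S" and "F x + h x < c"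
  define d where "d = (c - F x - h x) / 2"
  have "d > 0" using \<open>F x + h x < c\<close> by (simp add: d_def)
  then have "\<forall>\<^sub>F y in at x within S. F y < F x + d"
    using F x unfolding usc_on_def by auto
  moreover have "\<forall>\<^sub>F y in at x within S. h y < h x + d"
    using h x \<open>d > 0\<close> unfolding continuous_on_def by (auto intro: order_tendstoD)
  ultimately show "\<forall>\<^sub>F y in at x within S. F y + h y < c"
    by eventually_elim (auto simp: d_def field_simps)
qed

lemma usc_on_snd:
  assumes "usc_on B v" shows "usc_on (A \<times> B) (\<lambda>z. v (snd z))"
  unfolding usc_on_def eventually_at_topological
proof (intro ballI allI impI)
  fix z c assume "z \<in> A \<times> B" and "v (snd z) < c"
  then obtain T where "open T" "snd z \<in> T" "\<forall>y\<in>T \<inter> B. v y < c"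
    using usc_on_imp_open_nbhd[OF assms, of "snd z" c] by auto
  then show "\<exists>S. open S \<and> z \<in> S \<and> (\<forall>y\<in>S. y \<noteq> z \<longrightarrow> y \<in> A \<times> B \<longrightarrow> v (snd y) < c)"
    by (intro exI[of _ "UNIV \<times> T"]) (auto simp: open_Times mem_Times_iff)
qed

text \<open>Without a maximum every x is beaten by some \<open>Y x\<close>, and the neighbourhoods
  where F stays below \<open>F (Y x)\<close> cover K. In a finite subcover the largest of the values
  \<open>F (Y x)\<close> would lie below another of them.\<close>

lemma usc_on_attains_max:
  fixes F :: "'a::topological_space \<Rightarrow> 'b::linorder"
  assumes "compact K" "K \<noteq> {}" and F: "usc_on K F"
  shows "\<exists>x\<in>K. \<forall>y\<in>K. F y \<le> F x"
proof (rule ccontr)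
  assume "\<not> ?thesis"
  then have "\<forall>x\<in>K. \<exists>y\<in>K. F x < F y" by (meson not_le)
  then have "\<exists>Y. \<forall>x\<in>K. Y x \<in> K \<and> F x < F (Y x)" by (intro bchoice) blast
  then obtain Y where Y: "\<forall>x\<in>K. Y x \<in> K \<and> F x < F (Y x)" by blast
  then have "\<forall>x\<in>K. \<exists>T. open T \<and> x \<in> T \<and> (\<forall>z\<in>T \<inter> K. F z < F (Y x))"
    using usc_on_imp_open_nbhd[OF F] by blast
  then have "\<exists>T. \<forall>x\<in>K. open (T x) \<and> x \<in> T x \<and> (\<forall>z\<in>T x \<inter> K. F z < F (Y x))" by (rule bchoice)
  then obtain T where "\<forall>x\<in>K. open (T x) \<and> x \<in> T x \<and> (\<forall>z\<in>T x \<inter> K. F z < F (Y x))" by blast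
  with Y have YT: "\<And>x. x \<in> K \<Longrightarrow> Y x \<in> K \<and> open (T x) \<and> x \<in> T x \<and> (\<forall>z\<in>T x \<inter> K. F z < F (Y x))"
    by blast
  then have "\<And>x. x \<in> K \<Longrightarrow> open (T x)" "K \<subseteq> (\<Union>x\<in>K. T x)" by blast+
  then obtain D where D: "D \<subseteq> K" "finite D" "K \<subseteq> (\<Union>x\<in>D. T x)"
    by (rule compactE_image[OF assms(1)])
  have "D \<noteq> {}" using D assms(2) by auto
  define m where "m = Max ((\<lambda>x. F (Y x)) ` D)"
  have "m \<in> (\<lambda>x. F (Y x)) ` D" unfolding m_def using D \<open>D \<noteq> {}\<close> by (intro Max_in) auto
  then obtain x where x: "x \<in> D" "m = F (Y x)" by auto
  then have "Y x \<in> K" using YT D by blast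
  then obtain x' where x': "x' \<in> D" "Y x \<in> T x'" using D by blast
  then have "F (Y x) < F (Y x')" using YT[of x'] D \<open>Y x \<in> K\<close> by blast
  also have "F (Y x') \<le> m" unfolding m_def using D x' by (intro Max_ge) auto
  finally show False using x by simp
qed

text \<open>Mean value inequality for \<psi> minus its linear part. The constant is L rather than L
  / 2 because the derivative is bounded by its worst value on the segment.\<close>

lemma lipschitz_gradient_taylor:
  fixes \<psi> :: "'a::euclidean_space \<Rightarrow> real"
  assumes S: "convex S" and \<psi>: "\<And>x. x \<in> S \<Longrightarrow> (\<psi> has_derivative (\<lambda>h. g x \<bullet> h)) (at x)"
    and g: "L-lipschitz_on S g" and x: "x \<in> S" and z: "z \<in> S"
  shows "\<bar>\<psi> z - \<psi> x - g x \<bullet> (z - x)\<bar> \<le> L * (norm (z - x))\<^sup>2"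
proof -
  let ?f = "\<lambda>w. \<psi> w - g x \<bullet> w"
  have seg: "closed_segment x z \<subseteq> S" using S x z by (simp add: closed_segment_subset)
  have L0: "L \<ge> 0" by (rule lipschitz_on_nonneg[OF g])
  have "norm (?f z - ?f x) \<le> (L * norm (z - x)) * norm (z - x)"
  proof (rule differentiable_bound[of "closed_segment x z" _ "\<lambda>w h. (g w - g x) \<bullet> h"])
    fix w assume w: "w \<in> closed_segment x z"
    then have "w \<in> S" using seg by blast
    show "(?f has_derivative (\<lambda>h. (g w - g x) \<bullet> h)) (at w within closed_segment x z)"
      by (rule has_derivative_at_withinI)
        (auto intro!: derivative_eq_intros \<psi> \<open>w \<in> S\<close> simp: inner_diff_left)
    show "onorm (\<lambda>h. (g w - g x) \<bullet> h) \<le> L * norm (z - x)"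
    proof (rule onorm_le)
      fix h
      have "norm ((g w - g x) \<bullet> h) \<le> norm (g w - g x) * norm h"
        by (simp add: Cauchy_Schwarz_ineq2)
      also have "norm (g w - g x) \<le> L * norm (w - x)"
        using lipschitz_onD[OF g \<open>w \<in> S\<close> x] by (simp add: dist_norm)
      also have "norm (w - x) \<le> norm (z - x)"
        using segment_bound(1)[OF w] by (simp add: norm_minus_commute)
      finally show "norm ((g w - g x) \<bullet> h) \<le> L * norm (z - x) * norm h"
        using L0 by (simp add: mult_left_mono mult_right_mono)
    qed
  qed auto
  then show ?thesis by (simp add: inner_diff_right power2_eq_square algebra_simps)
qed

lemma lipschitz_gradient_imp_lipschitz:
  fixes \<psi> :: "'a::euclidean_space \<Rightarrow> real"
  assumes \<psi>: "\<And>x. x \<in> cball a r \<Longrightarrow> (\<psi> has_derivative (\<lambda>h. g x \<bullet> h)) (at x)"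
    and g: "L-lipschitz_on (cball a r) g" and r: "r \<ge> 0"
  shows "(norm (g a) + L * r)-lipschitz_on (cball a r) \<psi>"
proof (rule lipschitz_onI)
  have L0: "L \<ge> 0" by (rule lipschitz_on_nonneg[OF g])
  then show "0 \<le> norm (g a) + L * r" using r by simp
  fix x y assume xy: "x \<in> cball a r" "y \<in> cball a r"
  have "norm (\<psi> x - \<psi> y) \<le> (norm (g a) + L * r) * norm (x - y)"
  proof (rule differentiable_bound[of "cball a r" _ "\<lambda>w h. g w \<bullet> h"])
    fix w assume w: "w \<in> cball a r"
    show "(\<psi> has_derivative (\<lambda>h. g w \<bullet> h)) (at w within cball a r)"
      by (rule has_derivative_at_withinI[OF \<psi>[OF w]])
    have "norm (g w - g a) \<le> L * dist w a"
      using lipschitz_onD[OF g w, of a] r by (simp add: dist_norm)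
    also have "\<dots> \<le> L * r" using w L0 by (intro mult_left_mono) (auto simp: dist_commute)
    finally have "norm (g w) \<le> norm (g a) + L * r"
      using norm_triangle_ineq2[of "g w" "g a"] by linarith
    then show "onorm (\<lambda>h. g w \<bullet> h) \<le> norm (g a) + L * r"
      by (intro onorm_le) (metis Cauchy_Schwarz_ineq2 mult_right_mono norm_ge_zero order_trans real_norm_def)
  qed (use xy in auto)
  then show "dist (\<psi> x) (\<psi> y) \<le> (norm (g a) + L * r) * dist x y" by (simp add: dist_norm)
qed

text \<open>A form of Jensen's lemma for the doubled functional \<open>\<Phi>\<close>.
  \<open>touch_loc\<close> keeps the maxima in the interior, \<open>lower\<close> places a
  paraboloid below, and \<open>lip\<close> deduces the Lipschitz bound for the slopes.\<close>

lemma contact_point_with_hessian: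
  fixes v \<psi> :: "'a::euclidean_space \<Rightarrow> real"
  assumes r: "r > 0" and v: "usc_on (cball a r) v"
    and \<psi>: "\<And>x. x \<in> cball a r \<Longrightarrow> (\<psi> has_derivative (\<lambda>h. g x \<bullet> h)) (at x)"
    and g: "L-lipschitz_on (cball a r) g"
    and sph: "\<And>x. x \<in> sphere a r \<Longrightarrow> v x - \<psi> x < v a - \<psi> a"
    and \<eta>: "\<eta> > 0"
  shows "\<exists>x y p Y. x \<in> ball a r \<and> y \<in> ball a r \<and> norm (x - y) \<le> \<eta> \<and> norm p \<le> \<eta> \<and>
    (g has_derivative Y) (at x) \<and> v a - \<psi> a - \<eta> \<le> v y - \<psi> x \<and>
    (\<forall>\<^sub>F z in nhds y. v z \<le> v y + \<psi> (x + z - y) - \<psi> x + p \<bullet> (z - y))"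
proof -
  define S where "S = cball a r"
  define M where "M = v a - \<psi> a"
  have aS: "a \<in> S" and compS: "compact S" using r by (auto simp: S_def)
  have L0: "L \<ge> 0" by (rule lipschitz_on_nonneg[OF g])
  define B where "B = norm (g a) + L * r"
  have B0: "B \<ge> 0" using L0 r by (simp add: B_def)
  have \<psi>B: "B-lipschitz_on S \<psi>"
    unfolding S_def B_def using r by (intro lipschitz_gradient_imp_lipschitz[OF \<psi> g]) auto
  then have cont\<psi>: "continuous_on S \<psi>" by (rule lipschitz_on_continuous_on)
  have uscd: "usc_on S (\<lambda>x. v x - \<psi> x)"
    using usc_on_add_continuous[OF v, of "\<lambda>x. - \<psi> x"] cont\<psi> by (auto simp: S_def intro: continuous_intros)
  have "sphere a r \<subseteq> S" by (auto simp: S_def)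
  then obtain m where m: "m \<in> sphere a r" "\<And>x. x \<in> sphere a r \<Longrightarrow> v x - \<psi> x \<le> v m - \<psi> m"
    using usc_on_attains_max[OF compact_sphere _ usc_on_subset[OF uscd], of a r] r by auto
  define \<kappa> where "\<kappa> = (M - (v m - \<psi> m)) / 2"
  have \<kappa>: "\<kappa> > 0" "v m - \<psi> m < M - \<kappa>" using sph[OF m(1)] by (auto simp: \<kappa>_def M_def field_simps)
  \<comment> \<open>Here v - \<psi> is not much below its value at a. This compact set misses the
    sphere, so it lies within some distance \<rho> < r of a.\<close>
  define C where "C = {x \<in> S. M - \<kappa> \<le> v x - \<psi> x}"
  have "compact C"
  proof -
    have "openin (top_of_set S) {x \<in> S. v x - \<psi> x < M - \<kappa>}"
      unfolding openin_subopen[of _ "{x \<in> S. v x - \<psi> x < M - \<kappa>}"]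
    proof safe
      fix x assume "x \<in> S" "v x - \<psi> x < M - \<kappa>"
      then obtain T where "open T" "x \<in> T" "\<forall>y\<in>T \<inter> S. v y - \<psi> y < M - \<kappa>"
        using usc_on_imp_open_nbhd[OF uscd] by blast
      then show "\<exists>T. openin (top_of_set S) T \<and> x \<in> T \<and> T \<subseteq> {x \<in> S. v x - \<psi> x < M - \<kappa>}"
        using \<open>x \<in> S\<close> by (intro exI[of _ "S \<inter> T"]) auto
    qed
    then have "closedin (top_of_set S) (S - {x \<in> S. v x - \<psi> x < M - \<kappa>})"
      using closedin_diff[OF closedin_topspace, of "top_of_set S"] by simp
    moreover have "S - {x \<in> S. v x - \<psi> x < M - \<kappa>} = C" by (auto simp: C_def)
    ultimately show ?thesis using closedin_compact[OF compS] by simp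
  qed
  have "a \<in> C" using aS \<kappa> by (simp add: C_def M_def)
  obtain c where c: "c \<in> C" "\<And>x. x \<in> C \<Longrightarrow> dist a x \<le> dist a c"
    using distance_attains_sup[OF \<open>compact C\<close>, of a] \<open>a \<in> C\<close> by blast
  define \<rho> where "\<rho> = dist a c"
  have "dist a c \<noteq> r" using m(2)[of c] c(1) \<kappa> by (auto simp: C_def)
  then have \<rho>: "\<rho> < r" using c(1) by (auto simp: C_def S_def \<rho>_def)
  obtain y0 where y0: "y0 \<in> S" "\<And>y. y \<in> S \<Longrightarrow> v y \<le> v y0"
    using usc_on_attains_max[OF compS _ v[folded S_def]] aS by blast
  obtain x0 where x0: "x0 \<in> S" "\<And>x. x \<in> S \<Longrightarrow> \<psi> x0 \<le> \<psi> x"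
    using continuous_attains_inf[OF compS _ cont\<psi>] aS by blast
  \<comment> \<open>Comparison with the pair (a, a) bounds the penalty by v y - \<psi> x + \<delta>
    r - M, hence by \<open>D\<close>; the choice \<open>\<mu> = D / \<sigma>\<^sup>2\<close> then
    forces |x - y| to be at most \<sigma>.\<close>
  define D where "D = v y0 - \<psi> x0 + r - M"
  have D: "D > 0" using y0(2)[OF aS] x0(2)[OF aS] r by (simp add: D_def M_def)
  \<comment> \<open>The three entries make x and y \<eta>-close, change \<psi> by at most \<kappa> /
    2 between them, and keep x in the open ball once y is within \<rho> of a.\<close>
  define \<sigma> where "\<sigma> = min \<eta> (min (\<kappa> / (2 * (B + 1))) ((r - \<rho>) / 2))"
  have \<sigma>: "\<sigma> > 0" "\<sigma> \<le> \<eta>" "\<sigma> \<le> \<kappa> / (2 * (B + 1))" "\<sigma> < r - \<rho>"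
  proof -
    show "\<sigma> > 0" using \<eta> \<kappa> B0 \<rho> by (simp add: \<sigma>_def)
    show "\<sigma> \<le> \<eta>" "\<sigma> \<le> \<kappa> / (2 * (B + 1))" unfolding \<sigma>_def by linarith+
    have "\<sigma> \<le> (r - \<rho>) / 2" unfolding \<sigma>_def by linarith
    also have "(r - \<rho>) / 2 < r - \<rho>" using \<rho> by (simp add: field_simps)
    finally show "\<sigma> < r - \<rho>" .
  qed
  have B\<sigma>: "B * \<sigma> \<le> \<kappa> / 2"
  proof -
    have "B * \<sigma> \<le> (B + 1) * (\<kappa> / (2 * (B + 1)))" using \<sigma> B0 by (intro mult_mono) auto
    also have "(B + 1) * (\<kappa> / (2 * (B + 1))) = \<kappa> / 2" using B0 by (simp add: field_simps)
    finally show ?thesis .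
  qed
  define \<mu> where "\<mu> = D / \<sigma>\<^sup>2"
  have \<mu>: "\<mu> > 0" using D \<sigma> by (simp add: \<mu>_def)
  \<comment> \<open>The slope changes the comparison by at most \<delta> r. This must be at most r
    (the summand r of \<open>D\<close>), at most \<eta> (final value estimate) and at most \<kappa>
    / 2 (membership of y in \<open>C\<close>).\<close>
  define \<delta> where "\<delta> = min (min 1 \<eta>) (min (\<eta> / r) (\<kappa> / (2 * r)))"
  have \<delta>: "\<delta> > 0" "\<delta> \<le> 1" "\<delta> \<le> \<eta>" "\<delta> * r \<le> \<eta>" "\<delta> * r \<le> \<kappa> / 2"
  proof -
    show "\<delta> > 0" using \<eta> r \<kappa> by (simp add: \<delta>_def)
    show "\<delta> \<le> 1" "\<delta> \<le> \<eta>" unfolding \<delta>_def by linarith+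
    have "\<delta> \<le> \<eta> / r" "\<delta> \<le> \<kappa> / (2 * r)" unfolding \<delta>_def by linarith+
    then show "\<delta> * r \<le> \<eta>" "\<delta> * r \<le> \<kappa> / 2" using r by (simp_all add: field_simps)
  qed
  define \<Phi> where "\<Phi> x y = v y - \<mu> * (norm (x - y))\<^sup>2 - \<psi> x" for x y
  define touch where "touch p x y \<longleftrightarrow> x \<in> S \<and> y \<in> S \<and> (\<forall>x'\<in>S. \<forall>y'\<in>S. \<Phi> x' y' \<le> \<Phi> x y + p \<bullet> (x' - x))" for p x y
  have touch_ex: "\<exists>x y. touch p x y" for p
  proof -
    have "usc_on (S \<times> S) (\<lambda>z. v (snd z) + (- \<mu> * (norm (fst z - snd z))\<^sup>2 - \<psi> (fst z) - p \<bullet> fst z))"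
      by (intro usc_on_add_continuous usc_on_snd v[folded S_def] continuous_intros
          continuous_on_compose2[OF cont\<psi> continuous_on_fst]) auto
    moreover have "compact (S \<times> S)" "S \<times> S \<noteq> {}" using compS aS by (auto simp: compact_Times)
    ultimately obtain z where
      z: "z \<in> S \<times> S" "\<forall>w\<in>S \<times> S.
        v (snd w) + (- \<mu> * (norm (fst w - snd w))\<^sup>2 - \<psi> (fst w) - p \<bullet> fst w) \<le>
        v (snd z) + (- \<mu> * (norm (fst z - snd z))\<^sup>2 - \<psi> (fst z) - p \<bullet> fst z)"
      using usc_on_attains_max by blast
    have "touch p (fst z) (snd z)"
      unfolding touch_def \<Phi>_def
    proof (intro conjI ballI)
      fix x' y' assume "x' \<in> S" "y' \<in> S"
      then show "v y' - \<mu> * (norm (x' - y'))\<^sup>2 - \<psi> x'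
          \<le> v (snd z) - \<mu> * (norm (fst z - snd z))\<^sup>2 - \<psi> (fst z) + p \<bullet> (x' - fst z)"
        using z(2)[rule_format, of "(x', y')"] by (simp add: inner_diff_right)
    qed (use z in auto)
    then show ?thesis by blast
  qed
  have touch_loc: "x \<in> ball a r \<and> y \<in> ball a r \<and> norm (x - y) \<le> \<eta> \<and> M - \<eta> \<le> v y - \<psi> x"
    if p: "norm p < \<delta>" and t: "touch p x y" for p x y
  proof -
    have xy: "x \<in> S" "y \<in> S" using t by (auto simp: touch_def)
    have "\<bar>p \<bullet> (a - x)\<bar> \<le> norm p * norm (a - x)" by (rule Cauchy_Schwarz_ineq2)
    also have "\<dots> \<le> \<delta> * r" using p xy r \<delta>(1) by (intro mult_mono) (auto simp: S_def dist_norm)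
    finally have pr: "\<bar>p \<bullet> (a - x)\<bar> \<le> \<delta> * r" .
    have "\<Phi> a a \<le> \<Phi> x y + p \<bullet> (a - x)" using t aS by (auto simp: touch_def)
    then have main: "M + \<mu> * (norm (x - y))\<^sup>2 \<le> v y - \<psi> x + \<delta> * r"
      using pr by (simp add: \<Phi>_def M_def)
    have "\<delta> * r \<le> r" using \<delta> r by simp
    then have "\<mu> * (norm (x - y))\<^sup>2 \<le> D"
      using main y0(2)[OF xy(2)] x0(2)[OF xy(1)] by (simp add: D_def)
    then have "(norm (x - y))\<^sup>2 \<le> \<sigma>\<^sup>2"
      using D \<sigma>(1) by (simp add: \<mu>_def field_simps)
    then have n: "norm (x - y) \<le> \<sigma>" using \<sigma>(1) by (simp add: power2_le_iff_abs_le)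
    have "\<bar>\<psi> x - \<psi> y\<bar> \<le> B * norm (x - y)"
      using lipschitz_onD[OF \<psi>B xy] by (simp add: dist_norm)
    also have "\<dots> \<le> B * \<sigma>" using n B0 by (intro mult_left_mono)
    also note B\<sigma>
    finally have b: "\<bar>\<psi> x - \<psi> y\<bar> \<le> \<kappa> / 2" .
    have pos: "\<mu> * (norm (x - y))\<^sup>2 \<ge> 0" using \<mu> by simp
    have "M - \<kappa> \<le> v y - \<psi> y" using main b \<delta>(5) pos by linarith
    then have "dist a y \<le> \<rho>" using c(2)[of y] xy by (simp add: C_def \<rho>_def)
    moreover have "dist a x \<le> dist a y + norm (x - y)"
      using dist_triangle[of a x y] by (simp add: dist_norm norm_minus_commute)
    ultimately show ?thesis using n \<sigma> \<rho> main pos \<delta>(4) by auto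
  qed
  \<comment> \<open>Curvature bound for \<Phi> in its first argument: \<mu> from the penalty, L from
    the Taylor estimate of \<psi>.\<close>
  define Q where "Q = \<mu> + L"
  have Q: "Q > 0" using \<mu> L0 by (simp add: Q_def)
  have lower: "\<Phi> x y + p \<bullet> (z - x) - Q * (norm (z - x))\<^sup>2 \<le> \<Phi> z y"
    if t: "touch p x y" and x: "x \<in> ball a r" and z: "z \<in> S" for p x y z
  proof -
    have xy: "x \<in> S" "y \<in> S" using t by (auto simp: touch_def)
    define d where "d = - (2 * \<mu>) *\<^sub>R (x - y) - g x"
    have low: "\<Phi> x y + d \<bullet> (z - x) - Q * (norm (z - x))\<^sup>2 \<le> \<Phi> z y" if z: "z \<in> S" for z
    proof -
      have "(norm (z - y))\<^sup>2 = (norm (x - y))\<^sup>2 + 2 * ((x - y) \<bullet> (z - x)) + (norm (z - x))\<^sup>2"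
        by (simp add: power2_norm_eq_inner algebra_simps inner_commute)
      then have "\<mu> * (norm (z - y))\<^sup>2 =
          \<mu> * (norm (x - y))\<^sup>2 + 2 * \<mu> * ((x - y) \<bullet> (z - x)) + \<mu> * (norm (z - x))\<^sup>2"
        by (simp only: distrib_left mult.assoc mult.left_commute)
      moreover have "d \<bullet> (z - x) = - (2 * \<mu> * ((x - y) \<bullet> (z - x))) - g x \<bullet> (z - x)"
        unfolding d_def inner_diff_left inner_scaleR_left by simp
      moreover have "Q * (norm (z - x))\<^sup>2 = \<mu> * (norm (z - x))\<^sup>2 + L * (norm (z - x))\<^sup>2"
        by (simp only: Q_def distrib_right)
      moreover have "\<psi> z \<le> \<psi> x + g x \<bullet> (z - x) + L * (norm (z - x))\<^sup>2"
        using lipschitz_gradient_taylor[OF convex_cball \<psi> g, of x z] xy z by (simp add: S_def abs_le_iff)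
      ultimately show ?thesis
        unfolding \<Phi>_def by linarith
    qed
    \<comment> \<open>First order condition at an interior maximum. A step t along e = d - p would
      gain t |e|^2 and lose at most Q t^2 |e|^2, which is less when t Q < 1.\<close>
    have "d = p"
    proof (rule ccontr)
      assume "d \<noteq> p"
      define e where "e = d - p"
      have e: "norm e > 0" using \<open>d \<noteq> p\<close> by (simp add: e_def)
      obtain s where s: "s > 0" "ball x s \<subseteq> S"
        using x by (metis S_def ball_subset_cball open_ball openE subset_trans)
      define t where "t = min (s / (2 * norm e)) (1 / (2 * Q))"
      have t: "t > 0" "t * norm e < s" "t * Q < 1"
      proof -
        show "t > 0" using s e Q by (simp add: t_def)
        have "t \<le> s / (2 * norm e)" "t \<le> 1 / (2 * Q)" unfolding t_def by linarith+
        then have "t * norm e \<le> s / 2" "t * Q \<le> 1 / 2" using e Q by (simp_all add: field_simps)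
        then show "t * norm e < s" "t * Q < 1" using s(1) by linarith+
      qed
      have "x + t *\<^sub>R e \<in> S" using s t by (auto simp: dist_norm)
      with low[OF this] \<open>touch p x y\<close> xy have
        "d \<bullet> (t *\<^sub>R e) - Q * (norm (t *\<^sub>R e))\<^sup>2 \<le> p \<bullet> (t *\<^sub>R e)" by (fastforce simp: touch_def)
      then have "t * (e \<bullet> e) \<le> Q * t\<^sup>2 * (e \<bullet> e)"
      proof -
        have "d \<bullet> e = p \<bullet> e + e \<bullet> e" by (simp add: e_def inner_diff_left)
        then have "t * (d \<bullet> e) = t * (p \<bullet> e) + t * (e \<bullet> e)" by (simp add: distrib_left)
        moreover have "(norm (t *\<^sub>R e))\<^sup>2 = t\<^sup>2 * (e \<bullet> e)"
          by (simp add: power_mult_distrib power2_norm_eq_inner)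
        moreover have "d \<bullet> (t *\<^sub>R e) = t * (d \<bullet> e)" "p \<bullet> (t *\<^sub>R e) = t * (p \<bullet> e)" by simp_all
        ultimately show ?thesis
          using \<open>d \<bullet> (t *\<^sub>R e) - Q * (norm (t *\<^sub>R e))\<^sup>2 \<le> p \<bullet> (t *\<^sub>R e)\<close>
          by (simp only: mult.assoc)
      qed
      then have "1 \<le> t * Q" using t e by (simp add: power2_eq_square mult.commute)
      then show False using t by simp
    qed
    with low[OF z] show ?thesis by simp
  qed
  \<comment> \<open>The maximality at (x, y) is tested at a point z reached from x' against the
    direction of p - p'; the paraboloids at both contact points bound \<Phi> from below. Keeping t
    independent of |x - x'| covers x = x' as well: letting t shrink there shows that a contact point
    has only one slope.\<close>
  have lip: "norm (p - p') \<le> 2 * Q * t"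
    if t1: "touch p x y" "x \<in> ball a r" and t2: "touch p' x' y'" "x' \<in> ball a r"
      and t: "t > 0" "norm (x - x') \<le> t" "cball x' t \<subseteq> S" for p p' x x' y y' t
  proof (cases "p = p'")
    case False
    define u where "u = (p - p') /\<^sub>R norm (p - p')"
    have u: "norm u = 1" "(p - p') \<bullet> u = norm (p - p')"
      using False by (auto simp: u_def power2_norm_eq_inner[symmetric] power2_eq_square)
    define z where "z = x' - t *\<^sub>R u"
    have z: "z \<in> S" using t(1) u by (intro subsetD[OF t(3)]) (simp add: z_def dist_norm)
    have S: "x \<in> S" "y \<in> S" "x' \<in> S" "y' \<in> S" using t1 t2 by (auto simp: touch_def)
    have 1: "\<Phi> z y' \<le> \<Phi> x y + p \<bullet> (z - x)" using t1 z S by (auto simp: touch_def)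
    have 2: "\<Phi> x' y' + p' \<bullet> (z - x') - Q * t\<^sup>2 \<le> \<Phi> z y'"
      using lower[OF t2 z] u t by (simp add: z_def)
    have 3: "\<Phi> x' y \<le> \<Phi> x' y'" using t2 S by (fastforce simp: touch_def)
    have "Q * (norm (x' - x))\<^sup>2 \<le> Q * t\<^sup>2"
      using t Q by (intro mult_left_mono power_mono) (auto simp: norm_minus_commute)
    with lower[OF t1 S(3)] have 4: "\<Phi> x y + p \<bullet> (x' - x) - Q * t\<^sup>2 \<le> \<Phi> x' y" by linarith
    have 5: "p' \<bullet> (z - x') - p \<bullet> (z - x) + p \<bullet> (x' - x) = t * norm (p - p')"
      unfolding u(2)[symmetric] z_def by (simp add: algebra_simps)
    have "t * norm (p - p') \<le> 2 * Q * t\<^sup>2" using 1 2 3 4 5 by linarith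
    then show ?thesis using t by (simp add: power2_eq_square)
  qed (use Q that in simp)
  have room: "\<exists>s>0. cball x s \<subseteq> S" if "x \<in> ball a r" for x
    using that open_contains_cball[of "ball a r"] ball_subset_cball[of a r] unfolding S_def by (meson open_ball subset_trans)
  define N where "N = {x \<in> ball a r. \<not> g differentiable (at x)}"
  have N: "negligible N" unfolding N_def by (rule rademacher_on_cball[OF g])
  define K where "K = {x. \<exists>p y. norm p < \<delta> \<and> touch p x y}"
  have "\<exists>x\<in>K. x \<notin> N"
  proof (rule ccontr)
    assume "\<not> ?thesis"
    then have "K \<subseteq> N" by blast
    then have nK: "negligible K" using N negligible_subset by blast
    \<comment> \<open>The slope as a function of the contact point. Every p in the ball of radius
      \<delta> occurs by \<open>touch_ex\<close>, so uniqueness makes the image of K contain that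
      ball.\<close>
    define P where "P x = (SOME p. \<exists>y. norm p < \<delta> \<and> touch p x y)" for x
    have P: "\<exists>y. norm (P x) < \<delta> \<and> touch (P x) x y" if "x \<in> K" for x
      using someI_ex[of "\<lambda>p. \<exists>y. norm p < \<delta> \<and> touch p x y"] that unfolding P_def K_def by simp
    have uniq: "P x = p" if "norm p < \<delta>" "touch p x y" for p x y
    proof -
      have "x \<in> K" using that unfolding K_def by blast
      from P[OF this] obtain y' where y': "norm (P x) < \<delta>" "touch (P x) x y'" by blast
      have xb: "x \<in> ball a r" using touch_loc[OF that] by blast
      obtain s where s: "s > 0" "cball x s \<subseteq> S" using room[OF xb] by blast
      show ?thesis
      proof (rule ccontr)
        assume "P x \<noteq> p"
        define t where "t = min s (norm (P x - p) / (4 * Q))"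
        have "t > 0" "t \<le> s" using s \<open>P x \<noteq> p\<close> Q by (auto simp: t_def)
        then have "norm (P x - p) \<le> 2 * Q * t"
          using s by (intro lip[OF y'(2) xb that(2) xb]) auto
        also have "\<dots> \<le> 2 * Q * (norm (P x - p) / (4 * Q))"
          using Q by (intro mult_left_mono) (auto simp: t_def)
        also have "\<dots> = norm (P x - p) / 2" using Q by simp
        finally show False using \<open>P x \<noteq> p\<close> by simp
      qed
    qed
    have "negligible (P ` K)"
    proof (rule negligible_locally_Lipschitz_image[OF order_refl nK])
      fix x' assume "x' \<in> K"
      from P[OF this] obtain y' where y': "norm (P x') < \<delta>" "touch (P x') x' y'" by blast
      have xb: "x' \<in> ball a r" using touch_loc[OF y'] by blast
      obtain s where s: "s > 0" "cball x' s \<subseteq> S" using room[OF xb] by blast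
      have "norm (P x - P x') \<le> 2 * Q * norm (x - x')" if x: "x \<in> K" "x \<in> ball x' s" for x
      proof (cases "x = x'")
        case False
        from P[OF x(1)] obtain y where y: "norm (P x) < \<delta>" "touch (P x) x y" by blast
        have "x \<in> ball a r" using touch_loc[OF y] by blast
        then show ?thesis
          using False s x by (intro lip[OF y(2) _ y'(2) xb]) (auto simp: dist_norm norm_minus_commute)
      qed simp
      then show "\<exists>T B. open T \<and> x' \<in> T \<and> (\<forall>y\<in>K \<inter> T. norm (P y - P x') \<le> B * norm (y - x'))"
        using s by (intro exI[of _ "ball x' s"] exI[of _ "2 * Q"]) auto
    qed
    moreover have "ball 0 \<delta> \<subseteq> P ` K"
    proof
      fix p :: 'a assume "p \<in> ball 0 \<delta>"
      then have p: "norm p < \<delta>" by simp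
      obtain x y where t: "touch p x y" using touch_ex by blast
      then show "p \<in> P ` K" using uniq[OF p t] p by (force simp: K_def)
    qed
    ultimately have "negligible (ball (0 :: 'a) \<delta>)" using negligible_subset by blast
    then show False using \<delta>(1) open_not_negligible[OF open_ball, of "0 :: 'a" \<delta>] by auto
  qed
  then obtain x p y where x: "x \<notin> N" and p: "norm p < \<delta>" and t: "touch p x y" unfolding K_def by blast
  note loc = touch_loc[OF p t]
  obtain Y where Y: "(g has_derivative Y) (at x)" using x loc by (auto simp: N_def differentiable_def)
  obtain s where s: "s > 0" "cball x s \<subseteq> S" using room loc by blast
  obtain s' where s': "s' > 0" "cball y s' \<subseteq> S" using room loc by blast
  have "\<forall>\<^sub>F z in nhds y. dist z y < min s s'"
    unfolding eventually_nhds_metric using s s' by (intro exI[of _ "min s s'"]) auto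
  then have "\<forall>\<^sub>F z in nhds y. v z \<le> v y + \<psi> (x + z - y) - \<psi> x + p \<bullet> (z - y)"
  proof eventually_elim
    case (elim z)
    have "z \<in> S" using elim s' by (auto simp: dist_commute)
    moreover have "x + z - y \<in> S" using elim s by (auto simp: dist_norm norm_minus_commute)
    \<comment> \<open>Only pairs with the same difference x - y are compared, so the penalty
      cancels.\<close>
    ultimately have "\<Phi> (x + z - y) z \<le> \<Phi> x y + p \<bullet> (x + z - y - x)" using t by (auto simp: touch_def)
    then show ?case by (simp add: \<Phi>_def)
  qed
  then show ?thesis using loc p \<delta>(3) Y unfolding M_def by (intro exI[of _ x] exI[of _ y] exI[of _ p] exI[of _ Y]) auto
qed

section \<open>Spectra of symmetric matrices\<close>

lemma symmetric_inner_swap: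
  fixes A :: "real^'n^'n"
  assumes "transpose A = A"
  shows "(A *v x) \<bullet> y = x \<bullet> (A *v y)"
  by (metis assms dot_lmul_matrix transpose_matrix_vector)

text \<open>A maximizer x of the Rayleigh quotient on S. The residual w = A x - l x stays in S by
  invariance, and moving x along w would raise the quotient at first order unless w = 0.\<close>

lemma symmetric_eigenvector_in_subspace:
  fixes A :: "real^'n^'n"
  assumes A: "transpose A = A" and S: "subspace S" "S \<noteq> {0}" and inv: "\<And>x. x \<in> S \<Longrightarrow> A *v x \<in> S"
  shows "\<exists>x\<in>S. norm x = 1 \<and> (\<exists>l. A *v x = l *\<^sub>R x)"
proof -
  let ?q = "\<lambda>x. x \<bullet> (A *v x)"
  let ?U = "sphere 0 1 \<inter> S"
  have "compact ?U" using closed_subspace[OF S(1)] by (intro compact_Int_closed) auto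
  obtain y where y: "y \<in> S" "y \<noteq> 0" using S subspace_0 by blast
  then have "y /\<^sub>R norm y \<in> ?U" using S(1) by (simp add: subspace_scale)
  then have "?U \<noteq> {}" by blast
  have cont: "continuous_on ?U ?q"
    by (intro continuous_intros linear_continuous_on matrix_vector_mul_bounded_linear)
  obtain x where x: "x \<in> ?U" and max: "\<And>y. y \<in> ?U \<Longrightarrow> ?q y \<le> ?q x"
    using continuous_attains_sup[OF \<open>compact ?U\<close> \<open>?U \<noteq> {}\<close> cont] by blast
  define l where "l = ?q x"
  have xS: "x \<in> S" "norm x = 1" using x by auto
  have le: "?q y \<le> l * (y \<bullet> y)" if "y \<in> S" for y
  proof (cases "y = 0")
    case False
    have "y /\<^sub>R norm y \<in> ?U" using S(1) that False by (simp add: subspace_scale)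
    from max[OF this] False show ?thesis
      by (simp add: l_def scaleR_matrix_vector_assoc[symmetric] matrix_vector_mult_scaleR field_simps
          power2_norm_eq_inner[symmetric] power2_eq_square)
  qed simp
  define w where "w = A *v x - l *\<^sub>R x"
  have wS: "w \<in> S" using xS S(1) inv by (simp add: w_def subspace_diff subspace_scale)
  have xx: "x \<bullet> x = 1" using xS by (simp add: power2_norm_eq_inner[symmetric])
  have "w = 0"
  proof (rule ccontr)
    assume "w \<noteq> 0"
    then have ww: "w \<bullet> w > 0" by simp
    define c where "c = l * (w \<bullet> w) - ?q w"
    have key: "2 * t * (w \<bullet> w) \<le> t\<^sup>2 * c" for t
    proof -
      have "x + t *\<^sub>R w \<in> S" using xS wS S(1) by (simp add: subspace_add subspace_scale)
      from le[OF this] have "l + 2 * t * (w \<bullet> (A *v x)) + t\<^sup>2 * ?q w \<le> l * (1 + 2 * t * (x \<bullet> w) + t\<^sup>2 * (w \<bullet> w))"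
        using symmetric_inner_swap[OF A, of x w] xx
        by (simp add: matrix_vector_right_distrib matrix_vector_mult_scaleR inner_add_left inner_add_right
            l_def[symmetric] inner_commute power2_eq_square algebra_simps)
      then have "2 * t * (w \<bullet> (A *v x) - l * (x \<bullet> w)) \<le> t\<^sup>2 * c"
        by (simp add: c_def algebra_simps)
      also have "w \<bullet> (A *v x) - l * (x \<bullet> w) = w \<bullet> (A *v x - l *\<^sub>R x)"
        by (simp add: inner_diff_right inner_commute)
      finally show ?thesis by (simp only: w_def[symmetric])
    qed
    \<comment> \<open>Small enough that the second order term t c is at most half of the first order
      term 2 (w \<bullet> w).\<close>
    define t where "t = (w \<bullet> w) / (\<bar>c\<bar> + 1)"
    have t: "t > 0" using ww by (simp add: t_def)
    have "2 * (w \<bullet> w) \<le> t * c" using key[of t] t by (simp add: power2_eq_square)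
    also have "\<dots> \<le> t * (\<bar>c\<bar> + 1)" using t by (intro mult_left_mono) auto
    also have "\<dots> = w \<bullet> w" by (simp add: t_def)
    finally show False using ww by simp
  qed
  then show ?thesis using xS by (auto simp: w_def)
qed

text \<open>Induction on the dimension: by symmetry the orthogonal complement of an eigenvector
  within S is again invariant.\<close>

lemma symmetric_eigenbasis_subspace:
  fixes A :: "real^'n^'n"
  assumes A: "transpose A = A" and S: "subspace S" and inv: "\<And>x. x \<in> S \<Longrightarrow> A *v x \<in> S"
  shows "\<exists>B\<subseteq>S. finite B \<and> card B = dim S \<and> pairwise orthogonal B \<and>
    (\<forall>b\<in>B. norm b = 1 \<and> (\<exists>l. A *v b = l *\<^sub>R b))"
  using S inv
proof (induction "dim S" arbitrary: S)
  case 0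
  then show ?case by (intro exI[of _ "{}"]) auto
next
  case (Suc d)
  have "S \<noteq> {0}" using Suc.hyps(2) by auto
  then obtain x l where x: "x \<in> S" "norm x = 1" "A *v x = l *\<^sub>R x"
    using symmetric_eigenvector_in_subspace[OF A Suc.prems(1) _ Suc.prems(2)] by blast
  define T where "T = {y \<in> S. x \<bullet> y = 0}"
  have T: "subspace T"
    using Suc.prems(1) by (auto simp: T_def subspace_def inner_right_distrib)
  have invT: "A *v y \<in> T" if "y \<in> T" for y
    using that Suc.prems(2) symmetric_inner_swap[OF A, of x y] x(3) by (auto simp: T_def)
  have "dim {y \<in> S. \<forall>z\<in>span {x}. orthogonal z y} + dim (span {x}) = dim S"
    using x Suc.prems(1) by (intro dim_subspace_orthogonal_to_vectors) (auto simp: span_minimal)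
  moreover have "{y \<in> S. \<forall>z\<in>span {x}. orthogonal z y} = T"
    by (auto simp: T_def span_singleton orthogonal_def)
  moreover have "dim (span {x}) = 1" using x(2) by (auto simp: dim_singleton)
  ultimately have "d = dim T" using Suc.hyps(2) by simp
  from Suc.hyps(1)[OF this T invT] obtain B where B: "B \<subseteq> T" "finite B" "card B = dim T"
    "pairwise orthogonal B" "\<forall>b\<in>B. norm b = 1 \<and> (\<exists>l. A *v b = l *\<^sub>R b)" by blast
  have "x \<notin> B" using B(1) x(2) by (auto simp: T_def)
  show ?case
  proof (intro exI[of _ "insert x B"] conjI)
    show "insert x B \<subseteq> S" using B(1) x(1) by (auto simp: T_def)
    show "card (insert x B) = dim S" using B \<open>x \<notin> B\<close> \<open>d = dim T\<close> Suc.hyps(2) by simp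
    show "pairwise orthogonal (insert x B)"
      using B(1,4) by (auto simp: pairwise_insert T_def orthogonal_def inner_commute)
    show "\<forall>b\<in>insert x B. norm b = 1 \<and> (\<exists>l. A *v b = l *\<^sub>R b)" using B(5) x by auto
  qed (use B in auto)
qed

text \<open>The index type carries no order; any fixed bijection onto an initial segment of the
  naturals provides one for sorting.\<close>

definition enum_index :: "'n::finite \<Rightarrow> nat" where
  "enum_index = (SOME h. bij_betw h UNIV {..<CARD('n)})"

lemma bij_enum_index: "bij_betw (enum_index :: 'n::finite \<Rightarrow> nat) UNIV {..<CARD('n)}"
proof -
  obtain h :: "'n \<Rightarrow> nat" where "bij_betw h UNIV {..<CARD('n)}"
    using ex_bij_betw_finite_nat[OF finite, of "UNIV :: 'n set"] unfolding lessThan_atLeast0 by blast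
  then show ?thesis unfolding enum_index_def by (rule someI[where P = "\<lambda>h. bij_betw h UNIV {..<CARD('n)}"])
qed

lemma enum_index_eq_iff [simp]: "enum_index i = enum_index j \<longleftrightarrow> i = j"
  by (rule inj_eq[OF bij_betw_imp_inj_on[OF bij_enum_index]])

text \<open>Listing the eigenvalues in decreasing order along the enumeration makes the entries of the
  spectra of different matrices comparable index by index.\<close>

definition sorted_spectrum :: "real^'n^'n \<Rightarrow> ('n \<Rightarrow> real^'n) \<Rightarrow> real^'n \<Rightarrow> bool" where
  "sorted_spectrum A b s \<longleftrightarrow> (\<forall>i j. b i \<bullet> b j = (if i = j then 1 else 0)) \<and>
     (\<forall>i. A *v b i = (s $ i) *\<^sub>R b i) \<and> (\<forall>i j. enum_index i \<le> enum_index j \<longrightarrow> s $ j \<le> s $ i)"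

lemma sorted_spectrum_exists:
  fixes A :: "real^'n^'n"
  assumes A: "transpose A = A"
  shows "\<exists>b s. sorted_spectrum A b s"
proof -
  from symmetric_eigenbasis_subspace[OF A subspace_UNIV] obtain B where
    B: "finite B" "card B = CARD('n)" "pairwise orthogonal B"
      "\<forall>b\<in>B. norm b = 1 \<and> (\<exists>l. A *v b = l *\<^sub>R b)" by auto
  obtain l where l: "\<And>b. b \<in> B \<Longrightarrow> A *v b = l b *\<^sub>R b" using B(4) by metis
  obtain xs0 where xs0: "set xs0 = B" "distinct xs0" using finite_distinct_list[OF B(1)] by blast
  define xs where "xs = sort_key (\<lambda>b. - l b) xs0"
  have xs: "set xs = B" "distinct xs" "length xs = CARD('n)"
    using xs0 B(2) distinct_card[OF xs0(2)] by (auto simp: xs_def)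
  have sorted: "l (xs ! j) \<le> l (xs ! i)" if "i \<le> j" "j < CARD('n)" for i j
    using sorted_nth_mono[of "map (\<lambda>b. - l b) xs" i j] that xs by (simp add: xs_def)
  have lt: "enum_index (i :: 'n) < length xs" for i
    using bij_enum_index xs(3) by (auto simp: bij_betw_def)
  define b where "b i = xs ! enum_index i" for i :: 'n
  have bB: "b i \<in> B" for i using lt xs(1) by (auto simp: b_def)
  have "b i \<bullet> b j = (if i = j then 1 else 0)" for i j
  proof (cases "i = j")
    case True
    then show ?thesis using bB[of j] B(4) by (auto simp: power2_norm_eq_inner[symmetric])
  next
    case False
    then have "b i \<noteq> b j" using lt xs(2) by (simp add: b_def nth_eq_iff_index_eq)
    then show ?thesis using bB B(3) False by (auto simp: pairwise_def orthogonal_def)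
  qed
  then have "sorted_spectrum A b (\<chi> i. l (b i))"
    using l[OF bB] sorted lt xs(3) by (auto simp: sorted_spectrum_def b_def)
  then show ?thesis by blast
qed

section \<open>Comparison of eigenvalues of two matrices\<close>

lemma sorted_spectrum_expand:
  fixes A :: "real^'n^'n"
  assumes "sorted_spectrum A b s"
  shows "x = (\<Sum>i\<in>UNIV. (x \<bullet> b i) *\<^sub>R b i)"
proof -
  have orth: "b i \<bullet> b j = (if i = j then 1 else 0)" for i j using assms by (simp add: sorted_spectrum_def)
  have inj: "inj b"
  proof (rule injI, rule ccontr)
    fix i j assume "b i = b j" "i \<noteq> j"
    then show False using orth[of i j] orth[of j j] by simp
  qed
  have "pairwise orthogonal (range b)" using orth by (auto simp: pairwise_def orthogonal_def)
  moreover have "0 \<notin> range b"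
  proof
    assume "0 \<in> range b"
    then obtain i where "b i = 0" by auto
    then show False using orth[of i i] by simp
  qed
  ultimately have "independent (range b)" by (rule pairwise_orthogonal_independent)
  moreover have "card (range b) = DIM(real^'n)" using inj by (simp add: card_image)
  ultimately have "UNIV \<subseteq> span (range b)" by (intro card_ge_dim_independent) auto
  then have span: "span (range b) = UNIV" by blast
  define y where "y = x - (\<Sum>i\<in>UNIV. (x \<bullet> b i) *\<^sub>R b i)"
  have yb: "orthogonal y (b j)" for j
    by (simp add: y_def orthogonal_def inner_diff_left inner_sum_left orth if_distrib cong: if_cong)
  have "orthogonal y y"
    by (rule orthogonal_to_span[of _ "range b"]) (use yb span in auto)
  then have "y = 0" by (simp add: orthogonal_self)
  then show ?thesis by (simp only: y_def right_minus_eq)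
qed

lemma sorted_spectrum_quadratic:
  fixes A :: "real^'n^'n"
  assumes "sorted_spectrum A b s"
  shows "x \<bullet> x = (\<Sum>i\<in>UNIV. (x \<bullet> b i)\<^sup>2)" "x \<bullet> (A *v x) = (\<Sum>i\<in>UNIV. s $ i * (x \<bullet> b i)\<^sup>2)"
proof -
  note ex = sorted_spectrum_expand[OF assms, of x]
  have "x \<bullet> x = x \<bullet> (\<Sum>i\<in>UNIV. (x \<bullet> b i) *\<^sub>R b i)" using ex by simp
  then show "x \<bullet> x = (\<Sum>i\<in>UNIV. (x \<bullet> b i)\<^sup>2)" by (simp add: inner_sum_right power2_eq_square)
  have "A *v x = (\<Sum>i\<in>UNIV. (x \<bullet> b i) *\<^sub>R (A *v b i))"
    by (subst ex) (simp add: linear_sum[OF matrix_vector_mul_linear] matrix_vector_mult_scaleR)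
  also have "\<dots> = (\<Sum>i\<in>UNIV. (x \<bullet> b i) *\<^sub>R (s $ i *\<^sub>R b i))"
    using assms by (simp add: sorted_spectrum_def)
  finally show "x \<bullet> (A *v x) = (\<Sum>i\<in>UNIV. s $ i * (x \<bullet> b i)\<^sup>2)"
    by (simp add: inner_sum_right power2_eq_square mult_ac)
qed

text \<open>Weyl's monotonicity by a dimension count. The eigenvectors of A after k and those of B
  before k are together at most n - 1 vectors, so some nonzero x is orthogonal to all of them; on it
  the form of A is at least \<open>s $ k\<close> and that of B at most \<open>u $ k\<close>,
  relative to |x|^2.\<close>

lemma sorted_spectrum_mono:
  fixes A B :: "real^'n^'n"
  assumes A: "sorted_spectrum A b s" and B: "sorted_spectrum B c u"
    and le: "\<And>x. x \<bullet> (A *v x) \<le> x \<bullet> (B *v x)"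
  shows "s $ k \<le> u $ k"
proof -
  let ?I = "{j :: 'n. enum_index k < enum_index j}" and ?J = "{j :: 'n. enum_index j < enum_index k}"
  let ?T = "b ` ?I \<union> c ` ?J"
  have "card ?T \<le> card ?I + card ?J"
    by (intro order_trans[OF card_Un_le] add_mono card_image_le) auto
  also have "card ?I + card ?J = card (?I \<union> ?J)" by (subst card_Un_disjoint) auto
  also have "?I \<union> ?J = UNIV - {k}"
  proof (intro set_eqI)
    fix j :: 'n
    show "j \<in> ?I \<union> ?J \<longleftrightarrow> j \<in> UNIV - {k}"
      using enum_index_eq_iff[of j k] by (cases "enum_index j" "enum_index k" rule: linorder_cases) auto
  qed
  also have "card (UNIV - {k}) = CARD('n) - 1" by simp
  finally have "card ?T \<le> CARD('n) - 1" .
  moreover have "dim ?T \<le> card ?T" by (rule dim_le_card') auto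
  moreover have "CARD('n) - 1 < CARD('n)" using zero_less_card_finite[where 'a='n] by linarith
  ultimately have "dim ?T < CARD('n)" by linarith
  then have "dim ?T < DIM(real^'n)" by simp
  then obtain x where x: "x \<noteq> 0" "\<And>y. y \<in> span ?T \<Longrightarrow> orthogonal x y"
    using orthogonal_to_subspace_exists[of ?T] by blast
  have xb: "x \<bullet> b j = 0" if "enum_index k < enum_index j" for j
    using x(2)[OF span_base, of "b j"] that by (auto simp: orthogonal_def)
  have xc: "x \<bullet> c j = 0" if "enum_index j < enum_index k" for j
    using x(2)[OF span_base, of "c j"] that by (auto simp: orthogonal_def)
  have "s $ k * (x \<bullet> x) \<le> x \<bullet> (A *v x)"
    unfolding sorted_spectrum_quadratic[OF A, of x] sum_distrib_left
  proof (intro sum_mono)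
    fix i show "s $ k * (x \<bullet> b i)\<^sup>2 \<le> s $ i * (x \<bullet> b i)\<^sup>2"
      using xb[of i] A by (cases "enum_index k < enum_index i") (auto simp: sorted_spectrum_def intro: mult_right_mono)
  qed
  also have "\<dots> \<le> x \<bullet> (B *v x)" by (rule le)
  also have "\<dots> \<le> u $ k * (x \<bullet> x)"
    unfolding sorted_spectrum_quadratic[OF B, of x] sum_distrib_left
  proof (intro sum_mono)
    fix i show "u $ i * (x \<bullet> c i)\<^sup>2 \<le> u $ k * (x \<bullet> c i)\<^sup>2"
      using xc[of i] B by (cases "enum_index i < enum_index k") (auto simp: sorted_spectrum_def intro: mult_right_mono)
  qed
  finally show ?thesis using x(1) by simp
qed

lemma sorted_spectrum_shift:
  assumes "sorted_spectrum A b s"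
  shows "sorted_spectrum (A + c *\<^sub>R mat 1) b (\<chi> i. s $ i + c)"
  using assms by (simp add: sorted_spectrum_def matrix_vector_mult_add_rdistrib scaleR_matrix_vector_assoc[symmetric] scaleR_left_distrib)

text \<open>Weyl's perturbation bound: monotonicity applied to A and B shifted by d, and with the
  roles exchanged.\<close>

lemma sorted_spectrum_dist:
  fixes A B :: "real^'n^'n"
  assumes A: "sorted_spectrum A b s" and B: "sorted_spectrum B c u"
    and le: "\<And>x. \<bar>x \<bullet> (A *v x) - x \<bullet> (B *v x)\<bar> \<le> d * (x \<bullet> x)"
  shows "\<bar>s $ k - u $ k\<bar> \<le> d"
proof -
  have "s $ k \<le> (\<chi> i. u $ i + d) $ k"
    by (rule sorted_spectrum_mono[OF A sorted_spectrum_shift[OF B]])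
      (use le in \<open>simp add: abs_le_iff matrix_vector_mult_add_rdistrib scaleR_matrix_vector_assoc[symmetric] inner_add_right algebra_simps\<close>)
  moreover have "u $ k \<le> (\<chi> i. s $ i + d) $ k"
    by (rule sorted_spectrum_mono[OF B sorted_spectrum_shift[OF A]])
      (use le in \<open>simp add: abs_le_iff matrix_vector_mult_add_rdistrib scaleR_matrix_vector_assoc[symmetric] inner_add_right algebra_simps\<close>)
  ultimately show ?thesis by (simp add: abs_le_iff)
qed

section \<open>Diagonalization, trace and characteristic polynomial\<close>

lemma sorted_spectrum_matrix:
  fixes A :: "real^'n^'n"
  assumes "sorted_spectrum A b s"
  defines "P \<equiv> \<chi> i j. b j $ i"
  shows "transpose P ** P = mat 1" "P ** transpose P = mat 1" "A ** P = P ** (\<chi> i j. if i = j then s $ i else 0)"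
proof -
  have orth: "b i \<bullet> b j = (if i = j then 1 else 0)" for i j using assms(1) by (simp add: sorted_spectrum_def)
  show PP: "transpose P ** P = mat 1"
    using orth by (simp add: P_def vec_eq_iff matrix_matrix_mult_def transpose_def mat_def inner_vec_def)
  then show "P ** transpose P = mat 1" by (simp add: matrix_left_right_inverse)
  have "(A ** P) $ i $ j = (A *v b j) $ i" for i j
    by (simp add: P_def matrix_matrix_mult_def matrix_vector_mult_def)
  moreover have "A *v b j = (s $ j) *\<^sub>R b j" for j using assms(1) by (simp add: sorted_spectrum_def)
  ultimately show "A ** P = P ** (\<chi> i j. if i = j then s $ i else 0)"
    by (simp add: vec_eq_iff matrix_matrix_mult_def P_def if_distrib mult.commute cong: if_cong)
qed

lemma sorted_spectrum_trace:
  fixes A :: "real^'n^'n"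
  assumes "sorted_spectrum A b s"
  shows "(\<Sum>i\<in>UNIV. s $ i) = trace A"
proof -
  define P where "P = (\<chi> i j. b j $ i)"
  define D where "D = (\<chi> i j. if i = j then s $ i else 0)"
  note P = sorted_spectrum_matrix[OF assms, folded P_def D_def]
  have "trace A = trace (A ** (P ** transpose P))" by (simp add: P)
  also have "\<dots> = trace (transpose P ** (A ** P))"
    by (metis matrix_mul_assoc trace_mul_sym)
  also have "transpose P ** (A ** P) = D" by (simp add: P matrix_mul_assoc)
  finally show ?thesis by (simp add: trace_def D_def)
qed

lemma sorted_spectrum_charpoly:
  fixes A :: "real^'n^'n"
  assumes "sorted_spectrum A b s"
  shows "det (mat t - A) = (\<Prod>i\<in>UNIV. t - s $ i)"
proof -
  define P where "P = (\<chi> i j. b j $ i)"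
  define D where "D = (\<chi> i j. if i = j then s $ i else 0)"
  note P = sorted_spectrum_matrix[OF assms, folded P_def D_def]
  have "mat t ** P = P ** mat t"
    by (simp add: vec_eq_iff matrix_matrix_mult_def mat_def if_distrib if_distribR mult.commute cong: if_cong)
  then have "(mat t - A) ** P = P ** (mat t - D)"
  proof -
    assume comm: "mat t ** P = P ** mat t"
    have "(mat t - A) ** P = mat t ** P - A ** P"
      by (simp add: vec_eq_iff matrix_matrix_mult_def left_diff_distrib sum_subtractf)
    also have "\<dots> = P ** mat t - P ** D" by (simp add: comm P)
    also have "\<dots> = P ** (mat t - D)"
      by (simp add: vec_eq_iff matrix_matrix_mult_def right_diff_distrib sum_subtractf)
    finally show ?thesis .
  qed
  then have "det (mat t - A) * det P = det P * det (mat t - D)" by (metis det_mul)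
  moreover have "det P \<noteq> 0" by (metis P(1) det_I det_mul mult_zero_right zero_neq_one)
  ultimately have "det (mat t - A) = det (mat t - D)" by simp
  also have "\<dots> = (\<Prod>i\<in>UNIV. (mat t - D) $ i $ i)"
    by (rule det_diagonal) (simp add: D_def mat_def)
  finally show ?thesis by (simp add: D_def mat_def)
qed

text \<open>Equality of the root multisets, by cancelling one common linear factor at a time. The
  cancellation is valid off the root and extends to it by continuity.\<close>

lemma equal_monic_products_imp_bij:
  fixes l m :: "'i \<Rightarrow> real"
  assumes "finite I" "finite J" "\<And>t. (\<Prod>i\<in>I. t - l i) = (\<Prod>j\<in>J. t - m j)"
  shows "\<exists>h. bij_betw h I J \<and> (\<forall>i\<in>I. l i = m (h i))"
  using assms
proof (induction I arbitrary: J rule: finite_induct)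
  case empty
  have "J = {}"
  proof (rule ccontr)
    assume "J \<noteq> {}"
    then obtain j where j: "j \<in> J" by blast
    then have "(\<Prod>k\<in>J. m j - m k) = 0" using empty.prems(1) by (auto intro!: prod_zero)
    then show False using empty.prems(2)[of "m j"] by simp
  qed
  then show ?case by (auto simp: bij_betw_def)
next
  case (insert i I)
  have "(\<Prod>k\<in>J. l i - m k) = 0" using insert.prems(2)[of "l i"] insert.hyps by simp
  then obtain j where j: "j \<in> J" "m j = l i" using insert.prems(1) by auto
  have eq: "(\<Prod>k\<in>I. t - l k) = (\<Prod>k\<in>J - {j}. t - m k)" for t
  proof -
    let ?F = "\<lambda>t. \<Prod>k\<in>I. t - l k" and ?G = "\<lambda>t. \<Prod>k\<in>J - {j}. t - m k"
    have off: "?F t = ?G t" if "t \<noteq> l i" for t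
      using insert.prems(2)[of t] insert.hyps insert.prems(1) j that by (simp add: prod.remove[of J j])
    have "((\<lambda>t. ?F t - ?G t) \<longlongrightarrow> ?F (l i) - ?G (l i)) (at (l i))"
      by (intro tendsto_intros)
    moreover have "((\<lambda>t. ?F t - ?G t) \<longlongrightarrow> 0) (at (l i))"
      by (rule tendsto_eventually) (auto simp: eventually_at_filter off)
    ultimately have "?F (l i) - ?G (l i) = 0" using tendsto_unique[OF at_neq_bot] by blast
    then show ?thesis using off by (cases "t = l i") auto
  qed
  from insert.IH[OF _ eq] insert.prems(1) obtain h where
    h: "bij_betw h I (J - {j})" "\<forall>k\<in>I. l k = m (h k)" by blast
  have "bij_betw (h(i := j)) I (J - {j})"
    using h(1) insert.hyps(2) by (subst bij_betw_cong[of _ _ h]) auto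
  then have "bij_betw (h(i := j)) (I \<union> {i}) ((J - {j}) \<union> {(h(i := j)) i})"
    using insert.hyps(2) by (intro notIn_Un_bij_betw) auto
  moreover have "I \<union> {i} = insert i I" "(J - {j}) \<union> {(h(i := j)) i} = J" using j by auto
  ultimately have "bij_betw (h(i := j)) (insert i I) J" by simp
  moreover have "\<forall>k\<in>insert i I. l k = m ((h(i := j)) k)" using h(2) j insert.hyps by auto
  ultimately show ?case by blast
qed

text \<open>\<open>eigvals\<close> is a choice, fixed only up to order. (S1) transfers information
  from a known member of the cone to its permutations, so permutations in both directions are
  provided.\<close>

lemma eigvals_permutation:
  fixes A :: "real^'n^'n"
  assumes "sorted_spectrum A b s"
  obtains p q where "p permutes UNIV" "eigvals A = (\<chi> i. s $ p i)"
    "q permutes UNIV" "s = (\<chi> i. eigvals A $ q i)"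
proof -
  have "\<forall>t. det (mat t - A) = (\<Prod>i\<in>UNIV. t - eigvals A $ i)"
    unfolding eigvals_def using sorted_spectrum_charpoly[OF assms] by (intro someI_ex[of "\<lambda>l. \<forall>t. det (mat t - A) = (\<Prod>i\<in>UNIV. t - l $ i)"]) blast
  then have eq: "(\<Prod>i\<in>UNIV. t - eigvals A $ i) = (\<Prod>i\<in>UNIV. t - s $ i)" for t
    using sorted_spectrum_charpoly[OF assms] by metis
  obtain p where "bij p" "\<forall>i. eigvals A $ i = s $ p i"
    using equal_monic_products_imp_bij[OF _ _ eq] by auto
  moreover obtain q where "bij q" "\<forall>i. s $ i = eigvals A $ q i"
    using equal_monic_products_imp_bij[OF _ _ eq[symmetric]] by auto
  ultimately show ?thesis
    by (intro that[of p q] bij_imp_permutes) (simp_all add: vec_eq_iff)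
qed

section \<open>Second order jets and the conformal Hessian\<close>

lemma grad_eqI:
  assumes "(u has_derivative (\<lambda>h. G \<bullet> h)) (at x)" shows "grad u x = G"
  unfolding grad_def frechet_derivative_at[OF assms, symmetric] by (simp add: vec_eq_iff inner_axis)

lemma has_derivative_grad:
  fixes u :: "real^'n \<Rightarrow> real"
  assumes "u differentiable (at x)" shows "(u has_derivative (\<lambda>h. grad u x \<bullet> h)) (at x)"
proof -
  let ?D = "frechet_derivative u (at x)"
  have D: "(u has_derivative ?D) (at x)" using assms by (simp add: frechet_derivative_works)
  then interpret bounded_linear ?D by (rule has_derivative_bounded_linear)
  have "?D h = grad u x \<bullet> h" for h
  proof -
    have "?D h = ?D (\<Sum>i\<in>UNIV. h $ i *\<^sub>R axis i 1)" by (simp add: basis_expansion[of h, unfolded scalar_mult_eq_scaleR])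
    also have "\<dots> = (\<Sum>i\<in>UNIV. h $ i * ?D (axis i 1))" by (simp add: sum scaleR)
    finally show ?thesis by (simp add: grad_def inner_vec_def mult.commute)
  qed
  then have "?D = (\<lambda>h. grad u x \<bullet> h)" by blast
  with D show ?thesis by simp
qed

lemma outer_prod_mult_vec [simp]: "outer_prod v w *v h = (w \<bullet> h) *\<^sub>R v"
  by (simp add: outer_prod_def vec_eq_iff matrix_vector_mult_def inner_vec_def sum_distrib_right sum_distrib_left mult_ac)

lemma transpose_outer_prod_self [simp]: "transpose (outer_prod v v) = outer_prod v v"
  by (simp add: outer_prod_def transpose_def vec_eq_iff mult.commute)

definition quad_poly :: "real \<Rightarrow> real^'n \<Rightarrow> real^'n^'n \<Rightarrow> real^'n \<Rightarrow> real^'n \<Rightarrow> real" where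
  "quad_poly a p Q y x = a + p \<bullet> (x - y) + (x - y) \<bullet> (Q *v (x - y)) / 2"

text \<open>The conformal Hessian at \<open>y\<close> of \<open>exp (quad_poly a p Q y)\<close>; see \<open>conf_hess_exp_quad_poly\<close>.\<close>

definition log_conf_hess :: "real \<Rightarrow> real^'n \<Rightarrow> real^'n^'n \<Rightarrow> real^'n^'n" where
  "log_conf_hess a p Q = (let c = 2 / (real CARD('n) - 2) in
     exp (- 2 * c * a) *\<^sub>R (c\<^sup>2 *\<^sub>R outer_prod p p - c *\<^sub>R Q - (c\<^sup>2 / 2 * (norm p)\<^sup>2) *\<^sub>R mat 1))"

lemma exp_quad_poly_derivatives:
  fixes Q :: "real^'n^'n" and p y :: "real^'n" and a :: real
  assumes Q: "transpose Q = Q"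
  defines "u \<equiv> \<lambda>x. exp (quad_poly a p Q y x)" and "G \<equiv> \<lambda>x. p + Q *v (x - y)"
  shows "grad u x = u x *\<^sub>R G x" "(u has_derivative (\<lambda>h. (u x *\<^sub>R G x) \<bullet> h)) (at x)"
    and "(grad u has_derivative (\<lambda>h. (u x *\<^sub>R (outer_prod (G x) (G x) + Q)) *v h)) (at x)"
    and "hess u x = u x *\<^sub>R (outer_prod (G x) (G x) + Q)"
proof -
  have Qd: "((\<lambda>x. Q *v (x - y)) has_derivative (\<lambda>h. Q *v h)) (at x)" for x
    by (rule derivative_eq_intros bounded_linear.has_derivative[OF matrix_vector_mul_bounded_linear] refl | simp)+
  have qd: "(quad_poly a p Q y has_derivative (\<lambda>h. G x \<bullet> h)) (at x)" for x
  proof -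
    have "((\<lambda>x. a + p \<bullet> (x - y) + (x - y) \<bullet> (Q *v (x - y)) / 2) has_derivative
        (\<lambda>h. p \<bullet> h + ((x - y) \<bullet> (Q *v h) + h \<bullet> (Q *v (x - y))) / 2)) (at x)"
      by (auto intro!: derivative_eq_intros Qd)
    moreover have "p \<bullet> h + ((x - y) \<bullet> (Q *v h) + h \<bullet> (Q *v (x - y))) / 2 = G x \<bullet> h" for h
      using symmetric_inner_swap[OF Q, of "x - y" h] by (simp add: G_def inner_add_left inner_add_right inner_commute)
    ultimately show ?thesis by (simp add: quad_poly_def[abs_def])
  qed
  show ud: "(u has_derivative (\<lambda>h. (u x *\<^sub>R G x) \<bullet> h)) (at x)" for x
    unfolding u_def by (auto intro!: derivative_eq_intros qd)
  show gr: "grad u x = u x *\<^sub>R G x" for x by (rule grad_eqI[OF ud])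
  have Gd: "(G has_derivative (\<lambda>h. Q *v h)) (at x)" for x
    unfolding G_def by (auto intro!: derivative_eq_intros Qd)
  have "((\<lambda>x. u x *\<^sub>R G x) has_derivative (\<lambda>h. (u x *\<^sub>R (outer_prod (G x) (G x) + Q)) *v h)) (at x)"
    by (auto intro!: derivative_eq_intros ud Gd
        simp: matrix_vector_mult_add_rdistrib scaleR_matrix_vector_assoc[symmetric] algebra_simps)
  moreover have "grad u = (\<lambda>x. u x *\<^sub>R G x)" using gr by blast
  ultimately show hd: "(grad u has_derivative (\<lambda>h. (u x *\<^sub>R (outer_prod (G x) (G x) + Q)) *v h)) (at x)" by simp
  show "hess u x = u x *\<^sub>R (outer_prod (G x) (G x) + Q)"
    unfolding hess_def jacobian_def frechet_derivative_at[OF hd, symmetric] by (rule matrix_of_matrix_vector_mul)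
qed

lemma C2_on_exp_quad_poly:
  fixes Q :: "real^'n^'n"
  assumes Q: "transpose Q = Q"
  shows "C2_on W (\<lambda>x. exp (quad_poly a p Q y x))"
proof -
  note d = exp_quad_poly_derivatives[OF Q, of a p y]
  let ?u = "\<lambda>x. exp (quad_poly a p Q y x)"
  have c1: "continuous_on W (\<lambda>x. Q *v (x - y))"
    by (intro bounded_linear.continuous_on[OF matrix_vector_mul_bounded_linear] continuous_on_diff
        continuous_on_id continuous_on_const)
  have c2: "continuous_on W (quad_poly a p Q y)"
    unfolding quad_poly_def[abs_def] by (intro continuous_intros c1) simp
  have c3: "continuous_on W (\<lambda>x. (p + Q *v (x - y)) $ i)" for i
    by (intro continuous_on_component continuous_on_add continuous_on_const c1)
  have "continuous_on W (\<lambda>x. ?u x *\<^sub>R (outer_prod (p + Q *v (x - y)) (p + Q *v (x - y)) + Q))"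
    unfolding outer_prod_def
    by (intro continuous_on_scaleR continuous_on_exp continuous_on_add continuous_on_const
        continuous_on_vec_lambda continuous_on_mult c2 c3)
  then have "continuous_on W (hess ?u)"
    using d(4) by (simp cong: continuous_on_cong)
  then show ?thesis
    using d(2,3) unfolding C2_on_def differentiable_on_def
    by (meson differentiable_at_withinI differentiable_def)
qed

text \<open>With m = n - 2 and c = 2 / m, both powers of u, multiplied by the u or u^2 coming from
  the derivatives, reduce to the same factor exp (- 2 c a). The tensor product has coefficient c^2 +
  c from the gradient term and - c from the Hessian of the exponential, which leaves c^2.\<close>

lemma conf_hess_exp_quad_poly:
  fixes Q :: "real^'n^'n"
  assumes Q: "transpose Q = Q" and n: "CARD('n) \<ge> 3"
  shows "conf_hess (\<lambda>x. exp (quad_poly a p Q y x)) y = log_conf_hess a p Q"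
proof -
  define m where "m = real CARD('n) - 2"
  have m: "m > 0" using n by (simp add: m_def)
  have N: "real CARD('n) = m + 2" by (simp add: m_def)
  define c where "c = 2 / m"
  define u where "u = exp a"
  note d = exp_quad_poly_derivatives[OF Q, of a p y]
  have uy: "exp (quad_poly a p Q y y) = u" by (simp add: quad_poly_def u_def)
  have gr: "grad (\<lambda>x. exp (quad_poly a p Q y x)) y = u *\<^sub>R p" using d(1)[of y] uy by simp
  have he: "hess (\<lambda>x. exp (quad_poly a p Q y x)) y = u *\<^sub>R (outer_prod p p + Q)" using d(4)[of y] uy by simp
  define K where "K = exp (- 2 * c * a)"
  have pw: "u powr b = exp (b * a)" for b by (simp add: u_def powr_def)
  have k1: "u powr (- ((m + 2 + 2) / m)) * u = K"
  proof -
    have "u powr (- ((m + 2 + 2) / m)) * u = exp (- ((m + 2 + 2) / m) * a + a)"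
      by (simp only: pw exp_add) (simp add: u_def)
    also have "- ((m + 2 + 2) / m) * a + a = - 2 * c * a" using m by (simp add: c_def field_simps)
    finally show ?thesis by (simp add: K_def)
  qed
  have k2: "u powr (- (2 * (m + 2) / m)) * u\<^sup>2 = K"
  proof -
    have "u powr (- (2 * (m + 2) / m)) * u\<^sup>2 = exp (- (2 * (m + 2) / m) * a + (a + a))"
      by (simp only: pw exp_add) (simp add: u_def power2_eq_square)
    also have "- (2 * (m + 2) / m) * a + (a + a) = - 2 * c * a" using m by (simp add: c_def field_simps)
    finally show ?thesis by (simp add: K_def)
  qed
  have o: "outer_prod (u *\<^sub>R p) (u *\<^sub>R p) = u\<^sup>2 *\<^sub>R outer_prod p p"
    by (simp add: outer_prod_def vec_eq_iff power2_eq_square mult_ac)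
  have nn: "(norm (u *\<^sub>R p))\<^sup>2 = u\<^sup>2 * (norm p)\<^sup>2" by (simp add: power_mult_distrib)
  have 1: "(- (2 / m) * u powr (- ((m + 2 + 2) / m))) *\<^sub>R (u *\<^sub>R (outer_prod p p + Q)) = (- c * K) *\<^sub>R (outer_prod p p + Q)"
    unfolding scaleR_scaleR mult.assoc k1 c_def by simp
  have 2: "(2 * (m + 2) / m\<^sup>2 * u powr (- (2 * (m + 2) / m))) *\<^sub>R (u\<^sup>2 *\<^sub>R outer_prod p p) = (2 * (m + 2) / m\<^sup>2 * K) *\<^sub>R outer_prod p p"
    unfolding scaleR_scaleR mult.assoc k2 by simp
  have 3: "2 / m\<^sup>2 * u powr (- (2 * (m + 2) / m)) * (u\<^sup>2 * (norm p)\<^sup>2) = K * (c\<^sup>2 / 2 * (norm p)\<^sup>2)"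
  proof -
    have "2 / m\<^sup>2 * u powr (- (2 * (m + 2) / m)) * (u\<^sup>2 * (norm p)\<^sup>2) =
        2 / m\<^sup>2 * (u powr (- (2 * (m + 2) / m)) * u\<^sup>2) * (norm p)\<^sup>2" by (simp only: mult.assoc)
    also have "\<dots> = K * (c\<^sup>2 / 2 * (norm p)\<^sup>2)" unfolding k2 by (simp add: c_def power2_eq_square)
    finally show ?thesis .
  qed
  have 4: "2 * (m + 2) / m\<^sup>2 * K = K * (c\<^sup>2 + c)"
    using m by (simp add: c_def field_simps power2_eq_square)
  show ?thesis
    unfolding conf_hess_def log_conf_hess_def Let_def N uy gr he o nn add_diff_cancel_right' 1 2 3 4
    by (simp only: c_def[symmetric] K_def[symmetric]) (simp add: algebra_simps)
qed

text \<open>The exponential of a quadratic is smooth and positive on all of \<Omega>, as the test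
  functions must be, while touching is required near y only. A bare quadratic could become negative
  away from y.\<close>

lemma visc_sub_jet:
  fixes Q :: "real^'n^'n"
  assumes "visc_sub f \<Gamma> \<Omega> u1" and n: "CARD('n) \<ge> 3" and y: "y \<in> \<Omega>" and Q: "transpose Q = Q"
    and a: "u1 y = exp a" and touch: "\<forall>\<^sub>F z in nhds y. u1 z \<le> exp (quad_poly a p Q y z)"
  shows "eigvals (log_conf_hess a p Q) \<notin> closure \<Gamma> \<or> f (eigvals (log_conf_hess a p Q)) \<le> 1"
proof -
  have "u1 y - exp (quad_poly a p Q y y) = 0" by (simp add: a quad_poly_def)
  moreover have "\<forall>\<^sub>F z in nhds y. u1 z - exp (quad_poly a p Q y z) \<le> 0" using touch by simp
  moreover have "\<forall>x\<in>\<Omega>. 0 < exp (quad_poly a p Q y x)" by simp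
  ultimately have "eigvals (conf_hess (\<lambda>x. exp (quad_poly a p Q y x)) y) \<notin> closure \<Gamma> \<or>
      f (eigvals (conf_hess (\<lambda>x. exp (quad_poly a p Q y x)) y)) \<le> 1"
    using assms(1) y C2_on_exp_quad_poly[OF Q, of \<Omega> a p y] unfolding visc_sub_def by blast
  then show ?thesis by (simp only: conf_hess_exp_quad_poly[OF Q n])
qed

lemma visc_super_jet:
  fixes Q :: "real^'n^'n"
  assumes "visc_super f \<Gamma> \<Omega> u2" and n: "CARD('n) \<ge> 3" and y: "y \<in> \<Omega>" and Q: "transpose Q = Q"
    and a: "u2 y = ereal (exp a)" and touch: "\<forall>\<^sub>F z in nhds y. ereal (exp (quad_poly a p Q y z)) \<le> u2 z"
  shows "eigvals (log_conf_hess a p Q) \<in> closure \<Gamma> \<and> f (eigvals (log_conf_hess a p Q)) \<ge> 1"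
proof -
  have "u2 y - ereal (exp (quad_poly a p Q y y)) = 0" by (simp add: a quad_poly_def zero_ereal_def)
  moreover have "\<forall>\<^sub>F z in nhds y. u2 z - ereal (exp (quad_poly a p Q y z)) \<ge> 0"
    using touch by eventually_elim (simp add: ereal_le_minus_iff)
  moreover have "\<forall>x\<in>\<Omega>. 0 < exp (quad_poly a p Q y x)" by simp
  ultimately have "eigvals (conf_hess (\<lambda>x. exp (quad_poly a p Q y x)) y) \<in> closure \<Gamma> \<and>
      f (eigvals (conf_hess (\<lambda>x. exp (quad_poly a p Q y x)) y)) \<ge> 1"
    using assms(1) y C2_on_exp_quad_poly[OF Q, of \<Omega> a p y] unfolding visc_super_def by blast
  then show ?thesis by (simp only: conf_hess_exp_quad_poly[OF Q n])
qed

text \<open>Differentiability of the gradient at the single point x suffices: its first order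
  expansion is integrated along segments issuing from x by the mean value inequality.\<close>

lemma gradient_peano_expansion:
  fixes \<psi> :: "'a::euclidean_space \<Rightarrow> real"
  assumes S: "open S" "x \<in> S" and \<psi>: "\<And>z. z \<in> S \<Longrightarrow> (\<psi> has_derivative (\<lambda>h. g z \<bullet> h)) (at z)"
    and g: "(g has_derivative Y) (at x)" and \<eta>: "\<eta> > 0"
  shows "\<forall>\<^sub>F z in nhds x. \<bar>\<psi> z - \<psi> x - g x \<bullet> (z - x) - (z - x) \<bullet> Y (z - x) / 2\<bar> \<le> \<eta> * (norm (z - x))\<^sup>2"
proof -
  interpret bounded_linear Y by (rule has_derivative_bounded_linear[OF g])
  obtain d1 where d1: "d1 > 0" "ball x d1 \<subseteq> S" using S open_contains_ball by blast
  obtain d2 where d2: "d2 > 0" "\<And>z. norm (z - x) < d2 \<Longrightarrow> norm (g z - g x - Y (z - x)) \<le> \<eta> * norm (z - x)"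
    using g \<eta> unfolding has_derivative_at_alt by blast
  have "\<bar>\<psi> z - \<psi> x - g x \<bullet> (z - x) - (z - x) \<bullet> Y (z - x) / 2\<bar> \<le> \<eta> * (norm (z - x))\<^sup>2"
    if z: "dist z x < min d1 d2" for z
  proof -
    define k where "k = z - x"
    have k: "norm k < d1" "norm k < d2" using z by (auto simp: k_def dist_norm)
    \<comment> \<open>The Taylor remainder along the segment; its derivative is the remainder of the
      expansion of g, paired with k.\<close>
    define \<phi> where "\<phi> t = \<psi> (x + t *\<^sub>R k) - t * (g x \<bullet> k) - t\<^sup>2 * (k \<bullet> Y k) / 2" for t
    have tk: "norm (t *\<^sub>R k) \<le> norm k" if "t \<in> {0..1}" for t
      using that by (auto intro: mult_left_le_one_le)
    have der: "(\<phi> has_derivative (\<lambda>s. s * ((g (x + t *\<^sub>R k) - g x - Y (t *\<^sub>R k)) \<bullet> k))) (at t)"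
      if "t \<in> {0..1}" for t
    proof -
      have "x + t *\<^sub>R k \<in> S" using tk[OF that] k d1 by (auto simp: dist_norm)
      from \<psi>[OF this] have "((\<lambda>t. \<psi> (x + t *\<^sub>R k)) has_derivative (\<lambda>s. g (x + t *\<^sub>R k) \<bullet> (s *\<^sub>R k))) (at t)"
        by (rule has_derivative_compose[rotated]) (auto intro!: derivative_eq_intros)
      then show ?thesis unfolding \<phi>_def
        by (auto intro!: derivative_eq_intros simp: scaleR inner_diff_left inner_commute[of k] algebra_simps)
    qed
    have "norm (\<phi> 1 - \<phi> 0) \<le> \<eta> * (norm k)\<^sup>2 * norm (1 - 0 :: real)"
    proof (rule differentiable_bound[of "{0..1}"])
      fix t :: real assume t: "t \<in> {0..1}"
      show "(\<phi> has_derivative (\<lambda>s. s * ((g (x + t *\<^sub>R k) - g x - Y (t *\<^sub>R k)) \<bullet> k))) (at t within {0..1})"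
        by (rule has_derivative_at_withinI[OF der[OF t]])
      have "norm (t *\<^sub>R k) < d2" using tk[OF t] k by linarith
      then have "norm (g (x + t *\<^sub>R k) - g x - Y (t *\<^sub>R k)) \<le> \<eta> * norm (t *\<^sub>R k)"
        using d2(2)[of "x + t *\<^sub>R k"] by simp
      also have "\<dots> \<le> \<eta> * norm k" using tk[OF t] \<eta> by (intro mult_left_mono) auto
      finally have "norm (g (x + t *\<^sub>R k) - g x - Y (t *\<^sub>R k)) * norm k \<le> \<eta> * norm k * norm k"
        by (intro mult_right_mono) auto
      then have "\<bar>(g (x + t *\<^sub>R k) - g x - Y (t *\<^sub>R k)) \<bullet> k\<bar> \<le> \<eta> * (norm k)\<^sup>2"
        using Cauchy_Schwarz_ineq2[of "g (x + t *\<^sub>R k) - g x - Y (t *\<^sub>R k)" k]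
        by (simp add: power2_eq_square)
      then show "onorm (\<lambda>s. s * ((g (x + t *\<^sub>R k) - g x - Y (t *\<^sub>R k)) \<bullet> k)) \<le> \<eta> * (norm k)\<^sup>2"
        by (intro onorm_le) (simp add: abs_mult mult.commute mult_left_mono)
    qed auto
    then show ?thesis by (simp add: \<phi>_def k_def)
  qed
  then show ?thesis
    unfolding eventually_nhds_metric using d1 d2 by (intro exI[of _ "min d1 d2"]) auto
qed

lemma lipschitz_derivative_bound:
  fixes g :: "'a::euclidean_space \<Rightarrow> 'b::real_normed_vector"
  assumes g: "L-lipschitz_on S g" and x: "x \<in> interior S" and Y: "(g has_derivative Y) (at x)"
  shows "norm (Y h) \<le> L * norm h"
proof (cases "h = 0")
  case False
  interpret bounded_linear Y by (rule has_derivative_bounded_linear[OF Y])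
  obtain d1 where d1: "d1 > 0" "ball x d1 \<subseteq> S" using x by (meson mem_interior)
  show ?thesis
  proof (rule field_le_epsilon)
    fix e :: real assume "e > 0"
    define e' where "e' = e / norm h"
    have e': "e' > 0" using \<open>e > 0\<close> False by (simp add: e'_def)
    obtain d2 where d2: "d2 > 0" "\<And>z. norm (z - x) < d2 \<Longrightarrow> norm (g z - g x - Y (z - x)) \<le> e' * norm (z - x)"
      using Y e' unfolding has_derivative_at_alt by blast
    define t where "t = min d1 d2 / (2 * norm h)"
    have t: "t > 0" using d1 d2 False by (simp add: t_def)
    have "t * norm h = min d1 d2 / 2" using False by (simp add: t_def)
    then have th: "t * norm h < d1" "t * norm h < d2" using d1 d2 by linarith+
    have "x + t *\<^sub>R h \<in> S" "x \<in> S" using th(1) t d1 by (auto simp: dist_norm)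
    then have "norm (g (x + t *\<^sub>R h) - g x) \<le> L * (t * norm h)"
      using lipschitz_onD[OF g, of "x + t *\<^sub>R h" x] t by (simp add: dist_norm)
    moreover have "norm (g (x + t *\<^sub>R h) - g x - t *\<^sub>R Y h) \<le> e' * (t * norm h)"
      using d2(2)[of "x + t *\<^sub>R h"] th t by (simp add: scaleR)
    ultimately have "norm (t *\<^sub>R Y h) \<le> L * (t * norm h) + e' * (t * norm h)"
      using norm_triangle_ineq4[of "g (x + t *\<^sub>R h) - g x" "g (x + t *\<^sub>R h) - g x - t *\<^sub>R Y h"] by simp
    then have "t * norm (Y h) \<le> t * (L * norm h + e' * norm h)"
      using t by (simp add: algebra_simps)
    then show "norm (Y h) \<le> L * norm h + e" using t False by (simp add: e'_def)
  qed
qed (use linear_0[OF has_derivative_linear[OF Y]] in simp)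

text \<open>Only the quadratic form of the derivative of the gradient enters the Peano expansion.
  Its symmetric part therefore serves as Hessian, without any appeal to the symmetry of second
  derivatives.\<close>

definition sym_matrix :: "(real^'n \<Rightarrow> real^'n) \<Rightarrow> real^'n^'n" where
  "sym_matrix Y = (1 / 2) *\<^sub>R (matrix Y + transpose (matrix Y))"

lemma transpose_sym_matrix [simp]: "transpose (sym_matrix Y) = sym_matrix Y"
  by (simp add: sym_matrix_def transpose_def vec_eq_iff add.commute)

lemma sym_matrix_quadratic:
  assumes "linear Y" shows "h \<bullet> (sym_matrix Y *v h) = h \<bullet> Y h"
proof -
  have "h \<bullet> (transpose (matrix Y) *v h) = h \<bullet> (matrix Y *v h)"
    by (metis dot_lmul_matrix inner_commute transpose_matrix_vector transpose_transpose)
  moreover have "matrix Y *v h = Y h" using assms by (simp add: matrix_works)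
  ultimately show ?thesis
    by (simp add: sym_matrix_def scaleR_matrix_vector_assoc[symmetric] matrix_vector_mult_add_rdistrib inner_add_right)
qed

lemma transpose_add: "transpose (A + B) = transpose A + transpose B"
  and transpose_diff: "transpose (A - B) = transpose A - transpose (B :: 'a::ab_group_add^'n^'m)"
  and transpose_scaleR: "transpose (r *\<^sub>R M) = r *\<^sub>R transpose (M :: real^'k^'l)"
  by (simp_all add: transpose_def vec_eq_iff)

lemma transpose_log_conf_hess [simp]:
  "transpose Q = Q \<Longrightarrow> transpose (log_conf_hess a p Q) = log_conf_hess a p Q"
  by (simp add: log_conf_hess_def Let_def transpose_add transpose_diff transpose_scaleR transpose_mat)

lemma log_conf_hess_quadratic:
  fixes Q :: "real^'n^'n"
  defines "c \<equiv> 2 / (real CARD('n) - 2)"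
  shows "x \<bullet> (log_conf_hess a p Q *v x) =
    exp (- 2 * c * a) * (c\<^sup>2 * (p \<bullet> x)\<^sup>2 - c * (x \<bullet> (Q *v x)) - c\<^sup>2 / 2 * (norm p)\<^sup>2 * (x \<bullet> x))"
  unfolding log_conf_hess_def Let_def c_def[symmetric]
  by (simp add: matrix_vector_mult_diff_rdistrib scaleR_matrix_vector_assoc[symmetric] inner_diff_right
      power2_eq_square inner_commute algebra_simps)

section \<open>Dependence of the conformal Hessian on the jet\<close>

lemma exp_diff_bound:
  fixes x y :: real
  assumes "\<bar>x\<bar> \<le> M" "\<bar>y\<bar> \<le> M"
  shows "\<bar>exp x - exp y\<bar> \<le> exp M * \<bar>x - y\<bar>"
proof -
  have "norm (exp x - exp y) \<le> exp M * norm (x - y)"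
  proof (rule differentiable_bound[of "{-M..M}" exp "\<lambda>z h. h * exp z"])
    fix z assume z: "z \<in> {-M..M}"
    show "(exp has_derivative (\<lambda>h. h * exp z)) (at z within {-M..M})"
      by (auto intro!: derivative_eq_intros simp: mult.commute)
    show "onorm (\<lambda>h. h * exp z) \<le> exp M"
      using z by (intro onorm_le) (simp add: abs_mult mult.commute mult_left_mono)
  qed (use assms in \<open>auto simp: abs_le_iff\<close>)
  then show ?thesis by simp
qed

text \<open>e collects the differences of values, gradients and Hessians apart from the rank-one
  part t. Since Q enters with the factor - c, a larger second Hessian makes the first conformal
  Hessian larger, by the exponential factor times c t in direction \<xi>.\<close>

lemma log_conf_hess_perturbation:
  fixes R :: real
  assumes n: "CARD('n) \<ge> 3" and R: "R \<ge> 1"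
  defines "c \<equiv> 2 / (real CARD('n) - 2)"
obtains C where "C \<ge> 1"
    and "\<And>a (p :: real^'n) Q h. \<bar>a\<bar> \<le> R \<Longrightarrow> norm p \<le> R \<Longrightarrow> \<bar>h \<bullet> (Q *v h)\<bar> \<le> R * (h \<bullet> h) \<Longrightarrow>
      \<bar>h \<bullet> (log_conf_hess a p Q *v h)\<bar> \<le> C * (h \<bullet> h)"
    and "\<And>a1 a2 e (p1 :: real^'n) p2 Q1 Q2 t \<xi> h. \<bar>a1\<bar> \<le> R \<Longrightarrow> \<bar>a2\<bar> \<le> R \<Longrightarrow> norm p1 \<le> R \<Longrightarrow> norm p2 \<le> R \<Longrightarrow>
      (\<And>h. \<bar>h \<bullet> (Q1 *v h)\<bar> \<le> R * (h \<bullet> h)) \<Longrightarrow>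
      (\<And>h. \<bar>h \<bullet> (Q2 *v h) - h \<bullet> (Q1 *v h) - t * (\<xi> \<bullet> h)\<^sup>2\<bar> \<le> e * (h \<bullet> h)) \<Longrightarrow>
      norm (p1 - p2) \<le> e \<Longrightarrow> \<bar>a1 - a2\<bar> \<le> e \<Longrightarrow>
      \<bar>h \<bullet> (log_conf_hess a1 p1 Q1 *v h) - h \<bullet> (log_conf_hess a2 p2 Q2 *v h)
        - exp (- 2 * c * a2) * c * t * (\<xi> \<bullet> h)\<^sup>2\<bar> \<le> C * e * (h \<bullet> h)"
proof -
  have c: "c > 0" using n by (simp add: c_def)
  define X where "X = exp (2 * c * R)"
  have X: "X > 0" by (simp add: X_def)
  define B where "B = c\<^sup>2 * R\<^sup>2 + c * R + c\<^sup>2 / 2 * R\<^sup>2"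
  have B: "B \<ge> 0" using c R by (simp add: B_def)
  \<comment> \<open>X B bounds the form itself. In the other entry, 2 c X B comes from the change of
    the exponential factor, and c + 3 c^2 R from the Hessians (c), the tensor product (2 c^2 R) and
    the squared norm (c^2 R).\<close>
  define C where "C = max 1 (max (X * B) (X * 2 * c * B + X * (c + 3 * c\<^sup>2 * R)))"
  have C: "C \<ge> 1" "X * B \<le> C" "X * 2 * c * B + X * (c + 3 * c\<^sup>2 * R) \<le> C" by (auto simp: C_def)
  define M where "M p Q h = c\<^sup>2 * (p \<bullet> h)\<^sup>2 - c * (h \<bullet> (Q *v h)) - c\<^sup>2 / 2 * (norm p)\<^sup>2 * (h \<bullet> h)"
    for p h :: "real^'n" and Q
  have qf: "h \<bullet> (log_conf_hess a p Q *v h) = exp (- 2 * c * a) * M p Q h" for a p Q and h :: "real^'n"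
    unfolding log_conf_hess_quadratic c_def M_def ..
  have hh: "h \<bullet> h = (norm h)\<^sup>2" for h :: "real^'n" by (simp add: power2_norm_eq_inner)
  have Mb: "\<bar>M p Q h\<bar> \<le> B * (h \<bullet> h)" if "norm p \<le> R" "\<bar>h \<bullet> (Q *v h)\<bar> \<le> R * (h \<bullet> h)" for p Q h
  proof -
    have "\<bar>p \<bullet> h\<bar> \<le> norm p * norm h" by (rule Cauchy_Schwarz_ineq2)
    also have "\<dots> \<le> R * norm h" using that by (intro mult_right_mono) auto
    finally have "(p \<bullet> h)\<^sup>2 \<le> (R * norm h)\<^sup>2" by (simp add: abs_le_square_iff[symmetric] R)
    then have "c\<^sup>2 * (p \<bullet> h)\<^sup>2 \<le> c\<^sup>2 * (R\<^sup>2 * (h \<bullet> h))"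
      by (intro mult_left_mono) (auto simp: power_mult_distrib hh)
    moreover have "c\<^sup>2 / 2 * (norm p)\<^sup>2 * (h \<bullet> h) \<le> c\<^sup>2 / 2 * R\<^sup>2 * (h \<bullet> h)"
      using that by (intro mult_right_mono mult_left_mono power_mono) auto
    moreover have "\<bar>c * (h \<bullet> (Q *v h))\<bar> \<le> c * (R * (h \<bullet> h))"
      using that c by (simp add: abs_mult mult_left_mono)
    moreover have "0 \<le> c\<^sup>2 * (p \<bullet> h)\<^sup>2" "0 \<le> c\<^sup>2 / 2 * (norm p)\<^sup>2 * (h \<bullet> h)" by simp_all
    moreover have "B * (h \<bullet> h) = c\<^sup>2 * (R\<^sup>2 * (h \<bullet> h)) + c * (R * (h \<bullet> h)) + c\<^sup>2 / 2 * R\<^sup>2 * (h \<bullet> h)"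
      by (simp add: B_def algebra_simps)
    ultimately show ?thesis unfolding M_def by (simp only: abs_le_iff) linarith
  qed
  have K: "\<bar>- 2 * c * a\<bar> \<le> 2 * c * R" "exp (- 2 * c * a) \<le> X" if "\<bar>a\<bar> \<le> R" for a
  proof -
    show 1: "\<bar>- 2 * c * a\<bar> \<le> 2 * c * R" using that c by (simp add: abs_mult)
    show "exp (- 2 * c * a) \<le> X" unfolding X_def exp_le_cancel_iff using 1 by linarith
  qed
  have main: "\<bar>exp (- 2 * c * a1) * M p1 Q1 h - exp (- 2 * c * a2) * M p2 Q2 h
      - exp (- 2 * c * a2) * c * t * (\<xi> \<bullet> h)\<^sup>2\<bar> \<le> C * e * (h \<bullet> h)"
    if a: "\<bar>a1\<bar> \<le> R" "\<bar>a2\<bar> \<le> R" and p: "norm p1 \<le> R" "norm p2 \<le> R"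
      and Q: "\<And>h. \<bar>h \<bullet> (Q1 *v h)\<bar> \<le> R * (h \<bullet> h)"
      and d: "\<And>h. \<bar>h \<bullet> (Q2 *v h) - h \<bullet> (Q1 *v h) - t * (\<xi> \<bullet> h)\<^sup>2\<bar> \<le> e * (h \<bullet> h)"
        "norm (p1 - p2) \<le> e" "\<bar>a1 - a2\<bar> \<le> e"
    for a1 a2 e p1 p2 Q1 Q2 t \<xi> and h :: "real^'n"
  proof -
    let ?K1 = "exp (- 2 * c * a1)" and ?K2 = "exp (- 2 * c * a2)" and ?n = "h \<bullet> h"
    have e: "e \<ge> 0" using d(3) by linarith
    have n0: "?n \<ge> 0" by simp
    have "\<bar>?K1 - ?K2\<bar> \<le> X * \<bar>- 2 * c * a1 - - 2 * c * a2\<bar>"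
      unfolding X_def by (rule exp_diff_bound[OF K(1) K(1)]) (rule a)+
    also have "- 2 * c * a1 - - 2 * c * a2 = - (2 * c) * (a1 - a2)" by (simp add: algebra_simps)
    also have "X * \<bar>- (2 * c) * (a1 - a2)\<bar> = X * (2 * c * \<bar>a1 - a2\<bar>)" using c by (simp add: abs_mult)
    also have "\<dots> \<le> X * (2 * c * e)" using X c d(3) by (intro mult_left_mono) auto
    finally have k: "\<bar>?K1 - ?K2\<bar> \<le> X * (2 * c * e)" .
    have 1: "\<bar>(?K1 - ?K2) * M p1 Q1 h\<bar> \<le> (X * (2 * c * e)) * (B * ?n)"
      unfolding abs_mult using k Mb[OF p(1) Q] X c e B by (intro mult_mono) auto
    have sq: "\<bar>(p1 \<bullet> h)\<^sup>2 - (p2 \<bullet> h)\<^sup>2\<bar> \<le> 2 * R * e * ?n"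
    proof -
      have "(p1 \<bullet> h)\<^sup>2 - (p2 \<bullet> h)\<^sup>2 = ((p1 - p2) \<bullet> h) * ((p1 + p2) \<bullet> h)"
        by (simp add: inner_diff_left inner_add_left power2_eq_square algebra_simps)
      moreover have "\<bar>(p1 - p2) \<bullet> h\<bar> \<le> e * norm h"
        using Cauchy_Schwarz_ineq2[of "p1 - p2" h] d(2) by (meson mult_right_mono norm_ge_zero order_trans)
      moreover have "\<bar>(p1 + p2) \<bullet> h\<bar> \<le> 2 * R * norm h"
      proof -
        have "norm (p1 + p2) \<le> 2 * R" using norm_triangle_ineq[of p1 p2] p by linarith
        then show ?thesis
          using Cauchy_Schwarz_ineq2[of "p1 + p2" h] by (meson mult_right_mono norm_ge_zero order_trans)
      qed
      ultimately have "\<bar>(p1 \<bullet> h)\<^sup>2 - (p2 \<bullet> h)\<^sup>2\<bar> \<le> (e * norm h) * (2 * R * norm h)"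
        unfolding abs_mult using e by (simp only: abs_mult) (intro mult_mono, auto)
      then show ?thesis by (simp add: hh power2_eq_square mult_ac)
    qed
    have nsq: "\<bar>(norm p1)\<^sup>2 - (norm p2)\<^sup>2\<bar> \<le> 2 * R * e"
    proof -
      have "(norm p1)\<^sup>2 - (norm p2)\<^sup>2 = (norm p1 - norm p2) * (norm p1 + norm p2)"
        by (simp add: power2_eq_square algebra_simps)
      moreover have "\<bar>norm p1 - norm p2\<bar> \<le> e" using norm_triangle_ineq3[of p1 p2] d(2) by linarith
      moreover have "\<bar>norm p1 + norm p2\<bar> \<le> 2 * R" using p by simp
      ultimately have "\<bar>(norm p1)\<^sup>2 - (norm p2)\<^sup>2\<bar> \<le> e * (2 * R)"
        using e by (simp only: abs_mult) (intro mult_mono, auto)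
      then show ?thesis by (simp add: mult_ac)
    qed
    have "M p1 Q1 h - M p2 Q2 h - c * t * (\<xi> \<bullet> h)\<^sup>2 =
        c\<^sup>2 * ((p1 \<bullet> h)\<^sup>2 - (p2 \<bullet> h)\<^sup>2) + c * (h \<bullet> (Q2 *v h) - h \<bullet> (Q1 *v h) - t * (\<xi> \<bullet> h)\<^sup>2)
        - c\<^sup>2 / 2 * (((norm p1)\<^sup>2 - (norm p2)\<^sup>2) * ?n)"
      by (simp add: M_def algebra_simps)
    moreover have "\<bar>c\<^sup>2 * ((p1 \<bullet> h)\<^sup>2 - (p2 \<bullet> h)\<^sup>2)\<bar> \<le> c\<^sup>2 * (2 * R * e * ?n)"
      using sq by (simp add: abs_mult mult_left_mono)
    moreover have "\<bar>c * (h \<bullet> (Q2 *v h) - h \<bullet> (Q1 *v h) - t * (\<xi> \<bullet> h)\<^sup>2)\<bar> \<le> c * (e * ?n)"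
      using d(1)[of h] c by (simp add: abs_mult mult_left_mono)
    moreover have "\<bar>c\<^sup>2 / 2 * (((norm p1)\<^sup>2 - (norm p2)\<^sup>2) * ?n)\<bar> \<le> c\<^sup>2 / 2 * (2 * R * e * ?n)"
    proof -
      have "\<bar>((norm p1)\<^sup>2 - (norm p2)\<^sup>2) * ?n\<bar> \<le> 2 * R * e * ?n"
        using mult_right_mono[OF nsq n0] by (simp add: abs_mult)
      from mult_left_mono[OF this, of "c\<^sup>2 / 2"] show ?thesis by (simp add: abs_mult)
    qed
    moreover have "c\<^sup>2 * (2 * R * e * ?n) + c * (e * ?n) + c\<^sup>2 / 2 * (2 * R * e * ?n) = (c + 3 * c\<^sup>2 * R) * e * ?n"
      by (simp add: algebra_simps)
    ultimately have "\<bar>M p1 Q1 h - M p2 Q2 h - c * t * (\<xi> \<bullet> h)\<^sup>2\<bar> \<le> (c + 3 * c\<^sup>2 * R) * e * ?n"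
      by linarith
    then have 2: "\<bar>?K2 * (M p1 Q1 h - M p2 Q2 h - c * t * (\<xi> \<bullet> h)\<^sup>2)\<bar> \<le> X * ((c + 3 * c\<^sup>2 * R) * e * ?n)"
      unfolding abs_mult using K(2)[OF a(2)] X by (intro mult_mono) auto
    have "?K1 * M p1 Q1 h - ?K2 * M p2 Q2 h - ?K2 * c * t * (\<xi> \<bullet> h)\<^sup>2 =
        (?K1 - ?K2) * M p1 Q1 h + ?K2 * (M p1 Q1 h - M p2 Q2 h - c * t * (\<xi> \<bullet> h)\<^sup>2)"
      by (simp add: algebra_simps)
    then have "\<bar>?K1 * M p1 Q1 h - ?K2 * M p2 Q2 h - ?K2 * c * t * (\<xi> \<bullet> h)\<^sup>2\<bar> \<le>
        (X * (2 * c * e)) * (B * ?n) + X * ((c + 3 * c\<^sup>2 * R) * e * ?n)"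
      using 1 2 by linarith
    also have "\<dots> = (X * 2 * c * B + X * (c + 3 * c\<^sup>2 * R)) * (e * ?n)" by (simp add: algebra_simps)
    also have "\<dots> \<le> C * (e * ?n)" using C(3) e n0 by (intro mult_right_mono) auto
    finally show ?thesis by (simp add: mult_ac)
  qed
  have bd: "\<bar>h \<bullet> (log_conf_hess a p Q *v h)\<bar> \<le> C * (h \<bullet> h)"
    if "\<bar>a\<bar> \<le> R" "norm p \<le> R" "\<bar>h \<bullet> (Q *v h)\<bar> \<le> R * (h \<bullet> h)" for a p Q and h :: "real^'n"
  proof -
    have "\<bar>exp (- 2 * c * a) * M p Q h\<bar> \<le> X * (B * (h \<bullet> h))"
      unfolding abs_mult using K(2)[OF that(1)] Mb[OF that(2,3)] X by (intro mult_mono) auto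
    also have "\<dots> \<le> C * (h \<bullet> h)" using C(2) by (simp add: mult.assoc[symmetric] mult_right_mono)
    finally show ?thesis unfolding qf .
  qed
  show ?thesis
    by (rule that[of C, OF C(1)], erule (2) bd, unfold qf, rule main)
qed

text \<open>The incompatibility of a sub-solution jet (index 1) and a super-solution jet (index 2),
  stated once for both uses. t \<xi> \<otimes> \<xi> is the gain and e the error: \<kappa> says how
  small e must be relative to the gain, and \<theta> keeps the spectra in a compact subset of the
  cone.\<close>

definition jets_exclusive ::
  "(real^'n \<Rightarrow> real) \<Rightarrow> (real^'n) set \<Rightarrow> real \<Rightarrow> real \<Rightarrow> real \<Rightarrow> bool" where
  "jets_exclusive f \<Gamma> R \<kappa> \<theta> \<longleftrightarrow> (\<forall>a1 a2 e (p1 :: real^'n) p2 Q1 Q2 t \<xi>.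
    \<bar>a1\<bar> \<le> R \<and> \<bar>a2\<bar> \<le> R \<and> norm p1 \<le> R \<and> norm p2 \<le> R \<and> transpose Q1 = Q1 \<and> transpose Q2 = Q2 \<and>
    (\<forall>h. \<bar>h \<bullet> (Q1 *v h)\<bar> \<le> R * (h \<bullet> h)) \<and> (\<forall>h. \<bar>h \<bullet> (Q2 *v h)\<bar> \<le> R * (h \<bullet> h)) \<and>
    (\<forall>h. \<bar>h \<bullet> (Q2 *v h) - h \<bullet> (Q1 *v h) - t * (\<xi> \<bullet> h)\<^sup>2\<bar> \<le> e * (h \<bullet> h)) \<and>
    norm (p1 - p2) \<le> e \<and> \<bar>a1 - a2\<bar> \<le> e \<and> 0 \<le> t \<and> t * (\<xi> \<bullet> \<xi>) + e \<le> \<theta> \<and> e < \<kappa> * t * (\<xi> \<bullet> \<xi>) \<and>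
    (eigvals (log_conf_hess a1 p1 Q1) \<notin> closure \<Gamma> \<or> f (eigvals (log_conf_hess a1 p1 Q1)) \<le> 1) \<and>
    eigvals (log_conf_hess a2 p2 Q2) \<in> closure \<Gamma> \<and> f (eigvals (log_conf_hess a2 p2 Q2)) \<ge> 1 \<longrightarrow> False)"

text \<open>Starting from the spectrum of the super-solution jet, where f is at least 1, (S3) turns
  the rank-one gain into an increase of f, and (S4) limits what the errors can take back. The
  sub-solution spectrum would then lie in the cone with f > 1.\<close>

lemma ellipticity_contradiction:
  fixes \<Gamma> :: "(real^'n) set" and f :: "real^'n \<Rightarrow> real"
  assumes n: "CARD('n) \<ge> 3" and G: "open \<Gamma>" and f: "continuous_on (closure \<Gamma>) f"
    and S: "S1 f \<Gamma>" "S2 f \<Gamma>" "S3 f \<Gamma>" "S4 f \<Gamma>" "S5 f \<Gamma>" and R: "R \<ge> 1"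
  shows "\<exists>\<kappa>>0. \<exists>\<theta>>0. jets_exclusive f \<Gamma> R \<kappa> \<theta>"
proof -
  define c where "c = 2 / (real CARD('n) - 2)"
  have c: "c > 0" using n by (simp add: c_def)
  define N where "N = real CARD('n)"
  have N: "N > 0" by (simp add: N_def)
  show ?thesis
  proof (rule log_conf_hess_perturbation[OF n R, folded c_def])
  fix C assume C: "C \<ge> 1"
    and Cb: "\<And>a (p :: real^'n) Q h. \<bar>a\<bar> \<le> R \<Longrightarrow> norm p \<le> R \<Longrightarrow> \<bar>h \<bullet> (Q *v h)\<bar> \<le> R * (h \<bullet> h) \<Longrightarrow>
      \<bar>h \<bullet> (log_conf_hess a p Q *v h)\<bar> \<le> C * (h \<bullet> h)"
    and Cd: "\<And>a1 a2 e (p1 :: real^'n) p2 Q1 Q2 t \<xi> h. \<bar>a1\<bar> \<le> R \<Longrightarrow> \<bar>a2\<bar> \<le> R \<Longrightarrow> norm p1 \<le> R \<Longrightarrow> norm p2 \<le> R \<Longrightarrow>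
      (\<And>h. \<bar>h \<bullet> (Q1 *v h)\<bar> \<le> R * (h \<bullet> h)) \<Longrightarrow>
      (\<And>h. \<bar>h \<bullet> (Q2 *v h) - h \<bullet> (Q1 *v h) - t * (\<xi> \<bullet> h)\<^sup>2\<bar> \<le> e * (h \<bullet> h)) \<Longrightarrow>
      norm (p1 - p2) \<le> e \<Longrightarrow> \<bar>a1 - a2\<bar> \<le> e \<Longrightarrow>
      \<bar>h \<bullet> (log_conf_hess a1 p1 Q1 *v h) - h \<bullet> (log_conf_hess a2 p2 Q2 *v h)
        - exp (- 2 * c * a2) * c * t * (\<xi> \<bullet> h)\<^sup>2\<bar> \<le> C * e * (h \<bullet> h)"
  \<comment> \<open>All possible sorted spectra of super-solution jets: closed by continuity of f on
    the closure, inside \<Gamma> by (S5), and bounded because every eigenvalue is at most C in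
    absolute value.\<close>
  define K0 where "K0 = {l \<in> closure \<Gamma>. 1 \<le> f l} \<inter> cball 0 (N * C)"
  have "closed {l \<in> closure \<Gamma>. 1 \<le> f l}"
  proof -
    have "{l \<in> closure \<Gamma>. 1 \<le> f l} = closure \<Gamma> \<inter> f -` {1..}" by auto
    then show ?thesis using continuous_closed_preimage[OF f closed_closure, of "{1..}"] by simp
  qed
  then have K0: "compact K0" unfolding K0_def by (intro closed_Int_compact) auto
  have K0G: "K0 \<subseteq> \<Gamma>" using S(5) unfolding K0_def S5_def by auto
  obtain \<rho> where \<rho>: "\<rho> > 0" "(\<Union>x\<in>K0. cball x \<rho>) \<subseteq> \<Gamma>"
    using compact_subset_open_imp_cball_epsilon_subset[OF K0 G K0G] by blast
  \<comment> \<open>\<open>K0\<close> enlarged by \<rho>, so that the perturbed spectra lie in a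
    compact set on which (S3) and (S4) give uniform constants.\<close>
  define K where "K = {x + y |x y. x \<in> K0 \<and> y \<in> cball 0 \<rho>}"
  have K: "compact K" unfolding K_def by (rule compact_sums[OF K0 compact_cball])
  have KG: "K \<subseteq> \<Gamma>" using \<rho>(2) by (force simp: K_def dist_norm)
  have inK: "l + m \<in> K" if "l \<in> K0" "norm m \<le> \<rho>" for l m using that by (auto simp: K_def)
  have "\<exists>\<delta>>0. \<forall>l\<in>K. \<forall>m\<in>closure Gamma_pos. f (l + m) - f l \<ge> \<delta> * norm m"
    using S(3) K KG unfolding S3_def by simp
  then obtain \<delta> where \<delta>: "\<delta> > 0" "\<forall>l\<in>K. \<forall>m\<in>closure Gamma_pos. f (l + m) - f l \<ge> \<delta> * norm m"
    by (elim exE conjE)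
  have "\<exists>C>0. \<forall>l\<in>K. \<forall>l'\<in>K. \<bar>f l' - f l\<bar> \<le> C * norm (l' - l)"
    using S(4) K KG unfolding S4_def by simp
  then obtain Cf where Cf: "Cf > 0" "\<forall>l\<in>K. \<forall>l'\<in>K. \<bar>f l' - f l\<bar> \<le> Cf * norm (l' - l)"
    by (elim exE conjE)
  define x0 where "x0 = exp (- 2 * c * R)"
  define x1 where "x1 = exp (2 * c * R)"
  have x: "x0 > 0" "x1 > 0" by (auto simp: x0_def x1_def)
  \<comment> \<open>Lower bound \<delta> x0 c / N for the gain per unit of t (\<xi> \<bullet>
    \<xi>), divided by the bound Cf N C for the loss per unit of e; \<theta> makes the total
    displacement of the spectrum at most \<rho>.\<close>
  define \<kappa> where "\<kappa> = \<delta> * x0 * c / N / (Cf * N * C)"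
  define \<theta> where "\<theta> = \<rho> / (x1 * c + N * C)"
  have den: "x1 * c + N * C > 0" "Cf * N * C > 0" using x c N C Cf by (simp_all add: add_pos_pos)
  have \<kappa>: "\<kappa> > 0" unfolding \<kappa>_def using \<delta>(1) x c N den by simp
  have \<theta>: "\<theta> > 0" unfolding \<theta>_def using \<rho>(1) den by simp
  have False
    if a: "\<bar>a1\<bar> \<le> R" "\<bar>a2\<bar> \<le> R" and p: "norm p1 \<le> R" "norm p2 \<le> R"
      and Q: "transpose Q1 = Q1" "transpose Q2 = Q2"
        "\<forall>h. \<bar>h \<bullet> (Q1 *v h)\<bar> \<le> R * (h \<bullet> h)" "\<forall>h. \<bar>h \<bullet> (Q2 *v h)\<bar> \<le> R * (h \<bullet> h)"
      and d: "\<forall>h. \<bar>h \<bullet> (Q2 *v h) - h \<bullet> (Q1 *v h) - t * (\<xi> \<bullet> h)\<^sup>2\<bar> \<le> e * (h \<bullet> h)"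
        "norm (p1 - p2) \<le> e" "\<bar>a1 - a2\<bar> \<le> e"
      and t: "0 \<le> t" "t * (\<xi> \<bullet> \<xi>) + e \<le> \<theta>" "e < \<kappa> * t * (\<xi> \<bullet> \<xi>)"
      and sub: "eigvals (log_conf_hess a1 p1 Q1) \<notin> closure \<Gamma> \<or> f (eigvals (log_conf_hess a1 p1 Q1)) \<le> 1"
      and super: "eigvals (log_conf_hess a2 p2 Q2) \<in> closure \<Gamma>" "f (eigvals (log_conf_hess a2 p2 Q2)) \<ge> 1"
    for a1 a2 e and p1 p2 :: "real^'n" and Q1 Q2 t \<xi>
  proof -
    let ?A1 = "log_conf_hess a1 p1 Q1" and ?A2 = "log_conf_hess a2 p2 Q2"
    define T where "T = exp (- 2 * c * a2) * c * t"
    have T0: "T \<ge> 0" using c t by (simp add: T_def)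
    \<comment> \<open>An intermediate matrix that separates the two effects: passing from the second
      matrix to \<open>A3\<close> adds only the gain, and from \<open>A3\<close> to the first only
      the errors.\<close>
    define A3 where "A3 = ?A2 + T *\<^sub>R outer_prod \<xi> \<xi>"
    have e0: "e \<ge> 0" using d(3) by linarith
    have A2b: "\<bar>h \<bullet> (?A2 *v h)\<bar> \<le> C * (h \<bullet> h)" for h
      by (rule Cb[OF a(2) p(2)]) (use Q(4) in blast)
    have A1b: "\<bar>h \<bullet> (?A1 *v h) - h \<bullet> (?A2 *v h) - T * (\<xi> \<bullet> h)\<^sup>2\<bar> \<le> C * e * (h \<bullet> h)" for h
      unfolding T_def by (rule Cd[OF a p _ _ d(2,3)]) (use Q(3) d(1) in blast)+
    have A3q: "h \<bullet> (A3 *v h) = h \<bullet> (?A2 *v h) + T * (\<xi> \<bullet> h)\<^sup>2" for h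
      by (simp add: A3_def matrix_vector_mult_add_rdistrib scaleR_matrix_vector_assoc[symmetric] inner_add_right
          power2_eq_square inner_commute)
    obtain b1 l1 where l1: "sorted_spectrum ?A1 b1 l1" using sorted_spectrum_exists[of ?A1] Q by auto
    obtain b2 l2 where l2: "sorted_spectrum ?A2 b2 l2" using sorted_spectrum_exists[of ?A2] Q by auto
    have "transpose A3 = A3" using Q(2) by (simp add: A3_def transpose_add transpose_scaleR)
    then obtain b3 l3 where l3: "sorted_spectrum A3 b3 l3" using sorted_spectrum_exists by blast
    obtain q where q: "q permutes UNIV" "l2 = (\<chi> i. eigvals ?A2 $ q i)" by (rule eigvals_permutation[OF l2])
    have "eigvals ?A2 \<in> \<Gamma>" using super S(5) by (auto simp: S5_def)
    then have "l2 \<in> \<Gamma>" "f l2 = f (eigvals ?A2)"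
      using S(1) q unfolding S1_def by auto
    then have l2G: "l2 \<in> \<Gamma>" "f l2 \<ge> 1" using super by auto
    have "\<bar>l2 $ i\<bar> \<le> C" for i
    proof -
      have "b2 i \<bullet> b2 i = 1" "?A2 *v b2 i = l2 $ i *\<^sub>R b2 i" using l2 by (auto simp: sorted_spectrum_def)
      then show ?thesis using A2b[of "b2 i"] by simp
    qed
    then have "norm l2 \<le> N * C"
      using norm_le_l1_cart[of l2] sum_bounded_above[of UNIV "\<lambda>i. \<bar>l2 $ i\<bar>" C] by (simp add: N_def)
    then have l2K0: "l2 \<in> K0" using l2G closure_subset by (auto simp: K0_def)
    have l23: "l2 $ k \<le> l3 $ k" for k
      by (rule sorted_spectrum_mono[OF l2 l3]) (simp add: A3q T0)
    define m where "m = l3 - l2"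
    have m0: "m $ k \<ge> 0" for k using l23 by (simp add: m_def)
    \<comment> \<open>The distribution of the gain among the eigenvalues is unknown, but all
      increments are nonnegative and their sum is a trace. This bounds \<open>norm m\<close> from
      above, and from below up to the factor 1 / N.\<close>
    have tr: "(\<Sum>k\<in>UNIV. m $ k) = T * (\<xi> \<bullet> \<xi>)"
    proof -
      have "(\<Sum>k\<in>UNIV. m $ k) = trace A3 - trace ?A2"
        by (simp add: m_def sum_subtractf sorted_spectrum_trace[OF l2] sorted_spectrum_trace[OF l3])
      also have "\<dots> = trace (T *\<^sub>R outer_prod \<xi> \<xi>)" by (simp add: A3_def trace_add)
      also have "\<dots> = T * (\<xi> \<bullet> \<xi>)"
        by (simp add: trace_def outer_prod_def inner_vec_def sum_distrib_left)
      finally show ?thesis .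
    qed
    have m_up: "norm m \<le> T * (\<xi> \<bullet> \<xi>)"
      using norm_le_l1_cart[of m] m0 tr by simp
    have "(\<Sum>k\<in>UNIV. m $ k) \<le> N * norm m"
      using sum_bounded_above[of UNIV "\<lambda>k. m $ k" "norm m"] component_le_norm_cart[of m]
      by (simp add: N_def abs_le_iff)
    then have m_low: "T * (\<xi> \<bullet> \<xi>) / N \<le> norm m" using tr N by (simp add: field_simps)
    have e13: "\<bar>l1 $ k - l3 $ k\<bar> \<le> C * e" for k
      by (rule sorted_spectrum_dist[OF l1 l3]) (use A1b in \<open>simp add: A3q algebra_simps\<close>)
    have n13: "norm (l1 - l3) \<le> N * (C * e)"
      using norm_le_l1_cart[of "l1 - l3"] sum_bounded_above[of UNIV "\<lambda>i. \<bar>(l1 - l3) $ i\<bar>" "C * e"] e13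
      by (simp add: N_def)
    have xt: "\<xi> \<bullet> \<xi> \<ge> 0" "t * (\<xi> \<bullet> \<xi>) \<ge> 0" using t by auto
    have ab: "\<bar>2 * c * a2\<bar> \<le> 2 * c * R" using a(2) c by (simp add: abs_mult)
    then have x01: "x0 \<le> exp (- 2 * c * a2)" "exp (- 2 * c * a2) \<le> x1"
      unfolding x0_def x1_def by (auto simp: abs_le_iff)
    have Tup: "T * (\<xi> \<bullet> \<xi>) \<le> x1 * c * (t * (\<xi> \<bullet> \<xi>))"
      using mult_right_mono[OF x01(2), of "c * (t * (\<xi> \<bullet> \<xi>))"] c xt by (simp add: T_def mult_ac)
    have Tlow: "x0 * c * (t * (\<xi> \<bullet> \<xi>)) \<le> T * (\<xi> \<bullet> \<xi>)"
      using mult_right_mono[OF x01(1), of "c * (t * (\<xi> \<bullet> \<xi>))"] c xt by (simp add: T_def mult_ac)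
    have "x1 * c * (t * (\<xi> \<bullet> \<xi>)) + N * (C * e) \<le> (x1 * c + N * C) * (t * (\<xi> \<bullet> \<xi>) + e)"
    proof -
      have "0 \<le> N * C * (t * (\<xi> \<bullet> \<xi>))" "0 \<le> x1 * c * e" using x c N C xt e0 by auto
      then show ?thesis by (simp add: algebra_simps)
    qed
    also have "\<dots> \<le> (x1 * c + N * C) * \<theta>" using t(2) den by (intro mult_left_mono) auto
    also have "\<dots> = \<rho>" using den by (simp add: \<theta>_def)
    finally have small: "x1 * c * (t * (\<xi> \<bullet> \<xi>)) + N * (C * e) \<le> \<rho>" .
    have nCe: "N * (C * e) \<ge> 0" using N C e0 by simp
    have "norm m \<le> \<rho>" using m_up Tup small nCe by linarith
    then have l3K: "l3 \<in> K" using inK[OF l2K0, of m] by (simp add: m_def)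
    have "norm (l1 - l2) \<le> norm (l1 - l3) + norm m"
      using norm_triangle_ineq[of "l1 - l3" m] by (simp add: m_def)
    then have "norm (l1 - l2) \<le> \<rho>" using m_up Tup small n13 by linarith
    then have l1K: "l1 \<in> K" using inK[OF l2K0, of "l1 - l2"] by simp
    have l2K: "l2 \<in> K" using inK[OF l2K0, of 0] \<rho>(1) by simp
    have "m \<in> closure Gamma_pos"
    proof -
      have "(\<lambda>k. m + (\<chi> i. inverse (real (Suc k)))) \<longlonglongrightarrow> m"
      proof (rule vec_tendstoI)
        show "(\<lambda>k. (m + (\<chi> i. inverse (real (Suc k)))) $ i) \<longlonglongrightarrow> m $ i" for i
          using tendsto_add[OF tendsto_const LIMSEQ_inverse_real_of_nat, of "m $ i"] by simp
      qed
      moreover have "m + (\<chi> i. inverse (real (Suc k))) \<in> Gamma_pos" for k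
        using m0 by (simp add: Gamma_pos_def add_nonneg_pos)
      ultimately show ?thesis
        unfolding closure_sequential by (intro exI[of _ "\<lambda>k. m + (\<chi> i. inverse (real (Suc k)))"] conjI allI)
    qed
    from \<delta>(2)[rule_format, OF l2K this] have "f l3 \<ge> f l2 + \<delta> * norm m" by (simp add: m_def)
    moreover have "\<delta> * norm m \<ge> \<delta> * (x0 * c * (t * (\<xi> \<bullet> \<xi>)) / N)"
    proof (rule mult_left_mono)
      have "x0 * c * (t * (\<xi> \<bullet> \<xi>)) / N \<le> T * (\<xi> \<bullet> \<xi>) / N" using Tlow N by (intro divide_right_mono) auto
      then show "x0 * c * (t * (\<xi> \<bullet> \<xi>)) / N \<le> norm m" using m_low by linarith
    qed (use \<delta>(1) in simp)
    moreover have "\<bar>f l1 - f l3\<bar> \<le> Cf * (N * (C * e))"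
    proof -
      have "\<bar>f l1 - f l3\<bar> \<le> Cf * norm (l1 - l3)" by (rule Cf(2)[rule_format, OF l3K l1K])
      also have "\<dots> \<le> Cf * (N * (C * e))" using n13 Cf(1) by (intro mult_left_mono) auto
      finally show ?thesis .
    qed
    moreover have "Cf * (N * (C * e)) < \<delta> * (x0 * c * (t * (\<xi> \<bullet> \<xi>)) / N)"
    proof -
      have "(Cf * N * C) * e < (Cf * N * C) * (\<kappa> * t * (\<xi> \<bullet> \<xi>))"
        using t(3) den(2) by (rule mult_strict_left_mono)
      also have "\<dots> = ((Cf * N * C) * \<kappa>) * (t * (\<xi> \<bullet> \<xi>))" by (simp only: mult.assoc)
      also have "(Cf * N * C) * \<kappa> = \<delta> * x0 * c / N" unfolding \<kappa>_def using den(2) by (metis less_irrefl nonzero_mult_div_cancel_left times_divide_eq_right)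
      finally show ?thesis by (simp add: mult_ac)
    qed
    ultimately have "f l1 > 1" using l2G(2) by (simp only: abs_le_iff) linarith
    obtain p' where p': "p' permutes UNIV" "eigvals ?A1 = (\<chi> i. l1 $ p' i)" by (rule eigvals_permutation[OF l1])
    have "l1 \<in> \<Gamma>" using l1K KG by blast
    then have "eigvals ?A1 \<in> \<Gamma>" "f (eigvals ?A1) = f l1"
      using S(1) p' unfolding S1_def by auto
    with sub \<open>f l1 > 1\<close> closure_subset show False by auto
  qed
  note key = this
  show ?thesis
    unfolding jets_exclusive_def
    by (rule exI[of _ \<kappa>], rule conjI[OF \<kappa>], rule exI[of _ \<theta>], rule conjI[OF \<theta>],
        intro allI impI, elim conjE, rule key) assumption+
  qed
qed

section \<open>The Hopf barrier\<close>

definition gauss_bump :: "real \<Rightarrow> 'a::euclidean_space \<Rightarrow> 'a \<Rightarrow> real" where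
  "gauss_bump \<alpha> z x = exp (- \<alpha> * ((x - z) \<bullet> (x - z)))"

definition gauss_bump_hess :: "real \<Rightarrow> 'a::euclidean_space \<Rightarrow> 'a \<Rightarrow> 'a \<Rightarrow> 'a" where
  "gauss_bump_hess \<alpha> z x k = gauss_bump \<alpha> z x *\<^sub>R ((4 * \<alpha>\<^sup>2 * ((x - z) \<bullet> k)) *\<^sub>R (x - z) - (2 * \<alpha>) *\<^sub>R k)"

lemma gauss_bump_has_derivative:
  "(gauss_bump \<alpha> z has_derivative (\<lambda>k. ((- 2 * \<alpha> * gauss_bump \<alpha> z x) *\<^sub>R (x - z)) \<bullet> k)) (at x)"
  unfolding gauss_bump_def by (auto intro!: derivative_eq_intros simp: inner_commute algebra_simps)

lemma gauss_bump_grad_has_derivative: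
  "((\<lambda>x. (- 2 * \<alpha> * gauss_bump \<alpha> z x) *\<^sub>R (x - z)) has_derivative gauss_bump_hess \<alpha> z x) (at x)"
  unfolding gauss_bump_hess_def
  by (auto intro!: derivative_eq_intros gauss_bump_has_derivative simp: power2_eq_square algebra_simps)

lemma gauss_bump_le_1: "\<alpha> \<ge> 0 \<Longrightarrow> gauss_bump \<alpha> z x \<le> 1"
  by (simp add: gauss_bump_def)

lemma gauss_bump_pos: "gauss_bump \<alpha> z x > 0"
  by (simp add: gauss_bump_def)

lemma gauss_bump_grad_lipschitz:
  assumes \<alpha>: "\<alpha> \<ge> 0" and D: "\<And>x. x \<in> S \<Longrightarrow> norm (x - z) \<le> D" "D \<ge> 0" and S: "convex S"
  shows "(4 * \<alpha>\<^sup>2 * D\<^sup>2 + 2 * \<alpha>)-lipschitz_on S (\<lambda>x. (- 2 * \<alpha> * gauss_bump \<alpha> z x) *\<^sub>R (x - z))"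
proof (rule lipschitz_onI)
  let ?G = "\<lambda>x. (- 2 * \<alpha> * gauss_bump \<alpha> z x) *\<^sub>R (x - z)"
  fix x y assume xy: "x \<in> S" "y \<in> S"
  have "norm (?G x - ?G y) \<le> (4 * \<alpha>\<^sup>2 * D\<^sup>2 + 2 * \<alpha>) * norm (x - y)"
  proof (rule differentiable_bound[OF S, of _ "gauss_bump_hess \<alpha> z"])
    fix w assume w: "w \<in> S"
    show "(?G has_derivative gauss_bump_hess \<alpha> z w) (at w within S)"
      by (rule has_derivative_at_withinI[OF gauss_bump_grad_has_derivative])
    show "onorm (gauss_bump_hess \<alpha> z w) \<le> 4 * \<alpha>\<^sup>2 * D\<^sup>2 + 2 * \<alpha>"
    proof (rule onorm_le)
      fix k
      have "norm ((4 * \<alpha>\<^sup>2 * ((w - z) \<bullet> k)) *\<^sub>R (w - z)) = 4 * \<alpha>\<^sup>2 * (\<bar>(w - z) \<bullet> k\<bar> * norm (w - z))"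
        by (simp add: abs_mult)
      also have "\<dots> \<le> 4 * \<alpha>\<^sup>2 * ((D * norm k) * D)"
      proof (intro mult_left_mono mult_mono)
        show "\<bar>(w - z) \<bullet> k\<bar> \<le> D * norm k"
          using Cauchy_Schwarz_ineq2[of "w - z" k] D(1)[OF w] by (meson mult_right_mono norm_ge_zero order_trans)
      qed (use D w in auto)
      finally have 1: "norm ((4 * \<alpha>\<^sup>2 * ((w - z) \<bullet> k)) *\<^sub>R (w - z)) \<le> 4 * \<alpha>\<^sup>2 * D\<^sup>2 * norm k"
        by (simp add: power2_eq_square mult_ac)
      have 2: "norm ((2 * \<alpha>) *\<^sub>R k) = 2 * \<alpha> * norm k" using \<alpha> by simp
      have "norm (gauss_bump_hess \<alpha> z w k) =
          gauss_bump \<alpha> z w * norm ((4 * \<alpha>\<^sup>2 * ((w - z) \<bullet> k)) *\<^sub>R (w - z) - (2 * \<alpha>) *\<^sub>R k)"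
        using gauss_bump_pos[of \<alpha> z w] by (simp add: gauss_bump_hess_def)
      also have "\<dots> \<le> 1 * norm ((4 * \<alpha>\<^sup>2 * ((w - z) \<bullet> k)) *\<^sub>R (w - z) - (2 * \<alpha>) *\<^sub>R k)"
        by (intro mult_right_mono gauss_bump_le_1 \<alpha>) auto
      also have "\<dots> \<le> 4 * \<alpha>\<^sup>2 * D\<^sup>2 * norm k + 2 * \<alpha> * norm k"
        using norm_triangle_ineq4[of "(4 * \<alpha>\<^sup>2 * ((w - z) \<bullet> k)) *\<^sub>R (w - z)" "(2 * \<alpha>) *\<^sub>R k"] 1 2 by linarith
      finally show "norm (gauss_bump_hess \<alpha> z w k) \<le> (4 * \<alpha>\<^sup>2 * D\<^sup>2 + 2 * \<alpha>) * norm k"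
        by (simp add: distrib_right)
    qed
  qed (use xy in auto)
  then show "dist (?G x) (?G y) \<le> (4 * \<alpha>\<^sup>2 * D\<^sup>2 + 2 * \<alpha>) * dist x y" by (simp add: dist_norm)
qed (use \<alpha> in auto)

text \<open>With E = \<epsilon> times the bump at x, the gain is of order \<alpha>^2 E and all
  differences of values, gradients and Hessians beyond it are of order \<alpha> E. Every error must
  be measured in this unit, since E itself may be very small.\<close>

lemma hopf_jets:
  fixes v w :: "real^'n \<Rightarrow> real"
  assumes r: "r > 0" and v: "usc_on (cball a r) v"
    and w': "\<forall>x\<in>cball a r. (w has_derivative (\<lambda>h. g x \<bullet> h)) (at x)"
    and g: "L-lipschitz_on (cball a r) g"
    and vw': "\<forall>x\<in>cball a r. v x \<le> w x" "v a = w a"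
    and \<rho>: "dist z0 a = \<rho>" "r \<le> \<rho> / 2"
    and strict: "\<forall>x\<in>cball a r. dist z0 x \<le> \<rho> \<and> x \<noteq> a \<longrightarrow> v x < w x"
    and \<kappa>: "\<kappa> > 0" and \<theta>: "\<theta> > 0"
  shows "\<exists>x y t e \<xi> pv Qw Qv. x \<in> ball a r \<and> y \<in> ball a r \<and> transpose Qw = Qw \<and> transpose Qv = Qv \<and>
    (\<forall>\<^sub>F z in nhds x. quad_poly (w x) (g x) Qw x z \<le> w z) \<and>
    (\<forall>\<^sub>F z in nhds y. v z \<le> quad_poly (v y) pv Qv y z) \<and>
    (\<forall>h. \<bar>h \<bullet> (Qw *v h) - h \<bullet> (Qv *v h) - t * (\<xi> \<bullet> h)\<^sup>2\<bar> \<le> e * (h \<bullet> h)) \<and>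
    (\<forall>h. \<bar>h \<bullet> (Qw *v h)\<bar> \<le> (L + 1) * (h \<bullet> h)) \<and>
    norm (g x - pv) \<le> e \<and> \<bar>w x - v y\<bar> \<le> e \<and> 0 \<le> t \<and> t * (\<xi> \<bullet> \<xi>) + e \<le> \<theta> \<and> e < \<kappa> * t * (\<xi> \<bullet> \<xi>)"
proof -
  note w = w'[rule_format] and vw = vw'[rule_format]
  have \<rho>0: "\<rho> > 0" using r \<rho> by simp
  have L0: "L \<ge> 0" by (rule lipschitz_on_nonneg[OF g])
  have up: "norm (x - z0) \<le> 2 * \<rho>" and low: "\<rho> / 2 \<le> norm (x - z0)" if "x \<in> cball a r" for x
  proof -
    have "dist z0 x \<le> dist z0 a + dist a x" "dist z0 a \<le> dist z0 x + dist a x"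
      using dist_triangle[of z0 x a] dist_triangle[of z0 a x] by (simp_all add: dist_commute)
    moreover have "dist a x \<le> \<rho> / 2" using that \<rho> by simp
    ultimately show "norm (x - z0) \<le> 2 * \<rho>" "\<rho> / 2 \<le> norm (x - z0)"
      using \<rho>(1) \<rho>0 by (simp_all add: dist_norm norm_minus_commute)
  qed
  \<comment> \<open>Covers all errors in units of \<alpha> E: 3 for the Hessians, 4 \<rho> + 1 for
    the gradients, 2 for the values.\<close>
  define c1 where "c1 = 4 + 4 * \<rho>"
  have c1: "c1 > 0" using \<rho>0 by (simp add: c1_def)
  \<comment> \<open>The error will be c1 \<alpha> E and the gain at least \<rho>^2 \<alpha>^2 E,
    since |\<xi>| is at least \<rho> / 2. Beating the error after multiplication by \<kappa>
    requires c1 < \<kappa> \<rho>^2 \<alpha>.\<close>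
  define \<alpha> where "\<alpha> = max 1 (c1 / (\<kappa> * \<rho>\<^sup>2) + 1)"
  have \<alpha>: "\<alpha> \<ge> 1" "c1 < \<kappa> * \<rho>\<^sup>2 * \<alpha>"
  proof -
    show "\<alpha> \<ge> 1" by (simp add: \<alpha>_def)
    have "c1 / (\<kappa> * \<rho>\<^sup>2) < \<alpha>" unfolding \<alpha>_def by linarith
    then show "c1 < \<kappa> * \<rho>\<^sup>2 * \<alpha>" using \<kappa> \<rho>0 by (simp add: field_simps)
  qed
  let ?b = "gauss_bump \<alpha> z0"
  define h where "h x = ?b x - exp (- \<alpha> * \<rho>\<^sup>2)" for x
  have bx: "?b x = exp (- \<alpha> * (dist z0 x)\<^sup>2)" for x
    by (simp add: gauss_bump_def dist_norm norm_minus_commute power2_norm_eq_inner)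
  have ha: "h a = 0" by (simp add: h_def bx \<rho>)
  have h_up: "h x \<le> ?b x" "h x \<le> 1" for x
    using gauss_bump_le_1[of \<alpha> z0 x] \<alpha>(1) exp_gt_zero[of "- \<alpha> * \<rho>\<^sup>2"] unfolding h_def by linarith+
  have h_neg: "h x < 0" if "dist z0 x > \<rho>" for x
  proof -
    have "\<rho>\<^sup>2 < (dist z0 x)\<^sup>2" using that \<rho>0 by (intro power_strict_mono) auto
    then show ?thesis using \<alpha>(1) by (simp add: h_def bx)
  qed
  define Gh where "Gh x = (- 2 * \<alpha> * ?b x) *\<^sub>R (x - z0)" for x
  have hd: "(h has_derivative (\<lambda>k. Gh x \<bullet> k)) (at x)" for x
    unfolding h_def Gh_def by (auto intro!: derivative_eq_intros gauss_bump_has_derivative)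
  have Ghd: "(Gh has_derivative gauss_bump_hess \<alpha> z0 x) (at x)" for x
    unfolding Gh_def by (rule gauss_bump_grad_has_derivative)
  have sub: "sphere a r \<subseteq> cball a r" by auto
  have wcont: "continuous_on (cball a r) w"
    using w by (meson continuous_at_imp_continuous_on has_derivative_continuous)
  have usc: "usc_on (cball a r) (\<lambda>x. v x - w x)"
    using usc_on_add_continuous[OF v continuous_on_minus[OF wcont]] by simp
  \<comment> \<open>Where the barrier may be positive, the strict inequality leaves a uniform gap m,
    by semicontinuity and compactness. On the rest of the sphere the barrier is negative.\<close>
  obtain m where m: "m > 0" "\<And>x. x \<in> sphere a r \<Longrightarrow> dist z0 x \<le> \<rho> \<Longrightarrow> v x - w x \<le> - m"
  proof (cases "sphere a r \<inter> cball z0 \<rho> = {}")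
    case True
    then show ?thesis by (intro that[of 1]) auto
  next
    case False
    have "compact (sphere a r \<inter> cball z0 \<rho>)" by (intro compact_Int) auto
    moreover have "usc_on (sphere a r \<inter> cball z0 \<rho>) (\<lambda>x. v x - w x)"
      by (rule usc_on_subset[OF usc]) (use sub in blast)
    ultimately have "\<exists>x\<in>sphere a r \<inter> cball z0 \<rho>. \<forall>y\<in>sphere a r \<inter> cball z0 \<rho>. v y - w y \<le> v x - w x"
      using False by (intro usc_on_attains_max)
    then obtain x where
      x: "x \<in> sphere a r" "dist z0 x \<le> \<rho>" "\<And>y. y \<in> sphere a r \<Longrightarrow> dist z0 y \<le> \<rho> \<Longrightarrow> v y - w y \<le> v x - w x"
      by auto
    have "x \<noteq> a" using x(1) r by auto
    then have "v x < w x" using strict x sub by blast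
    then show ?thesis using x(3) by (intro that[of "w x - v x"]) auto
  qed
  \<comment> \<open>The first entry stays below the gap m, since h is at most 1; the second bounds t
    |\<xi>|^2 + e by \<theta>, using |\<xi>| at most 2 \<rho> and E at most \<epsilon>.\<close>
  define \<epsilon> where "\<epsilon> = min (m / 2) (\<theta> / (16 * \<alpha>\<^sup>2 * \<rho>\<^sup>2 + c1 * \<alpha>))"
  have den: "16 * \<alpha>\<^sup>2 * \<rho>\<^sup>2 + c1 * \<alpha> > 0" using \<alpha>(1) c1 by (intro add_nonneg_pos) auto
  have \<epsilon>: "\<epsilon> > 0" "\<epsilon> < m" "\<epsilon> * (16 * \<alpha>\<^sup>2 * \<rho>\<^sup>2 + c1 * \<alpha>) \<le> \<theta>"
  proof -
    show "\<epsilon> > 0" using m(1) \<theta> den by (simp add: \<epsilon>_def)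
    have "\<epsilon> \<le> m / 2" unfolding \<epsilon>_def by linarith
    then show "\<epsilon> < m" using m(1) by linarith
    have "\<epsilon> \<le> \<theta> / (16 * \<alpha>\<^sup>2 * \<rho>\<^sup>2 + c1 * \<alpha>)" unfolding \<epsilon>_def by linarith
    then show "\<epsilon> * (16 * \<alpha>\<^sup>2 * \<rho>\<^sup>2 + c1 * \<alpha>) \<le> \<theta>" using den by (simp add: pos_le_divide_eq)
  qed
  define \<psi> where "\<psi> x = w x - \<epsilon> * h x" for x
  define gp where "gp x = g x - \<epsilon> *\<^sub>R Gh x" for x
  have \<psi>d: "(\<psi> has_derivative (\<lambda>k. gp x \<bullet> k)) (at x)" if "x \<in> cball a r" for x
    unfolding \<psi>_def gp_def
    by (auto intro!: derivative_eq_intros w[OF that] hd simp: inner_diff_left)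
  obtain L' where L': "L'-lipschitz_on (cball a r) gp"
  proof -
    have "(4 * \<alpha>\<^sup>2 * (2 * \<rho>)\<^sup>2 + 2 * \<alpha>)-lipschitz_on (cball a r) Gh"
      unfolding Gh_def using up \<alpha>(1) \<rho>0 by (intro gauss_bump_grad_lipschitz) auto
    from lipschitz_on_diff[OF g lipschitz_on_cmult[OF this, of \<epsilon>]] show ?thesis
      using that unfolding gp_def by blast
  qed
  define B where "B = norm (g a) + L * r"
  have B0: "B \<ge> 0" using L0 r by (simp add: B_def)
  have wB: "B-lipschitz_on (cball a r) w"
    unfolding B_def using r by (intro lipschitz_gradient_imp_lipschitz[OF w g]) auto
  \<comment> \<open>A lower bound for E on the whole ball: \<eta> has to be small compared with
    \<alpha> E before the contact point x is known.\<close>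
  define Em where "Em = \<epsilon> * exp (- \<alpha> * (2 * \<rho>)\<^sup>2)"
  have Em: "Em > 0" using \<epsilon> by (simp add: Em_def)
  define \<eta> where "\<eta> = min (1 / 2) (\<alpha> * Em / (B + 4))"
  have \<eta>: "\<eta> > 0" "\<eta> \<le> 1 / 2" "\<eta> * (B + 4) \<le> \<alpha> * Em"
  proof -
    show "\<eta> > 0" using \<alpha>(1) Em B0 by (simp add: \<eta>_def)
    show "\<eta> \<le> 1 / 2" unfolding \<eta>_def by linarith
    have "\<eta> \<le> \<alpha> * Em / (B + 4)" unfolding \<eta>_def by linarith
    then show "\<eta> * (B + 4) \<le> \<alpha> * Em" using B0 by (simp add: pos_le_divide_eq)
  qed
  have sph: "v x - \<psi> x < v a - \<psi> a" if "x \<in> sphere a r" for x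
  proof (cases "dist z0 x \<le> \<rho>")
    case True
    have "\<epsilon> * h x \<le> \<epsilon> * 1" using h_up \<epsilon>(1) by (intro mult_left_mono) auto
    then show ?thesis using m(2)[OF that True] \<epsilon>(2) vw(2) ha by (simp add: \<psi>_def)
  next
    case False
    then have "\<epsilon> * h x < 0" using h_neg[of x] \<epsilon>(1) by (simp add: mult_pos_neg)
    then show ?thesis using vw(1)[of x] that sub vw(2) ha by (auto simp: \<psi>_def)
  qed
  obtain x y p Y where x: "x \<in> ball a r" and y: "y \<in> ball a r" and xy: "norm (x - y) \<le> \<eta>" and p: "norm p \<le> \<eta>"
    and Y: "(gp has_derivative Y) (at x)" and val: "v a - \<psi> a - \<eta> \<le> v y - \<psi> x"
    and tch: "\<forall>\<^sub>F z in nhds y. v z \<le> v y + \<psi> (x + z - y) - \<psi> x + p \<bullet> (z - y)"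
    using contact_point_with_hessian[OF r v \<psi>d L' sph \<eta>(1)] by blast
  have xc: "x \<in> cball a r" and yc: "y \<in> cball a r" using x y by auto
  define E where "E = \<epsilon> * ?b x"
  define \<xi> where "\<xi> = x - z0"
  have E0: "E > 0" using \<epsilon>(1) gauss_bump_pos[of \<alpha> z0 x] by (simp add: E_def)
  have "Em \<le> E"
  proof -
    have "(dist z0 x)\<^sup>2 \<le> (2 * \<rho>)\<^sup>2"
      using up[OF xc] by (intro power_mono) (auto simp: dist_norm norm_minus_commute)
    then have "\<alpha> * (dist z0 x)\<^sup>2 \<le> \<alpha> * (2 * \<rho>)\<^sup>2" using \<alpha>(1) by (intro mult_left_mono) auto
    then show ?thesis unfolding Em_def E_def bx using \<epsilon>(1) by (intro mult_left_mono) auto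
  qed
  then have \<eta>E: "\<eta> * (B + 4) \<le> \<alpha> * E" using \<eta>(3) \<alpha>(1) by (meson mult_left_mono order_trans zero_le_one)
  have "\<eta> * B \<ge> 0" using \<eta>(1) B0 by simp
  then have \<eta>4: "4 * \<eta> \<le> \<alpha> * E" and \<eta>B: "B * \<eta> \<le> \<alpha> * E"
    using \<eta>E \<eta>(1) by (simp_all add: distrib_left mult.commute)
  define Yw where "Yw k = Y k + \<epsilon> *\<^sub>R gauss_bump_hess \<alpha> z0 x k" for k
  have Yw: "(g has_derivative Yw) (at x)"
  proof -
    have "((\<lambda>x. gp x + \<epsilon> *\<^sub>R Gh x) has_derivative Yw) (at x)"
      unfolding Yw_def by (intro has_derivative_add Y has_derivative_scaleR_right Ghd)
    then show ?thesis by (simp add: gp_def)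
  qed
  have linY: "linear Y" "linear Yw" using Y Yw has_derivative_linear by auto
  \<comment> \<open>The shift by 2 \<eta>, halved in \<open>quad_poly\<close>, absorbs the Peano
    remainder: downwards for the test function below w, upwards for the one above v.\<close>
  define Qw where "Qw = sym_matrix Yw - (2 * \<eta>) *\<^sub>R mat 1"
  define Qv where "Qv = sym_matrix Y + (2 * \<eta>) *\<^sub>R mat 1"
  have Qw: "transpose Qw = Qw" and Qv: "transpose Qv = Qv"
    by (simp_all add: Qw_def Qv_def transpose_add transpose_diff transpose_scaleR transpose_mat)
  have Qwq: "k \<bullet> (Qw *v k) = k \<bullet> Yw k - 2 * \<eta> * (k \<bullet> k)" for k
    by (simp add: Qw_def matrix_vector_mult_diff_rdistrib scaleR_matrix_vector_assoc[symmetric] inner_diff_right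
        sym_matrix_quadratic[OF linY(2)])
  have Qvq: "k \<bullet> (Qv *v k) = k \<bullet> Y k + 2 * \<eta> * (k \<bullet> k)" for k
    by (simp add: Qv_def matrix_vector_mult_add_rdistrib scaleR_matrix_vector_assoc[symmetric] inner_add_right
        sym_matrix_quadratic[OF linY(1)])
  have inball: "\<And>z. z \<in> ball a r \<Longrightarrow> z \<in> cball a r" by auto
  have jw: "\<forall>\<^sub>F z in nhds x. quad_poly (w x) (g x) Qw x z \<le> w z"
    using gradient_peano_expansion[OF open_ball x w[OF inball] Yw \<eta>(1)]
  proof (rule eventually_mono)
    fix z assume "\<bar>w z - w x - g x \<bullet> (z - x) - (z - x) \<bullet> Yw (z - x) / 2\<bar> \<le> \<eta> * (norm (z - x))\<^sup>2"
    then show "quad_poly (w x) (g x) Qw x z \<le> w z"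
      unfolding quad_poly_def Qwq by (simp add: power2_norm_eq_inner abs_le_iff field_simps)
  qed
  define pv where "pv = gp x + p"
  have jv: "\<forall>\<^sub>F z in nhds y. v z \<le> quad_poly (v y) pv Qv y z"
  proof -
    have "\<forall>\<^sub>F z in nhds x. \<bar>\<psi> z - \<psi> x - gp x \<bullet> (z - x) - (z - x) \<bullet> Y (z - x) / 2\<bar> \<le> \<eta> * (norm (z - x))\<^sup>2"
      by (rule gradient_peano_expansion[OF open_ball x \<psi>d[OF inball] Y \<eta>(1)])
    moreover have "((\<lambda>z. x + z - y) \<longlongrightarrow> x) (nhds y)"
      by (auto intro!: tendsto_eq_intros filterlim_ident)
    ultimately have "\<forall>\<^sub>F z in nhds y. \<bar>\<psi> (x + z - y) - \<psi> x - gp x \<bullet> (x + z - y - x) - (x + z - y - x) \<bullet> Y (x + z - y - x) / 2\<bar>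
        \<le> \<eta> * (norm (x + z - y - x))\<^sup>2"
      by (rule eventually_compose_filterlim)
    with tch show ?thesis
    proof eventually_elim
      case (elim z)
      then show ?case unfolding quad_poly_def Qvq pv_def
        by (simp add: power2_norm_eq_inner abs_le_iff inner_add_left field_simps)
    qed
  qed
  \<comment> \<open>Rank-one coefficient of \<epsilon> times the Hessian of the bump. Its isotropic
    part - 2 \<alpha> E and the shifts by \<eta> are counted as error.\<close>
  define t where "t = 4 * \<alpha>\<^sup>2 * E"
  define e where "e = c1 * \<alpha> * E"
  have \<alpha>E: "\<alpha> * E > 0" using \<alpha>(1) E0 by simp
  have e_ge: "s * (\<alpha> * E) \<le> e" if "s \<le> c1" for s
    using mult_right_mono[OF that, of "\<alpha> * E"] \<alpha>E by (simp add: e_def mult.assoc)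
  have diff: "\<bar>k \<bullet> (Qw *v k) - k \<bullet> (Qv *v k) - t * (\<xi> \<bullet> k)\<^sup>2\<bar> \<le> e * (k \<bullet> k)" for k
  proof -
    have "k \<bullet> (Qw *v k) - k \<bullet> (Qv *v k) - t * (\<xi> \<bullet> k)\<^sup>2 = - ((2 * (\<alpha> * E) + 4 * \<eta>) * (k \<bullet> k))"
      unfolding Qwq Qvq Yw_def gauss_bump_hess_def t_def E_def \<xi>_def
      by (simp add: inner_add_right inner_diff_right power2_eq_square inner_commute algebra_simps)
    moreover have "0 \<le> 2 * (\<alpha> * E) + 4 * \<eta>" using \<alpha>E \<eta>(1) by simp
    moreover have "2 * (\<alpha> * E) + 4 * \<eta> \<le> e"
      using \<eta>4 e_ge[of 3] \<rho>0 by (simp add: c1_def)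
    ultimately show ?thesis by (simp add: mult_right_mono)
  qed
  have Qwb: "\<bar>k \<bullet> (Qw *v k)\<bar> \<le> (L + 1) * (k \<bullet> k)" for k
  proof -
    have "\<bar>k \<bullet> Yw k\<bar> \<le> norm k * norm (Yw k)" by (rule Cauchy_Schwarz_ineq2)
    also have "\<dots> \<le> norm k * (L * norm k)"
      using x by (intro mult_left_mono lipschitz_derivative_bound[OF g _ Yw]) (auto simp: interior_cball)
    finally have "\<bar>k \<bullet> Yw k\<bar> \<le> L * (k \<bullet> k)" by (simp add: power2_norm_eq_inner[symmetric] power2_eq_square mult_ac)
    moreover have "\<bar>2 * \<eta> * (k \<bullet> k)\<bar> \<le> 1 * (k \<bullet> k)"
      using \<eta>(1,2) unfolding abs_mult by (intro mult_mono) auto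
    ultimately show ?thesis unfolding Qwq by (simp add: distrib_right)
  qed
  have dp: "norm (g x - pv) \<le> e"
  proof -
    have "norm (\<epsilon> *\<^sub>R Gh x) = 2 * (\<alpha> * E) * norm (x - z0)"
      using \<epsilon>(1) \<alpha>(1) gauss_bump_pos[of \<alpha> z0 x] by (simp add: Gh_def E_def abs_mult)
    also have "\<dots> \<le> 2 * (\<alpha> * E) * (2 * \<rho>)" using up[OF xc] \<alpha>E by (intro mult_left_mono) auto
    finally have "norm (\<epsilon> *\<^sub>R Gh x) \<le> 4 * \<rho> * (\<alpha> * E)" by (simp add: mult_ac)
    moreover have "g x - pv = \<epsilon> *\<^sub>R Gh x - p" by (simp add: pv_def gp_def)
    ultimately have "norm (g x - pv) \<le> 4 * \<rho> * (\<alpha> * E) + \<eta>"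
      using norm_triangle_ineq4[of "\<epsilon> *\<^sub>R Gh x" p] p by simp
    also have "\<dots> \<le> (4 * \<rho> + 1) * (\<alpha> * E)" using \<eta>4 \<eta>(1) by (simp add: distrib_right)
    also have "\<dots> \<le> e" by (rule e_ge) (simp add: c1_def)
    finally show ?thesis .
  qed
  have E1: "E \<le> \<alpha> * E" using \<alpha>(1) E0 by simp
  have da: "\<bar>w x - v y\<bar> \<le> e"
  proof -
    have "\<epsilon> * h x \<le> E" unfolding E_def using h_up \<epsilon>(1) by (intro mult_left_mono) auto
    then have 1: "w x - v y \<le> E + \<eta>" using val vw(2) ha by (simp add: \<psi>_def)
    \<comment> \<open>The opposite inequality uses v \<le> w at the same point y, whereas w is
      evaluated at x.\<close>
    have "\<bar>w x - w y\<bar> \<le> B * norm (x - y)" using lipschitz_onD[OF wB xc yc] by (simp add: dist_norm)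
    also have "\<dots> \<le> B * \<eta>" using xy B0 by (intro mult_left_mono) auto
    finally have "v y - w x \<le> B * \<eta>" using vw(1)[OF yc] by linarith
    then have "\<bar>w x - v y\<bar> \<le> 2 * (\<alpha> * E)" using 1 \<eta>4 \<eta>(1) \<eta>B E1 \<alpha>E by linarith
    also have "\<dots> \<le> e" by (rule e_ge) (use \<rho>0 in \<open>simp add: c1_def\<close>)
    finally show ?thesis .
  qed
  have \<xi>: "\<xi> \<bullet> \<xi> \<le> 4 * \<rho>\<^sup>2" "\<rho>\<^sup>2 / 4 \<le> \<xi> \<bullet> \<xi>"
  proof -
    have "(norm \<xi>)\<^sup>2 \<le> (2 * \<rho>)\<^sup>2" unfolding \<xi>_def using up[OF xc] by (intro power_mono) auto
    then show "\<xi> \<bullet> \<xi> \<le> 4 * \<rho>\<^sup>2" by (simp add: power2_norm_eq_inner power_mult_distrib)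
    have "(\<rho> / 2)\<^sup>2 \<le> (norm \<xi>)\<^sup>2" unfolding \<xi>_def using low[OF xc] \<rho>0 by (intro power_mono) auto
    then show "\<rho>\<^sup>2 / 4 \<le> \<xi> \<bullet> \<xi>" by (simp add: power2_norm_eq_inner power_divide)
  qed
  have t0: "t \<ge> 0" using E0 by (simp add: t_def)
  have small: "t * (\<xi> \<bullet> \<xi>) + e \<le> \<theta>"
  proof -
    have "t * (\<xi> \<bullet> \<xi>) \<le> t * (4 * \<rho>\<^sup>2)" using \<xi>(1) t0 by (rule mult_left_mono)
    then have "t * (\<xi> \<bullet> \<xi>) + e \<le> E * (16 * \<alpha>\<^sup>2 * \<rho>\<^sup>2 + c1 * \<alpha>)"
      by (simp add: t_def e_def algebra_simps)
    also have "\<dots> \<le> \<epsilon> * (16 * \<alpha>\<^sup>2 * \<rho>\<^sup>2 + c1 * \<alpha>)"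
      using gauss_bump_le_1[of \<alpha> z0 x] \<alpha>(1) \<epsilon>(1) den by (intro mult_right_mono) (auto simp: E_def)
    finally show ?thesis using \<epsilon>(3) by linarith
  qed
  have gain: "e < \<kappa> * t * (\<xi> \<bullet> \<xi>)"
  proof -
    have "e < \<kappa> * \<rho>\<^sup>2 * \<alpha> * (\<alpha> * E)"
      using mult_strict_right_mono[OF \<alpha>(2) \<alpha>E] by (simp add: e_def mult.assoc)
    also have "\<dots> = \<kappa> * t * (\<rho>\<^sup>2 / 4)" by (simp add: t_def power2_eq_square)
    also have "\<dots> \<le> \<kappa> * t * (\<xi> \<bullet> \<xi>)" using \<xi>(2) \<kappa> t0 by (intro mult_left_mono) auto
    finally show ?thesis .
  qed
  show ?thesis
    by (intro exI[of _ x] exI[of _ y] exI[of _ t] exI[of _ e] exI[of _ \<xi>] exI[of _ pv] exI[of _ Qw] exI[of _ Qv]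
        conjI allI x y Qw Qv jw jv diff Qwb dp da t0 small gain)
qed

section \<open>Touching points\<close>

lemma matrix_vector_mult_uminus [simp]: "(- A) *v x = - (A *v (x :: real^'n))"
  by (simp add: matrix_vector_mult_def vec_eq_iff sum_negf)

lemma transpose_uminus [simp]: "transpose (- A) = - transpose (A :: 'a::group_add^'n^'m)"
  by (simp add: transpose_def vec_eq_iff)

lemma quad_poly_uminus: "quad_poly (- a) (- p) (- Q) y z = - quad_poly a p Q y z"
  by (simp add: quad_poly_def)

lemma usc_lsc_open_less:
  fixes u1 :: "'a::topological_space \<Rightarrow> real" and u2 :: "'a \<Rightarrow> ereal"
  assumes W: "open W" and u1: "usc_on W u1" and u2: "lsc_on W u2"
  shows "open {x \<in> W. ereal (u1 x) < u2 x}"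
proof (subst open_subopen, safe)
  fix x assume x: "x \<in> W" "ereal (u1 x) < u2 x"
  obtain c where c: "ereal (u1 x) < ereal c" "ereal c < u2 x" using ereal_dense2[OF x(2)] by blast
  have "\<forall>\<^sub>F y in at x within W. u1 y < c" "\<forall>\<^sub>F y in at x within W. ereal c < u2 y"
    using u1 u2 x(1) c unfolding usc_on_def lsc_on_def by auto
  then have "\<forall>\<^sub>F y in at x within W. ereal (u1 y) < u2 y"
    by eventually_elim (metis less_ereal.simps(1) less_trans)
  then obtain S where S: "open S" "x \<in> S" "\<And>y. y \<in> S \<Longrightarrow> y \<noteq> x \<Longrightarrow> y \<in> W \<Longrightarrow> ereal (u1 y) < u2 y"
    unfolding eventually_at_topological by blast
  show "\<exists>T. open T \<and> x \<in> T \<and> T \<subseteq> {x \<in> W. ereal (u1 x) < u2 x}"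
    using S W x by (intro exI[of _ "S \<inter> W"]) auto
qed

text \<open>By connectedness W - U is not open, so points z of U come close to it. The largest ball
  about z inside U may touch the complement at several points; the ball of half the radius,
  internally tangent at one of them, touches only there.\<close>

lemma connected_touching_ball:
  fixes W U :: "'a::euclidean_space set"
  assumes W: "open W" "connected W" and U: "open U" "U \<subseteq> W" "U \<noteq> {}" "U \<noteq> W"
  shows "\<exists>a\<in>W - U. \<exists>z. dist z a > 0 \<and> cball z (dist z a) \<subseteq> insert a U"
proof -
  have "\<not> open (W - U)"
  proof
    assume "open (W - U)"
    then have "U \<inter> W = {} \<or> (W - U) \<inter> W = {}" using W(2) U(1) by (intro connectedD) auto
    then show False using U by blast
  qed
  then obtain x where x: "x \<in> W - U" "\<And>e. e > 0 \<Longrightarrow> \<not> ball x e \<subseteq> W - U"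
    unfolding open_contains_ball by blast
  obtain d where d: "d > 0" "ball x d \<subseteq> W" using W(1) x(1) open_contains_ball by blast
  have "\<not> ball x (d / 2) \<subseteq> W - U" using x(2) d(1) by simp
  then obtain z where "z \<in> ball x (d / 2)" "z \<notin> W - U" by blast
  then have z: "dist x z < d / 2" "z \<notin> W - U" by simp_all
  then have "z \<in> W" using d by auto
  then have zU: "z \<in> U" using z by blast
  define s where "s = dist z x"
  have sW: "cball z s \<subseteq> W"
  proof
    fix y assume "y \<in> cball z s"
    then have "dist x y < d" using z(1) dist_triangle[of x y z] by (simp add: s_def dist_commute)
    then show "y \<in> W" using d by auto
  qed
  \<comment> \<open>Searching only within distance s = \<open>dist z x\<close> of z, where
    everything lies in W, keeps the nearest point a in W.\<close>
  have "closed (cball z s - U)" "x \<in> cball z s - U"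
    using U(1) x(1) by (auto simp: s_def)
  then obtain a where a: "a \<in> cball z s - U" "\<And>y. y \<in> cball z s - U \<Longrightarrow> dist z a \<le> dist z y"
    using distance_attains_inf[of "cball z s - U" z] by blast
  have inU: "y \<in> U" if "dist z y < dist z a" for y
  proof (rule ccontr)
    assume "y \<notin> U"
    then have "y \<in> cball z s - U" using that a(1) by simp
    from a(2)[OF this] that show False by simp
  qed
  define u where "u = a - z"
  define z0 where "z0 = z + (1 / 2) *\<^sub>R u"
  have "u \<noteq> 0" using a(1) zU by (auto simp: u_def)
  have "cball z0 (norm u / 2) \<subseteq> insert a U"
  proof
    fix y assume "y \<in> cball z0 (norm u / 2)"
    then have "norm (y - z0) \<le> norm u / 2" by (simp add: dist_norm norm_minus_commute)
    then have "(norm (y - z0))\<^sup>2 \<le> (norm u / 2)\<^sup>2" by (intro power_mono) auto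
    then have 1: "(y - z0) \<bullet> (y - z0) \<le> (u \<bullet> u) / 4" by (simp add: power2_norm_eq_inner power_divide)
    define q where "q = y - z"
    have "y - z0 = q - (1 / 2) *\<^sub>R u" by (simp add: q_def z0_def)
    \<comment> \<open>Thales: with q = y - z and u = a - z, the small ball is given by q \<bullet> q
      \<le> q \<bullet> u. Then |q - u|^2 \<le> |u|^2 - |q|^2, so y is strictly nearer to z than a
      unless y = a.\<close>
    with 1 have 2: "q \<bullet> q \<le> q \<bullet> u"
      by (simp add: inner_diff_left inner_diff_right inner_commute)
    have "(q - u) \<bullet> (q - u) \<le> u \<bullet> u - q \<bullet> q"
      using 2 by (simp add: inner_diff_left inner_diff_right inner_commute)
    show "y \<in> insert a U"
    proof (cases "y = a")
      case False
      then have "(q - u) \<bullet> (q - u) > 0" by (simp add: q_def u_def)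
      then have "q \<bullet> q < u \<bullet> u" using \<open>(q - u) \<bullet> (q - u) \<le> u \<bullet> u - q \<bullet> q\<close> by linarith
      then have "norm q < norm u" by (simp add: norm_lt)
      then show ?thesis using inU[of y] by (simp add: q_def u_def dist_norm norm_minus_commute)
    qed simp
  qed
  moreover have da: "dist z0 a = norm u / 2"
  proof -
    have "z0 - a = (1 / 2) *\<^sub>R u - 1 *\<^sub>R u" by (simp add: z0_def u_def)
    also have "\<dots> = (- 1 / 2) *\<^sub>R u" by (simp only: scaleR_left_diff_distrib[symmetric]) simp
    finally have "z0 - a = (- 1 / 2) *\<^sub>R u" .
    then show ?thesis by (simp add: dist_norm)
  qed
  ultimately have "dist z0 a > 0" "cball z0 (dist z0 a) \<subseteq> insert a U"
    unfolding da using \<open>u \<noteq> 0\<close> by simp_all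
  moreover have "a \<in> W - U" using a(1) sW by blast
  ultimately show ?thesis by blast
qed

section \<open>Uniform jet bounds near a touching point\<close>

lemma C11_loc_on_cball:
  fixes F :: "real^'n \<Rightarrow> real"
  assumes F: "C11_loc W F" and W: "open W" and sub: "cball a r \<subseteq> W"
  shows "(\<exists>L. L-lipschitz_on (cball a r) (grad F)) \<and>
    (\<forall>x\<in>cball a r. (F has_derivative (\<lambda>h. grad F x \<bullet> h)) (at x))"
proof (intro conjI ballI)
  show "\<exists>L. L-lipschitz_on (cball a r) (grad F)"
    using F sub unfolding C11_loc_def by (meson compact_cball)
  show "(F has_derivative (\<lambda>h. grad F x \<bullet> h)) (at x)" if "x \<in> cball a r" for x
    using F W sub that unfolding C11_loc_def
    by (intro has_derivative_grad) (meson differentiable_on_eq_differentiable_at subsetD)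
qed

text \<open>v has no regularity of its own; the bound for its test Hessian comes from that of w and
  the smallness of the difference.\<close>

lemma hopf_hessian_bound:
  fixes Qw Qv :: "real^'n^'n"
  assumes Qw: "\<bar>h \<bullet> (Qw *v h)\<bar> \<le> (L + 1) * (h \<bullet> h)"
    and d: "\<bar>h \<bullet> (Qw *v h) - h \<bullet> (Qv *v h) - t * (\<xi> \<bullet> h)\<^sup>2\<bar> \<le> e * (h \<bullet> h)"
    and t: "0 \<le> t" "t * (\<xi> \<bullet> \<xi>) + e \<le> 1"
  shows "\<bar>h \<bullet> (Qv *v h)\<bar> \<le> (L + 2) * (h \<bullet> h)"
proof -
  have "(\<xi> \<bullet> h)\<^sup>2 \<le> (\<xi> \<bullet> \<xi>) * (h \<bullet> h)" by (rule Cauchy_Schwarz_ineq)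
  then have "t * (\<xi> \<bullet> h)\<^sup>2 \<le> t * (\<xi> \<bullet> \<xi>) * (h \<bullet> h)" using t(1) by (simp add: mult.assoc mult_left_mono)
  moreover have "(t * (\<xi> \<bullet> \<xi>) + e) * (h \<bullet> h) \<le> 1 * (h \<bullet> h)" using t(2) by (intro mult_right_mono) auto
  moreover have "0 \<le> t * (\<xi> \<bullet> h)\<^sup>2" using t(1) by simp
  ultimately show ?thesis using Qw d by (simp add: distrib_right abs_le_iff)
qed

lemma bounded_on_cball:
  fixes F :: "'a::euclidean_space \<Rightarrow> 'b::real_normed_vector"
  assumes "continuous_on (cball a r) F"
  obtains B where "B \<ge> 0" "\<And>x. x \<in> cball a r \<Longrightarrow> norm (F x) \<le> B"
proof -
  have "bounded (F ` cball a r)"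
    using assms by (intro compact_imp_bounded compact_continuous_image) auto
  then obtain B where "\<forall>x\<in>cball a r. norm (F x) \<le> B" by (auto simp: bounded_iff)
  then show thesis by (intro that[of "max 0 B"]) (auto simp: le_max_iff_disj)
qed

lemma C11_loc_uminus:
  fixes F :: "real^'n \<Rightarrow> real"
  assumes F: "C11_loc W F" and W: "open W"
  shows "C11_loc W (\<lambda>x. - F x)"
  unfolding C11_loc_def
proof (intro conjI allI impI)
  have dF: "F differentiable_on W" using F by (simp add: C11_loc_def)
  then show "(\<lambda>x. - F x) differentiable_on W" by (rule differentiable_on_minus)
  have gr: "grad (\<lambda>x. - F x) x = - grad F x" if "x \<in> W" for x
  proof (rule grad_eqI)
    have "F differentiable (at x)" using dF W that by (simp add: differentiable_on_eq_differentiable_at)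
    from has_derivative_minus[OF has_derivative_grad[OF this]]
    show "((\<lambda>x. - F x) has_derivative (\<lambda>h. - grad F x \<bullet> h)) (at x)" by simp
  qed
  fix K assume K: "compact K \<and> K \<subseteq> W"
  then obtain L where L: "L-lipschitz_on K (grad F)" using F unfolding C11_loc_def by blast
  have "L-lipschitz_on K (grad (\<lambda>x. - F x))"
  proof (rule lipschitz_onI)
    fix x y assume "x \<in> K" "y \<in> K"
    then show "dist (grad (\<lambda>x. - F x) x) (grad (\<lambda>x. - F x) y) \<le> L * dist x y"
      using lipschitz_onD[OF L, of x y] K gr by (auto simp: subset_iff dist_minus)
  qed (rule lipschitz_on_nonneg[OF L])
  then show "\<exists>L. L-lipschitz_on K (grad (\<lambda>x. - F x))" by blast
qed

text \<open>One constant \<open>R\<close> bounds both jets, because the ellipticity constants are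
  obtained from such a bound; it must therefore be available before \<kappa> and \<theta>.\<close>

definition touching_jets ::
  "real \<Rightarrow> real \<Rightarrow> real \<Rightarrow> real^'n \<Rightarrow> real \<Rightarrow> (real^'n \<Rightarrow> real) \<Rightarrow> (real^'n \<Rightarrow> real) \<Rightarrow> bool" where
  "touching_jets R \<kappa> \<theta> a r w v \<longleftrightarrow>
     (\<exists>x y t e \<xi> pw pv Qw Qv. x \<in> cball a r \<and> y \<in> cball a r \<and> transpose Qw = Qw \<and> transpose Qv = Qv \<and>
      (\<forall>\<^sub>F z in nhds x. quad_poly (w x) pw Qw x z \<le> w z) \<and>
      (\<forall>\<^sub>F z in nhds y. v z \<le> quad_poly (v y) pv Qv y z) \<and>
      \<bar>w x\<bar> \<le> R \<and> \<bar>v y\<bar> \<le> R \<and> norm pw \<le> R \<and> norm pv \<le> R \<and>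
      (\<forall>h. \<bar>h \<bullet> (Qw *v h)\<bar> \<le> R * (h \<bullet> h)) \<and> (\<forall>h. \<bar>h \<bullet> (Qv *v h)\<bar> \<le> R * (h \<bullet> h)) \<and>
      (\<forall>h. \<bar>h \<bullet> (Qw *v h) - h \<bullet> (Qv *v h) - t * (\<xi> \<bullet> h)\<^sup>2\<bar> \<le> e * (h \<bullet> h)) \<and>
      norm (pw - pv) \<le> e \<and> \<bar>w x - v y\<bar> \<le> e \<and> w a - 2 < v y \<and>
      0 \<le> t \<and> t * (\<xi> \<bullet> \<xi>) + e \<le> \<theta> \<and> e < \<kappa> * t * (\<xi> \<bullet> \<xi>))"

text \<open>In the application \<open>w\<close> is the regular one of \<open>ln u2\<close> and \<open>- ln u1\<close>, and \<open>v\<close> is the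
  corresponding logarithm of the other function, truncated from below at \<open>w a - 2\<close> so as to be
  finite. The truncation is inactive at \<open>y\<close> because \<open>w > w a - 1\<close> and \<open>e \<le> 1\<close>.\<close>

lemma hopf_jets_C11_loc:
  fixes w :: "real^'n \<Rightarrow> real"
  assumes \<Omega>: "open \<Omega>" and C11: "C11_loc \<Omega> w" and a: "a \<in> \<Omega>" and z0: "dist z0 a = \<rho>" "\<rho> > 0"
  shows "\<exists>r R. r > 0 \<and> R \<ge> 1 \<and> cball a r \<subseteq> \<Omega> \<and> (\<forall>x\<in>cball a r. w x > w a - 1) \<and>
    (\<forall>v \<kappa> \<theta>. usc_on (cball a r) v \<and> (\<forall>x\<in>cball a r. v x \<le> w x) \<and> v a = w a \<and>
       (\<forall>x\<in>cball a r. dist z0 x \<le> \<rho> \<and> x \<noteq> a \<longrightarrow> v x < w x) \<and> \<kappa> > 0 \<and> \<theta> > 0 \<longrightarrow>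
     touching_jets R \<kappa> \<theta> a r w v)"
proof -
  obtain r0 where r0: "r0 > 0" "cball a r0 \<subseteq> \<Omega>" using \<Omega> a open_contains_cball by blast
  have "(w has_derivative (\<lambda>h. grad w a \<bullet> h)) (at a)"
    using C11_loc_on_cball[OF C11 \<Omega> r0(2)] r0(1) by auto
  then have "isCont w a" by (rule has_derivative_continuous)
  then obtain r1 where r1: "r1 > 0" "\<forall>x. dist x a < r1 \<longrightarrow> dist (w x) (w a) < 1"
    unfolding continuous_at_eps_delta by (meson zero_less_one)
  define r where "r = min r0 (min (r1 / 2) (\<rho> / 2))"
  have r: "r > 0" "r \<le> \<rho> / 2" "cball a r \<subseteq> \<Omega>" "\<And>x. x \<in> cball a r \<Longrightarrow> w x > w a - 1"
  proof -
    show "r > 0" using r0 r1 z0 by (simp add: r_def)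
    show "r \<le> \<rho> / 2" unfolding r_def by linarith
    have "r \<le> r0" "r \<le> r1 / 2" unfolding r_def by linarith+
    then show "cball a r \<subseteq> \<Omega>" using r0(2) subset_cball by blast
    show "w x > w a - 1" if "x \<in> cball a r" for x
      using that \<open>r \<le> r1 / 2\<close> r1(1) r1(2)[rule_format, of x]
      by (simp add: dist_commute) (simp add: dist_real_def abs_less_iff)
  qed
  obtain L where L: "L-lipschitz_on (cball a r) (grad w)"
    using C11_loc_on_cball[OF C11 \<Omega> r(3)] by blast
  have wd: "\<forall>x\<in>cball a r. (w has_derivative (\<lambda>h. grad w x \<bullet> h)) (at x)"
    using C11_loc_on_cball[OF C11 \<Omega> r(3)] by blast
  have L0: "L \<ge> 0" by (rule lipschitz_on_nonneg[OF L])
  have wc: "continuous_on (cball a r) w"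
    using wd by (meson continuous_at_imp_continuous_on has_derivative_continuous)
  obtain B1 where B1: "B1 \<ge> 0" "\<And>x. x \<in> cball a r \<Longrightarrow> norm (w x) \<le> B1" using bounded_on_cball[OF wc] by blast
  obtain B2 where B2: "B2 \<ge> 0" "\<And>x. x \<in> cball a r \<Longrightarrow> norm (grad w x) \<le> B2"
    using bounded_on_cball[OF lipschitz_on_continuous_on[OF L]] by blast
  \<comment> \<open>Depends on w and the ball only. The summand 3 covers L + 2 for the Hessians and
    the distance at most e \<le> 1 of the v-jet from the w-jet in value and slope.\<close>
  define R where "R = 3 + L + B1 + B2"
  have R: "R \<ge> 1" using L0 B1(1) B2(1) by (simp add: R_def)
  show ?thesis
  proof (rule exI[of _ r], rule exI[of _ R], intro conjI allI impI ballI r(1) R r(3) r(4), assumption)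
    fix v :: "real^'n \<Rightarrow> real" and \<kappa> \<theta> :: real
    assume H: "usc_on (cball a r) v \<and> (\<forall>x\<in>cball a r. v x \<le> w x) \<and> v a = w a \<and>
       (\<forall>x\<in>cball a r. dist z0 x \<le> \<rho> \<and> x \<noteq> a \<longrightarrow> v x < w x) \<and> \<kappa> > 0 \<and> \<theta> > 0"
    then have "usc_on (cball a r) v" "\<forall>x\<in>cball a r. v x \<le> w x" "v a = w a"
      "\<forall>x\<in>cball a r. dist z0 x \<le> \<rho> \<and> x \<noteq> a \<longrightarrow> v x < w x" "\<kappa> > 0" "min \<theta> 1 > 0" by auto
    \<comment> \<open>The smallness parameter is min \<theta> 1 instead of \<theta>, which gives e
      \<le> 1.\<close>
    from hopf_jets[OF r(1) this(1) wd L this(2,3) z0(1) r(2) this(4-6)] obtain x y t e \<xi> pv Qw Qv where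
      xy: "x \<in> ball a r" "y \<in> ball a r" and Q: "transpose Qw = Qw" "transpose Qv = Qv"
      and jw: "\<forall>\<^sub>F z in nhds x. quad_poly (w x) (grad w x) Qw x z \<le> w z"
      and jv: "\<forall>\<^sub>F z in nhds y. v z \<le> quad_poly (v y) pv Qv y z"
      and d: "\<forall>h. \<bar>h \<bullet> (Qw *v h) - h \<bullet> (Qv *v h) - t * (\<xi> \<bullet> h)\<^sup>2\<bar> \<le> e * (h \<bullet> h)"
      and Qw: "\<forall>h. \<bar>h \<bullet> (Qw *v h)\<bar> \<le> (L + 1) * (h \<bullet> h)"
      and e: "norm (grad w x - pv) \<le> e" "\<bar>w x - v y\<bar> \<le> e"
      and t: "0 \<le> t" "t * (\<xi> \<bullet> \<xi>) + e \<le> min \<theta> 1" "e < \<kappa> * t * (\<xi> \<bullet> \<xi>)"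
      by (elim exE conjE)
    have "0 \<le> t * (\<xi> \<bullet> \<xi>)" using t(1) by simp
    then have e1: "e \<le> 1" using t(2) by linarith
    have xc: "x \<in> cball a r" "y \<in> cball a r" using xy by auto
    have Qb: "\<bar>h \<bullet> (Qv *v h)\<bar> \<le> R * (h \<bullet> h)" "\<bar>h \<bullet> (Qw *v h)\<bar> \<le> R * (h \<bullet> h)" for h
    proof -
      have "(L + 1) * (h \<bullet> h) \<le> R * (h \<bullet> h)" "(L + 2) * (h \<bullet> h) \<le> R * (h \<bullet> h)"
        using B1(1) B2(1) by (intro mult_right_mono; simp add: R_def)+
      moreover have "\<bar>h \<bullet> (Qv *v h)\<bar> \<le> (L + 2) * (h \<bullet> h)"
        using t(2) by (intro hopf_hessian_bound[OF Qw[rule_format] d[rule_format] t(1)]) simp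
      ultimately show "\<bar>h \<bullet> (Qv *v h)\<bar> \<le> R * (h \<bullet> h)" "\<bar>h \<bullet> (Qw *v h)\<bar> \<le> R * (h \<bullet> h)"
        using Qw[rule_format, of h] by linarith+
    qed
    have "\<bar>w x\<bar> \<le> B1" "norm (grad w x) \<le> B2" using B1(2)[OF xc(1)] B2(2)[OF xc(1)] by simp_all
    moreover have "norm pv \<le> norm (grad w x) + e"
      using norm_triangle_ineq2[of pv "grad w x"] e(1) by (simp add: norm_minus_commute)
    ultimately have R1: "\<bar>w x\<bar> \<le> R" "\<bar>v y\<bar> \<le> R" "norm (grad w x) \<le> R" "norm pv \<le> R"
      using B1(1) B2(1) L0 e(2) e1 unfolding R_def by linarith+
    have "w a - 2 < v y" using e(2) e1 r(4)[OF xc(1)] by linarith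
    moreover have "t * (\<xi> \<bullet> \<xi>) + e \<le> \<theta>" using t(2) by simp
    ultimately show "touching_jets R \<kappa> \<theta> a r w v"
      unfolding touching_jets_def
      by (intro exI[of _ x] exI[of _ y] exI[of _ t] exI[of _ e] exI[of _ \<xi>] exI[of _ "grad w x"] exI[of _ pv]
          exI[of _ Qw] exI[of _ Qv] conjI allI xc Q jw jv R1 Qb d[rule_format] e t(1,3))
  qed
qed

text \<open>Here the regular function w = ln u2 lies on top: its jet from below tests the
  super-solution, and the jet of v from above tests the sub-solution.\<close>

lemma no_touching_smooth_super:
  fixes \<Omega> \<Gamma> :: "(real^'n) set" and f u1 :: "real^'n \<Rightarrow> real" and u2 :: "real^'n \<Rightarrow> ereal"
  assumes n: "CARD('n) \<ge> 3" and \<Omega>: "open \<Omega>" and \<Gamma>: "open \<Gamma>" "continuous_on (closure \<Gamma>) f"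
    and S: "S1 f \<Gamma>" "S2 f \<Gamma>" "S3 f \<Gamma>" "S4 f \<Gamma>" "S5 f \<Gamma>"
    and u1: "usc_on \<Omega> u1" and u2: "\<forall>x\<in>\<Omega>. 0 < u2 x" "\<forall>x\<in>\<Omega>. u2 x < \<infinity>"
    and visc: "visc_sub f \<Gamma> \<Omega> u1" "visc_super f \<Gamma> \<Omega> u2"
    and le: "\<forall>x\<in>\<Omega>. ereal (u1 x) \<le> u2 x"
    and C11: "C11_loc \<Omega> (\<lambda>x. ln (real_of_ereal (u2 x)))"
    and a: "a \<in> \<Omega>" "ereal (u1 a) = u2 a"
    and z0: "dist z0 a = \<rho>" "\<rho> > 0" "cball z0 \<rho> \<subseteq> insert a {x \<in> \<Omega>. ereal (u1 x) < u2 x}"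
  shows False
proof -
  define w where "w x = ln (real_of_ereal (u2 x))" for x
  have C11w: "C11_loc \<Omega> w" using C11 by (simp add: w_def[abs_def])
  have u2w: "u2 x = ereal (exp (w x))" if "x \<in> \<Omega>" for x
    using u2 that by (cases "u2 x") (auto simp: w_def)
  have le': "u1 x \<le> exp (w x)" if "x \<in> \<Omega>" for x using le u2w[OF that] that by auto
  from hopf_jets_C11_loc[OF \<Omega> C11w a(1) z0(1,2)] obtain r R where
    r: "r > 0" and R: "R \<ge> 1" and r\<Omega>: "cball a r \<subseteq> \<Omega>" and near: "\<forall>x\<in>cball a r. w x > w a - 1" and
    jets: "\<forall>v \<kappa> \<theta>. usc_on (cball a r) v \<and> (\<forall>x\<in>cball a r. v x \<le> w x) \<and> v a = w a \<and>
       (\<forall>x\<in>cball a r. dist z0 x \<le> \<rho> \<and> x \<noteq> a \<longrightarrow> v x < w x) \<and> \<kappa> > 0 \<and> \<theta> > 0 \<longrightarrow>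
     touching_jets R \<kappa> \<theta> a r w v"
    by (elim exE conjE)
  from ellipticity_contradiction[OF n \<Gamma> S R] obtain \<kappa> \<theta> where \<kappa>: "\<kappa> > 0" and \<theta>: "\<theta> > 0" and contra: "jets_exclusive f \<Gamma> R \<kappa> \<theta>"
    by (elim exE conjE)
  \<comment> \<open>u1 may vanish. The cutoff lies below exp w on the whole ball, so the ordering,
    the contact at a and the strict inequality survive it.\<close>
  define \<mu> where "\<mu> = exp (w a - 2)"
  define v where "v x = ln (max (u1 x) \<mu>)" for x
  have \<mu>: "\<mu> > 0" by (simp add: \<mu>_def)
  have vexp: "exp (v x) = max (u1 x) \<mu>" for x using \<mu> by (simp add: v_def)
  have \<mu>w: "\<mu> < exp (w x)" if "x \<in> cball a r" for x using near[rule_format, OF that] by (simp add: \<mu>_def)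
  have vlt: "v x < c \<longleftrightarrow> u1 x < exp c \<and> \<mu> < exp c" for x c
    using vexp[of x] exp_less_cancel_iff[of "v x" c] by simp
  have vle: "v x \<le> c \<longleftrightarrow> u1 x \<le> exp c \<and> \<mu> \<le> exp c" for x c
    using vexp[of x] exp_le_cancel_iff[of "v x" c] by simp
  have "usc_on (cball a r) v"
    unfolding usc_on_def
  proof (intro ballI allI impI)
    fix x c assume "x \<in> cball a r" "v x < c"
    then have "\<forall>\<^sub>F y in at x within cball a r. u1 y < exp c" "\<mu> < exp c"
      using usc_on_subset[OF u1 r\<Omega>] by (auto simp: usc_on_def vlt)
    then show "\<forall>\<^sub>F y in at x within cball a r. v y < c" by (simp add: vlt)
  qed
  moreover have "\<forall>x\<in>cball a r. v x \<le> w x"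
    using le' \<mu>w r\<Omega> by (auto simp: vle less_imp_le subset_iff)
  moreover have "v a = w a"
  proof -
    have "u1 a = exp (w a)" using a u2w[OF a(1)] by simp
    then show ?thesis using \<mu>w[of a] r by (simp add: v_def max_def)
  qed
  moreover have "\<forall>x\<in>cball a r. dist z0 x \<le> \<rho> \<and> x \<noteq> a \<longrightarrow> v x < w x"
  proof (intro ballI impI)
    fix x assume x: "x \<in> cball a r" "dist z0 x \<le> \<rho> \<and> x \<noteq> a"
    then have "x \<in> insert a {x \<in> \<Omega>. ereal (u1 x) < u2 x}" using z0(3) by auto
    then have "x \<in> \<Omega>" "ereal (u1 x) < u2 x" using x by auto
    then show "v x < w x" using u2w[of x] \<mu>w[OF x(1)] by (simp add: vlt)
  qed
  ultimately have "touching_jets R \<kappa> \<theta> a r w v"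
    using jets[rule_format, of v \<kappa> \<theta>] \<kappa> \<theta> by simp
  then obtain x y t e \<xi> pw pv Qw Qv where
    xy: "x \<in> cball a r" "y \<in> cball a r" and Q: "transpose Qw = Qw" "transpose Qv = Qv"
    and jw: "\<forall>\<^sub>F z in nhds x. quad_poly (w x) pw Qw x z \<le> w z"
    and jv: "\<forall>\<^sub>F z in nhds y. v z \<le> quad_poly (v y) pv Qv y z"
    and bd: "\<bar>w x\<bar> \<le> R" "\<bar>v y\<bar> \<le> R" "norm pw \<le> R" "norm pv \<le> R"
      "\<forall>h. \<bar>h \<bullet> (Qw *v h)\<bar> \<le> R * (h \<bullet> h)" "\<forall>h. \<bar>h \<bullet> (Qv *v h)\<bar> \<le> R * (h \<bullet> h)"
    and d: "\<forall>h. \<bar>h \<bullet> (Qw *v h) - h \<bullet> (Qv *v h) - t * (\<xi> \<bullet> h)\<^sup>2\<bar> \<le> e * (h \<bullet> h)"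
    and e: "norm (pw - pv) \<le> e" "\<bar>w x - v y\<bar> \<le> e" and vy: "w a - 2 < v y"
    and t: "0 \<le> t" "t * (\<xi> \<bullet> \<xi>) + e \<le> \<theta>" "e < \<kappa> * t * (\<xi> \<bullet> \<xi>)"
    unfolding touching_jets_def by (elim exE conjE)
  have x\<Omega>: "x \<in> \<Omega>" "y \<in> \<Omega>" using xy r\<Omega> by auto
  have "\<forall>\<^sub>F z in nhds x. z \<in> \<Omega>" by (rule eventually_nhds_in_open[OF \<Omega> x\<Omega>(1)])
  with jw have "\<forall>\<^sub>F z in nhds x. ereal (exp (quad_poly (w x) pw Qw x z)) \<le> u2 z"
    by eventually_elim (simp add: u2w)
  from visc_super_jet[OF visc(2) n x\<Omega>(1) Q(1) u2w[OF x\<Omega>(1)] this]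
  have super: "eigvals (log_conf_hess (w x) pw Qw) \<in> closure \<Gamma>"
    "f (eigvals (log_conf_hess (w x) pw Qw)) \<ge> 1" by auto
  have "\<mu> < exp (v y)" using vy by (simp add: \<mu>_def)
  then have u1y: "u1 y = exp (v y)" using vexp[of y] by (simp add: max_def split: if_splits)
  \<comment> \<open>exp v is at least u1 everywhere and equals it at y, so a function above v near y
    also tests u1.\<close>
  have "\<forall>\<^sub>F z in nhds y. u1 z \<le> exp (quad_poly (v y) pv Qv y z)"
    using jv by eventually_elim (simp add: vle)
  from visc_sub_jet[OF visc(1) n x\<Omega>(2) Q(2) u1y this]
  have sub: "eigvals (log_conf_hess (v y) pv Qv) \<notin> closure \<Gamma> \<or> f (eigvals (log_conf_hess (v y) pv Qv)) \<le> 1" .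
  have "norm (pv - pw) \<le> e" "\<bar>v y - w x\<bar> \<le> e" using e by (simp_all add: norm_minus_commute abs_minus_commute)
  with bd Q d t sub super show False
    by (intro contra[unfolded jets_exclusive_def, rule_format, of "v y" "w x" pv pw Qv Qw t \<xi> e] conjI)
qed

text \<open>Negated logarithms put the regular function on top again: w = - ln u1 lies above v = -
  ln u2. The test functions change sign as well, so the jet of w now tests the sub-solution.\<close>

lemma no_touching_smooth_sub:
  fixes \<Omega> \<Gamma> :: "(real^'n) set" and f u1 :: "real^'n \<Rightarrow> real" and u2 :: "real^'n \<Rightarrow> ereal"
  assumes n: "CARD('n) \<ge> 3" and \<Omega>: "open \<Omega>" and \<Gamma>: "open \<Gamma>" "continuous_on (closure \<Gamma>) f"
    and S: "S1 f \<Gamma>" "S2 f \<Gamma>" "S3 f \<Gamma>" "S4 f \<Gamma>" "S5 f \<Gamma>"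
    and u2: "lsc_on \<Omega> u2" "\<forall>x\<in>\<Omega>. 0 < u2 x" and u1: "\<forall>x\<in>\<Omega>. 0 < u1 x"
    and visc: "visc_sub f \<Gamma> \<Omega> u1" "visc_super f \<Gamma> \<Omega> u2"
    and le: "\<forall>x\<in>\<Omega>. ereal (u1 x) \<le> u2 x"
    and C11: "C11_loc \<Omega> (\<lambda>x. ln (u1 x))"
    and a: "a \<in> \<Omega>" "ereal (u1 a) = u2 a"
    and z0: "dist z0 a = \<rho>" "\<rho> > 0" "cball z0 \<rho> \<subseteq> insert a {x \<in> \<Omega>. ereal (u1 x) < u2 x}"
  shows False
proof -
  define w where "w x = - ln (u1 x)" for x
  have C11w: "C11_loc \<Omega> w" using C11_loc_uminus[OF C11 \<Omega>] by (simp add: w_def[abs_def])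
  have u1w: "u1 x = exp (- w x)" if "x \<in> \<Omega>" for x
    using u1 that by (simp add: w_def)
  from hopf_jets_C11_loc[OF \<Omega> C11w a(1) z0(1,2)] obtain r R where
    r: "r > 0" and R: "R \<ge> 1" and r\<Omega>: "cball a r \<subseteq> \<Omega>" and near: "\<forall>x\<in>cball a r. w x > w a - 1" and
    jets: "\<forall>v \<kappa> \<theta>. usc_on (cball a r) v \<and> (\<forall>x\<in>cball a r. v x \<le> w x) \<and> v a = w a \<and>
       (\<forall>x\<in>cball a r. dist z0 x \<le> \<rho> \<and> x \<noteq> a \<longrightarrow> v x < w x) \<and> \<kappa> > 0 \<and> \<theta> > 0 \<longrightarrow>
     touching_jets R \<kappa> \<theta> a r w v"
    by (elim exE conjE)
  from ellipticity_contradiction[OF n \<Gamma> S R] obtain \<kappa> \<theta> where \<kappa>: "\<kappa> > 0" and \<theta>: "\<theta> > 0" and contra: "jets_exclusive f \<Gamma> R \<kappa> \<theta>"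
    by (elim exE conjE)
  define \<mu> where "\<mu> = exp (2 - w a)"
  \<comment> \<open>u2 may be infinite. Taking the minimum with a finite level first keeps
    \<open>real_of_ereal\<close> away from its default value 0 at infinity; - ln m is the truncation
    of - ln u2 from below at w a - 2.\<close>
  define m where "m x = real_of_ereal (min (u2 x) (ereal \<mu>))" for x
  define v where "v x = - ln (m x)" for x
  have \<mu>: "\<mu> > 0" by (simp add: \<mu>_def)
  have m: "ereal (m x) = min (u2 x) (ereal \<mu>)" "m x > 0" if "x \<in> \<Omega>" for x
  proof -
    have "0 < min (u2 x) (ereal \<mu>)" using u2(2) that \<mu> by simp
    moreover have "min (u2 x) (ereal \<mu>) \<le> ereal \<mu>" by simp
    ultimately show "ereal (m x) = min (u2 x) (ereal \<mu>)" "m x > 0"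
      unfolding m_def by (cases "min (u2 x) (ereal \<mu>)"; simp)+
  qed
  have vexp: "ereal (exp (- v x)) = min (u2 x) (ereal \<mu>)" if "x \<in> \<Omega>" for x
    using m[OF that] by (simp add: v_def)
  have \<mu>w: "exp (- w x) < \<mu>" if "x \<in> cball a r" for x using near[rule_format, OF that] by (simp add: \<mu>_def)
  have vlt: "v x < c \<longleftrightarrow> ereal (exp (- c)) < u2 x \<and> exp (- c) < \<mu>" if "x \<in> \<Omega>" for x c
  proof -
    have "v x < c \<longleftrightarrow> ereal (exp (- c)) < ereal (exp (- v x))" by simp
    then show ?thesis unfolding vexp[OF that] by simp
  qed
  have vle: "v x \<le> c \<longleftrightarrow> ereal (exp (- c)) \<le> u2 x \<and> exp (- c) \<le> \<mu>" if "x \<in> \<Omega>" for x c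
  proof -
    have "v x \<le> c \<longleftrightarrow> ereal (exp (- c)) \<le> ereal (exp (- v x))" by simp
    then show ?thesis unfolding vexp[OF that] by simp
  qed
  have "usc_on (cball a r) v"
    unfolding usc_on_def
  proof (intro ballI allI impI)
    fix x c assume x: "x \<in> cball a r" "v x < c"
    then have x\<Omega>: "x \<in> \<Omega>" using r\<Omega> by blast
    then have "\<forall>\<^sub>F y in at x within \<Omega>. ereal (exp (- c)) < u2 y" and c: "exp (- c) < \<mu>"
      using u2(1) x(2) by (auto simp: lsc_on_def vlt)
    then have "\<forall>\<^sub>F y in at x within cball a r. ereal (exp (- c)) < u2 y"
      using at_le[OF r\<Omega>] filter_leD by blast
    moreover have "\<forall>\<^sub>F y in at x within cball a r. y \<in> cball a r" by (simp add: eventually_at_filter)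
    ultimately show "\<forall>\<^sub>F y in at x within cball a r. v y < c"
    proof eventually_elim
      case (elim y)
      then have "y \<in> \<Omega>" using r\<Omega> by blast
      then show ?case using elim(1) c by (simp add: vlt)
    qed
  qed
  moreover have "\<forall>x\<in>cball a r. v x \<le> w x"
  proof
    fix x assume x: "x \<in> cball a r"
    then have x\<Omega>: "x \<in> \<Omega>" using r\<Omega> by blast
    then show "v x \<le> w x" using le[rule_format, OF x\<Omega>] u1w[of x] \<mu>w[OF x] by (simp add: vle less_imp_le)
  qed
  moreover have "v a = w a"
  proof -
    have "u2 a = ereal (exp (- w a))" using a u1w[OF a(1)] by simp
    then have "ereal (exp (- v a)) = ereal (exp (- w a))"
      unfolding vexp[OF a(1)] using \<mu>w[of a] r by (simp add: min_def)
    then show ?thesis by simp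
  qed
  moreover have "\<forall>x\<in>cball a r. dist z0 x \<le> \<rho> \<and> x \<noteq> a \<longrightarrow> v x < w x"
  proof (intro ballI impI)
    fix x assume x: "x \<in> cball a r" "dist z0 x \<le> \<rho> \<and> x \<noteq> a"
    then have "x \<in> insert a {x \<in> \<Omega>. ereal (u1 x) < u2 x}" using z0(3) by auto
    then have "x \<in> \<Omega>" "ereal (u1 x) < u2 x" using x by auto
    then show "v x < w x" using u1w[of x] \<mu>w[OF x(1)] by (simp add: vlt)
  qed
  ultimately have "touching_jets R \<kappa> \<theta> a r w v"
    using jets[rule_format, of v \<kappa> \<theta>] \<kappa> \<theta> by simp
  then obtain x y t e \<xi> pw pv Qw Qv where
    xy: "x \<in> cball a r" "y \<in> cball a r" and Q: "transpose Qw = Qw" "transpose Qv = Qv"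
    and jw: "\<forall>\<^sub>F z in nhds x. quad_poly (w x) pw Qw x z \<le> w z"
    and jv: "\<forall>\<^sub>F z in nhds y. v z \<le> quad_poly (v y) pv Qv y z"
    and bd: "\<bar>w x\<bar> \<le> R" "\<bar>v y\<bar> \<le> R" "norm pw \<le> R" "norm pv \<le> R"
      "\<forall>h. \<bar>h \<bullet> (Qw *v h)\<bar> \<le> R * (h \<bullet> h)" "\<forall>h. \<bar>h \<bullet> (Qv *v h)\<bar> \<le> R * (h \<bullet> h)"
    and d: "\<forall>h. \<bar>h \<bullet> (Qw *v h) - h \<bullet> (Qv *v h) - t * (\<xi> \<bullet> h)\<^sup>2\<bar> \<le> e * (h \<bullet> h)"
    and e: "norm (pw - pv) \<le> e" "\<bar>w x - v y\<bar> \<le> e" and vy: "w a - 2 < v y"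
    and t: "0 \<le> t" "t * (\<xi> \<bullet> \<xi>) + e \<le> \<theta>" "e < \<kappa> * t * (\<xi> \<bullet> \<xi>)"
    unfolding touching_jets_def by (elim exE conjE)
  have x\<Omega>: "x \<in> \<Omega>" "y \<in> \<Omega>" using xy r\<Omega> by auto
  have "\<forall>\<^sub>F z in nhds x. z \<in> \<Omega>" by (rule eventually_nhds_in_open[OF \<Omega> x\<Omega>(1)])
  with jw have "\<forall>\<^sub>F z in nhds x. u1 z \<le> exp (quad_poly (- w x) (- pw) (- Qw) x z)"
    by eventually_elim (simp add: u1w quad_poly_uminus)
  from visc_sub_jet[OF visc(1) n x\<Omega>(1) _ u1w[OF x\<Omega>(1)] this]
  have sub: "eigvals (log_conf_hess (- w x) (- pw) (- Qw)) \<notin> closure \<Gamma> \<or>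
    f (eigvals (log_conf_hess (- w x) (- pw) (- Qw))) \<le> 1" using Q(1) by simp
  have "exp (- v y) < \<mu>" using vy by (simp add: \<mu>_def)
  then have u2y: "u2 y = ereal (exp (- v y))"
    using vexp[OF x\<Omega>(2)] by (simp add: min_def split: if_splits)
  have "\<forall>\<^sub>F z in nhds y. z \<in> \<Omega>" by (rule eventually_nhds_in_open[OF \<Omega> x\<Omega>(2)])
  with jv have "\<forall>\<^sub>F z in nhds y. ereal (exp (quad_poly (- v y) (- pv) (- Qv) y z)) \<le> u2 z"
    by eventually_elim (simp add: quad_poly_uminus vle)
  from visc_super_jet[OF visc(2) n x\<Omega>(2) _ u2y this]
  have super: "eigvals (log_conf_hess (- v y) (- pv) (- Qv)) \<in> closure \<Gamma>"
    "f (eigvals (log_conf_hess (- v y) (- pv) (- Qv))) \<ge> 1" using Q(2) by auto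
  have neg: "\<bar>- w x\<bar> \<le> R" "\<bar>- v y\<bar> \<le> R" "norm (- pw) \<le> R" "norm (- pv) \<le> R"
    "transpose (- Qw) = - Qw" "transpose (- Qv) = - Qv"
    "\<forall>h. \<bar>h \<bullet> (- Qw *v h)\<bar> \<le> R * (h \<bullet> h)" "\<forall>h. \<bar>h \<bullet> (- Qv *v h)\<bar> \<le> R * (h \<bullet> h)"
    using bd Q by simp_all
  \<comment> \<open>The sign change and the exchange of roles cancel: (- Qv) - (- Qw) = Qw - Qv, so
    the gain keeps its sign.\<close>
  have "\<forall>h. \<bar>h \<bullet> (- Qv *v h) - h \<bullet> (- Qw *v h) - t * (\<xi> \<bullet> h)\<^sup>2\<bar> \<le> e * (h \<bullet> h)"
    using d by (simp add: algebra_simps)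
  moreover have "norm (- pw - - pv) \<le> e" "\<bar>- w x - - v y\<bar> \<le> e"
    using e by (simp_all add: norm_minus_commute abs_minus_commute)
  ultimately show False using neg t sub super
    by (intro contra[unfolded jets_exclusive_def, rule_format, of "- w x" "- v y" "- pw" "- pv" "- Qw" "- Qv" t \<xi> e] conjI)
qed

theorem theorem1p1:
  fixes \<Omega> \<Gamma> :: "(real^'n) set"
    and f :: "real^'n \<Rightarrow> real"
    and u1 :: "real^'n \<Rightarrow> real"
    and u2 :: "real^'n \<Rightarrow> ereal"
  assumes "CARD('n) \<ge> 3"
    and "open \<Omega>" and "connected \<Omega>"
    and "open \<Gamma>" and "\<Gamma> \<noteq> {}"
    and "continuous_on (closure \<Gamma>) f"
    and "S1 f \<Gamma>" and "S2 f \<Gamma>" and "S3 f \<Gamma>" and "S4 f \<Gamma>" and "S5 f \<Gamma>"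
    and "usc_on \<Omega> u1" and "\<forall>x\<in>\<Omega>. 0 \<le> u1 x"
    and "lsc_on \<Omega> u2" and "\<forall>x\<in>\<Omega>. 0 < u2 x"
    and "visc_sub f \<Gamma> \<Omega> u1"
    and "visc_super f \<Gamma> \<Omega> u2"
    and "\<forall>x\<in>\<Omega>. ereal (u1 x) \<le> u2 x"
    and "((\<forall>x\<in>\<Omega>. 0 < u1 x) \<and> C11_loc \<Omega> (\<lambda>x. ln (u1 x))) \<or>
         ((\<forall>x\<in>\<Omega>. u2 x < \<infinity>) \<and> C11_loc \<Omega> (\<lambda>x. ln (real_of_ereal (u2 x))))"
  shows "(\<forall>x\<in>\<Omega>. ereal (u1 x) = u2 x) \<or> (\<forall>x\<in>\<Omega>. ereal (u1 x) < u2 x)"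
proof (rule ccontr)
  assume neg: "\<not> ?thesis"
  define U where "U = {x \<in> \<Omega>. ereal (u1 x) < u2 x}"
  have ne: "U \<noteq> {}" "U \<noteq> \<Omega>"
    using neg assms(18) by (auto simp: U_def less_le)
  have "open U" unfolding U_def by (rule usc_lsc_open_less[OF assms(2,12,14)])
  moreover have "U \<subseteq> \<Omega>" by (auto simp: U_def)
  ultimately obtain a z0 where a: "a \<in> \<Omega> - U" and z0: "dist z0 a > 0" "cball z0 (dist z0 a) \<subseteq> insert a U"
    using connected_touching_ball[OF assms(2,3) _ _ ne] by blast
  have eq: "a \<in> \<Omega>" "ereal (u1 a) = u2 a" using a assms(18) by (auto simp: U_def less_le)
  from assms(19) show False
  proof (elim disjE conjE)
    assume "\<forall>x\<in>\<Omega>. 0 < u1 x" "C11_loc \<Omega> (\<lambda>x. ln (u1 x))"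
    then show False
      using no_touching_smooth_sub[OF assms(1,2,4,6-11,14,15) _ assms(16-18) _ eq refl z0[unfolded U_def]] by blast
  next
    assume "\<forall>x\<in>\<Omega>. u2 x < \<infinity>" "C11_loc \<Omega> (\<lambda>x. ln (real_of_ereal (u2 x)))"
    then show False
      using no_touching_smooth_super[OF assms(1,2,4,6-12,15) _ assms(16-18) _ eq refl z0[unfolded U_def]] by blast
  qed
qed

end
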